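(* Let $S=\Bbbk[x_1,\dots,x_n]$ be a polynomial ring over a field $\Bbbk$. Let $I$ be a monomial ideal of $S$ and let $M$ be a finitely generated multigraded ($\mathbb N^n$-graded) $S$-module such that $\mathrm{Gens}(I)\cap\mathrm{Gens}(M)=\emptyset$. Let $F_\bullet$ and $G_\bullet$ be the minimal multigraded free resolutions of $S/I$ and $M$, respectively. Then the complex $F_\bullet * G_\bullet$ is a multigraded free resolution of $M/IM$.
   Context: $S$ carries its standard $\mathbb N^n$-grading, where $x_i$ has degree the $i$-th unit vector; "multigraded" means $\mathbb N^n$-graded. For a homogeneous element $m$ of a multigraded module, of degree $(a_1,\dots,a_n)\in\mathbb N^n$, write $u_m=x_1^{a_1}\cdots x_n^{a_n}$ for the unique monomial of $S$ with the same degree as $m$. For monomials $u,v$, $[u,v]$ denotes their least common multiple. Gens. For a finitely generated multigraded $S$-module $M$, $\mathrm{Gens}(M)$ is the set of variables $x_i$ such that $x_i$ divides $u_m$ for some member $m$ of a minimal (multihomogeneous) generating set of $M$; it is empty if $M$ is generated in degree zero. For a monomial ideal $I$, $\mathrm{Gens}(I)$ is the set of variables occurring in the minimal monomial generators of $I$. $*$-product of free modules. Let $F$ and $G$ be multigraded free $S$-modules with homogeneous bases $B$ and $C$. Then $F*G$ is the multigraded free $S$-module with basis the symbols $f*g$ ($f\in B$, $g\in C$), where $f*g$ has the multidegree of the monomial $[u_f,u_g]$. $*$-product with maps. A multigraded (degree-preserving) homomorphism $\varphi:F\to G$ of multigraded free modules with homogeneous bases $B$, $C$ has the form $\varphi(f)=\sum_{g\in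 C}a_{fg}u_{fg}\,g$ for $f\in B$, where $a_{fg}\in\Bbbk$, $u_{fg}=u_f/u_g$ if $u_g$ divides $u_f$, and the term is zero (take $a_{fg}=0$) if $u_g$ does not divide $u_f$. If $H$ is another multigraded free module with homogeneous basis $D$, define $\varphi*\mathrm{Id}(H):F*H\to G*H$ by $$(\varphi*\mathrm{Id}(H))(f*h)=\sum_{g\in C}a_{fg}\,u_{hfg}\; g*h,$$ and $\mathrm{Id}(H)*\varphi:H*F\to H*G$ by $$(\mathrm{Id}(H)*\varphi)(h*f)=\sum_{g\in C}a_{fg}\,u_{hfg}\; h*g,$$ for $f\in B$, $h\in D$, where $u_{hfg}=[u_h,u_f]/[u_h,u_g]$. $*$-product of complexes. Let $(F_\bullet,\varphi)$ and $(G_\bullet,\psi)$ be complexes of multigraded free $S$-modules (with chosen homogeneous bases) and multigraded maps. The complex $(F_\bullet*G_\bullet,\alpha)$ is given by $(F_\bullet*G_\bullet)_i=\bigoplus_{j+k=i}F_j*G_k$ with differential $$\alpha_i=\sum_{j+k=i}\varphi_j*\mathrm{Id}(G_k)+(-1)^j\,\mathrm{Id}(F_j)*\psi_k .$$ That a complex $C_\bullet$ of multigraded free modules (concentrated in degrees $\ge 0$) is a multigraded free resolution of $M/IM$ means $H_i(C_\bullet)=0$ for $i>0$ and $H_0(C_\bullet)\cong M/IM$. *)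

theory Defs
  imports
    "HOL-Library.Poly_Mapping"
    "HOL-Library.Function_Algebras"
    "HOL-Algebra.Module"
    "HOL-Algebra.Ideal"
    "HOL-Algebra.Algebraic_Closure_Type"
begin

section \<open>The polynomial ring and its monomials\<close>

text \<open>
  The variables \<open>x\<^sub>i\<close> are indexed by the elements \<open>i\<close> of a finite type \<open>'v\<close>, so the number \<open>n\<close> of
  variables is \<open>CARD('v)\<close>. A monomial is represented by its exponent vector; on exponent vectors
  all operations are pointwise: \<open>+\<close> is multiplication of monomials, \<open>\<le>\<close> is divisibility, \<open>sup\<close> is
  the least common multiple and \<open>-\<close> is the (exact) quotient.
\<close>

type_synonym 'v expo = "'v \<Rightarrow> nat"

type_synonym ('v, 'k) mpoly = "('v \<Rightarrow> nat) \<Rightarrow>\<^sub>0 'k"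

abbreviation mpoly_ring :: "('v, 'k::field) mpoly ring"
  where "mpoly_ring \<equiv> ring_of_type_algebra"

definition monomial :: "'v expo \<Rightarrow> ('v, 'k::field) mpoly"
  where "monomial a = Poly_Mapping.single a 1"

definition variable :: "'v \<Rightarrow> ('v, 'k::field) mpoly"
  where "variable i = monomial (\<lambda>j. if j = i then 1 else 0)"

definition irrelevant_ideal :: "('v, 'k::field) mpoly set"
  where "irrelevant_ideal = Idl\<^bsub>mpoly_ring\<^esub> (range variable)"

definition monomial_ideal :: "('v, 'k::field) mpoly set \<Rightarrow> bool"
  where "monomial_ideal I \<longleftrightarrow> (\<exists>A. I = Idl\<^bsub>mpoly_ring\<^esub> (monomial ` A))"

definition minimal_monomial_generators :: "('v, 'k::field) mpoly set \<Rightarrow> 'v expo set \<Rightarrow> bool"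
  where "minimal_monomial_generators I A \<longleftrightarrow>
    Idl\<^bsub>mpoly_ring\<^esub> (monomial ` A) = I \<and> (\<forall>B. B \<subset> A \<longrightarrow> Idl\<^bsub>mpoly_ring\<^esub> (monomial ` B) \<noteq> I)"

definition Gens_ideal :: "('v, 'k::field) mpoly set \<Rightarrow> 'v set"
  where "Gens_ideal I = {i. \<exists>A. minimal_monomial_generators I A \<and> (\<exists>a\<in>A. 0 < a i)}"


section \<open>Multigraded modules\<close>

text \<open>\<open>gcomp M a\<close> is the homogeneous component of \<open>M\<close> in degree \<open>a\<close>.\<close>

record ('v, 's, 'm) graded_module = "('s, 'm) module" +
  gcomp :: "'v expo \<Rightarrow> 'm set"

type_synonym ('v, 'k, 'm) gmod = "('v, ('v, 'k) mpoly, 'm) graded_module"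

locale multigraded_module = module mpoly_ring M
  for M :: "('v::finite, 'k::field, 'm) gmod" (structure) +
  assumes gcomp_subgroup: "subgroup (gcomp M a) (add_monoid M)"
    and gcomp_smult: "x \<in> gcomp M a \<Longrightarrow> Poly_Mapping.single b c \<odot> x \<in> gcomp M (b + a)"
    and gcomp_direct_sum: "x \<in> carrier M \<Longrightarrow>
      \<exists>!c. (\<forall>a. c a \<in> gcomp M a) \<and> finite {a. c a \<noteq> \<zero>} \<and> x = (\<Oplus>a\<in>{a. c a \<noteq> \<zero>}. c a)"

definition mspan :: "('v, 'k::field, 'm) gmod \<Rightarrow> 'm set \<Rightarrow> 'm set"
  where "mspan M A = \<Inter>{N. submodule N mpoly_ring M \<and> A \<subseteq> N}"

definition finitely_generated :: "('v, 'k::field, 'm) gmod \<Rightarrow> bool"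
  where "finitely_generated M \<longleftrightarrow> (\<exists>A. finite A \<and> A \<subseteq> carrier M \<and> mspan M A = carrier M)"

definition minimal_homogeneous_generators :: "('v, 'k::field, 'm) gmod \<Rightarrow> 'm set \<Rightarrow> bool"
  where "minimal_homogeneous_generators M A \<longleftrightarrow>
    (\<forall>m\<in>A. \<exists>a. m \<in> gcomp M a) \<and> mspan M A = carrier M \<and>
    (\<forall>B. B \<subset> A \<longrightarrow> mspan M B \<noteq> carrier M)"

text \<open>
  The degree of a nonzero homogeneous element, i.e. the exponent vector of the monomial \<open>u\<^sub>m\<close>.
  (A minimal generating set never contains \<open>0\<close>, whose degree is not determined.)
\<close>

definition mdegree :: "('v, 'k::field, 'm) gmod \<Rightarrow> 'm \<Rightarrow> 'v expo"
  where "mdegree M m = (THE a. m \<in> gcomp M a)"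

definition Gens_module :: "('v, 'k::field, 'm) gmod \<Rightarrow> 'v set"
  where "Gens_module M =
    {i. \<exists>A. minimal_homogeneous_generators M A \<and> (\<exists>m\<in>A. 0 < mdegree M m i)}"

definition graded_hom ::
  "('v, 'k::field, 'm) gmod \<Rightarrow> ('v, 'k, 'n) gmod \<Rightarrow> ('m \<Rightarrow> 'n) \<Rightarrow> bool"
  where "graded_hom M N h \<longleftrightarrow>
    h \<in> carrier M \<rightarrow> carrier N \<and>
    (\<forall>x\<in>carrier M. \<forall>y\<in>carrier M. h (x \<oplus>\<^bsub>M\<^esub> y) = h x \<oplus>\<^bsub>N\<^esub> h y) \<and>
    (\<forall>s. \<forall>x\<in>carrier M. h (s \<odot>\<^bsub>M\<^esub> x) = s \<odot>\<^bsub>N\<^esub> h x) \<and>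
    (\<forall>a. h ` gcomp M a \<subseteq> gcomp N a)"

definition graded_isomorphic ::
  "('v, 'k::field, 'm) gmod \<Rightarrow> ('v, 'k, 'n) gmod \<Rightarrow> bool"
  where "graded_isomorphic M N \<longleftrightarrow>
    (\<exists>h. graded_hom M N h \<and> bij_betw h (carrier M) (carrier N))"

text \<open>
  Submodules and quotients (meant for graded submodules \<open>N\<close>). The record fields \<open>mult\<close> and \<open>one\<close>
  are not part of the module structure and are left unspecified.
\<close>

definition restrict_module :: "('v, 'k::field, 'm) gmod \<Rightarrow> 'm set \<Rightarrow> ('v, 'k, 'm) gmod"
  where "restrict_module M N = M\<lparr>carrier := N, gcomp := \<lambda>a. gcomp M a \<inter> N\<rparr>"

definition quotient_module ::
  "('v, 'k::field, 'm) gmod \<Rightarrow> 'm set \<Rightarrow> ('v, 'k, 'm set) gmod"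
  where "quotient_module M N =
    \<lparr>carrier = a_rcosets\<^bsub>M\<^esub> N, monoid.mult = undefined, one = undefined,
     ring.zero = N, add = set_add M,
     module.smult = (\<lambda>s T. \<Union>x\<in>T. N +>\<^bsub>M\<^esub> (s \<odot>\<^bsub>M\<^esub> x)),
     gcomp = (\<lambda>a. (\<lambda>x. N +>\<^bsub>M\<^esub> x) ` gcomp M a)\<rparr>"

definition ideal_times_module ::
  "('v, 'k::field) mpoly set \<Rightarrow> ('v, 'k, 'm) gmod \<Rightarrow> 'm set"
  where "ideal_times_module I M = mspan M {s \<odot>\<^bsub>M\<^esub> m | s m. s \<in> I \<and> m \<in> carrier M}"

definition regular_module :: "('v, 'k::field, ('v, 'k) mpoly) gmod"
  where "regular_module =
    \<lparr>carrier = UNIV, monoid.mult = undefined, one = undefined, ring.zero = 0, add = (+),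
     module.smult = (*), gcomp = (\<lambda>a. range (Poly_Mapping.single a))\<rparr>"


section \<open>Multigraded free modules with a homogeneous basis\<close>

text \<open>
  A multigraded free module with chosen homogeneous basis is given by the basis \<open>bset\<close> and the
  degrees \<open>bdeg\<close> of its members; its elements are the formal \<open>S\<close>-linear combinations of the basis,
  and the basis element \<open>b\<close> is \<open>Poly_Mapping.single b 1\<close>.
\<close>

record ('v, 'b) graded_basis =
  bset :: "'b set"
  bdeg :: "'b \<Rightarrow> 'v expo"

type_synonym ('v, 'k, 'b) fvec = "'b \<Rightarrow>\<^sub>0 ('v, 'k) mpoly"

definition fsmult :: "('v, 'k::field) mpoly \<Rightarrow> ('v, 'k, 'b) fvec \<Rightarrow> ('v, 'k, 'b) fvec"
  where "fsmult s x = Poly_Mapping.map (\<lambda>p. s * p) x"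

definition free_module :: "('v, 'b) graded_basis \<Rightarrow> ('v, 'k::field, ('v, 'k, 'b) fvec) gmod"
  where "free_module B =
    \<lparr>carrier = {x. Poly_Mapping.keys x \<subseteq> bset B}, monoid.mult = undefined, one = undefined,
     ring.zero = 0, add = (+), module.smult = fsmult,
     gcomp = (\<lambda>a. {x. Poly_Mapping.keys x \<subseteq> bset B \<and>
       (\<forall>b. \<forall>e \<in> Poly_Mapping.keys (Poly_Mapping.lookup x b). e + bdeg B b = a)})\<rparr>"

text \<open>The \<open>S\<close>-linear map with prescribed values on a basis.\<close>

definition linear_extension ::
  "('b \<Rightarrow> ('v, 'k::field, 'c) fvec) \<Rightarrow> ('v, 'k, 'b) fvec \<Rightarrow> ('v, 'k, 'c) fvec"
  where "linear_extension t x =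
    (\<Sum>b\<in>Poly_Mapping.keys x. fsmult (Poly_Mapping.lookup x b) (t b))"


section \<open>The star product\<close>

definition star_basis :: "('v, 'b) graded_basis \<Rightarrow> ('v, 'c) graded_basis \<Rightarrow> ('v, 'b \<times> 'c) graded_basis"
  where "star_basis F G =
    \<lparr>bset = bset F \<times> bset G, bdeg = (\<lambda>(f, g). sup (bdeg F f) (bdeg G g))\<rparr>"

text \<open>
  The scalar \<open>a\<^sub>f\<^sub>g\<close>: for multigraded \<open>\<phi>\<close> the coefficient of \<open>\<phi>(f)\<close> at \<open>g\<close> is \<open>a\<^sub>f\<^sub>g u\<^sub>f / u\<^sub>g\<close>,
  respectively \<open>0\<close> if \<open>u\<^sub>g\<close> does not divide \<open>u\<^sub>f\<close>.
\<close>

definition scalar_entry ::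
  "('v, 'b) graded_basis \<Rightarrow> ('v, 'c) graded_basis \<Rightarrow>
   (('v, 'k::field, 'b) fvec \<Rightarrow> ('v, 'k, 'c) fvec) \<Rightarrow> 'b \<Rightarrow> 'c \<Rightarrow> 'k"
  where "scalar_entry F G \<phi> f g =
    (if bdeg G g \<le> bdeg F f
     then Poly_Mapping.lookup (Poly_Mapping.lookup (\<phi> (Poly_Mapping.single f 1)) g) (bdeg F f - bdeg G g)
     else 0)"

text \<open>
  The maps \<open>\<phi> * Id(H)\<close> and \<open>Id(H) * \<phi>\<close> for \<open>\<phi> : F \<rightarrow> G\<close>. The sum over the basis of \<open>G\<close> is restricted
  to the finitely many \<open>g\<close> occurring in \<open>\<phi>(f)\<close>; all other \<open>a\<^sub>f\<^sub>g\<close> vanish.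
\<close>

definition star_Id ::
  "('v, 'b) graded_basis \<Rightarrow> ('v, 'c) graded_basis \<Rightarrow>
   (('v, 'k::field, 'b) fvec \<Rightarrow> ('v, 'k, 'c) fvec) \<Rightarrow> ('v, 'd) graded_basis \<Rightarrow>
   ('v, 'k, 'b \<times> 'd) fvec \<Rightarrow> ('v, 'k, 'c \<times> 'd) fvec"
  where "star_Id F G \<phi> H = linear_extension (\<lambda>(f, h).
    \<Sum>g\<in>Poly_Mapping.keys (\<phi> (Poly_Mapping.single f 1)).
      Poly_Mapping.single (g, h)
        (Poly_Mapping.single (sup (bdeg H h) (bdeg F f) - sup (bdeg H h) (bdeg G g))
          (scalar_entry F G \<phi> f g)))"

definition Id_star ::
  "('v, 'd) graded_basis \<Rightarrow> ('v, 'b) graded_basis \<Rightarrow> ('v, 'c) graded_basis \<Rightarrow>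
   (('v, 'k::field, 'b) fvec \<Rightarrow> ('v, 'k, 'c) fvec) \<Rightarrow>
   ('v, 'k, 'd \<times> 'b) fvec \<Rightarrow> ('v, 'k, 'd \<times> 'c) fvec"
  where "Id_star H F G \<phi> = linear_extension (\<lambda>(h, f).
    \<Sum>g\<in>Poly_Mapping.keys (\<phi> (Poly_Mapping.single f 1)).
      Poly_Mapping.single (h, g)
        (Poly_Mapping.single (sup (bdeg H h) (bdeg F f) - sup (bdeg H h) (bdeg G g))
          (scalar_entry F G \<phi> f g)))"

definition direct_sum_basis ::
  "'j set \<Rightarrow> ('j \<Rightarrow> ('v, 'b) graded_basis) \<Rightarrow> ('v, 'j \<times> 'b) graded_basis"
  where "direct_sum_basis J B =
    \<lparr>bset = Sigma J (\<lambda>j. bset (B j)), bdeg = (\<lambda>(j, b). bdeg (B j) b)\<rparr>"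

definition incl :: "'j \<Rightarrow> ('v, 'k::field, 'b) fvec \<Rightarrow> ('v, 'k, 'j \<times> 'b) fvec"
  where "incl j = linear_extension (\<lambda>b. Poly_Mapping.single (j, b) 1)"

definition proj :: "'j \<Rightarrow> ('v, 'k::field, 'j \<times> 'b) fvec \<Rightarrow> ('v, 'k, 'b) fvec"
  where "proj j = linear_extension (\<lambda>(j', b). if j' = j then Poly_Mapping.single b 1 else 0)"


section \<open>Complexes of multigraded free modules\<close>

text \<open>
  Complexes are concentrated in homological degrees \<open>\<ge> 0\<close>; \<open>cdiff C i\<close> is the differential
  \<open>C\<^sub>i \<rightarrow> C\<^sub>i\<^sub>-\<^sub>1\<close>. As \<open>C\<^sub>-\<^sub>1 = 0\<close> is not represented, \<open>cdiff C 0\<close> is required to be the zero map.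
\<close>

record (overloaded) ('v, 'k, 'b) free_complex =
  cbasis :: "nat \<Rightarrow> ('v, 'b) graded_basis"
  cdiff :: "nat \<Rightarrow> ('v, 'k, 'b) fvec \<Rightarrow> ('v, 'k, 'b) fvec"

definition cmod :: "('v, 'k::field, 'b) free_complex \<Rightarrow> nat \<Rightarrow> ('v, 'k, ('v, 'k, 'b) fvec) gmod"
  where "cmod C i = free_module (cbasis C i)"

definition is_complex :: "('v, 'k::field, 'b) free_complex \<Rightarrow> bool"
  where "is_complex C \<longleftrightarrow>
    (\<forall>x\<in>carrier (cmod C 0). cdiff C 0 x = 0) \<and>
    (\<forall>i. graded_hom (cmod C (Suc i)) (cmod C i) (cdiff C (Suc i))) \<and>
    (\<forall>i. \<forall>x\<in>carrier (cmod C (Suc i)). cdiff C i (cdiff C (Suc i) x) = 0)"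

definition homology ::
  "('v, 'k::field, 'b) free_complex \<Rightarrow> nat \<Rightarrow> ('v, 'k, ('v, 'k, 'b) fvec set) gmod"
  where "homology C i = quotient_module
    (restrict_module (cmod C i) {x \<in> carrier (cmod C i). cdiff C i x = 0})
    (cdiff C (Suc i) ` carrier (cmod C (Suc i)))"

definition free_resolution ::
  "('v, 'k::field, 'b) free_complex \<Rightarrow> ('v, 'k, 'm) gmod \<Rightarrow> bool"
  where "free_resolution C N \<longleftrightarrow>
    is_complex C \<and>
    (\<forall>i>0. carrier (homology C i) = {\<zero>\<^bsub>homology C i\<^esub>}) \<and>
    graded_isomorphic (homology C 0) N"

text \<open>Minimality: the differential maps \<open>C\<^sub>i\<^sub>+\<^sub>1\<close> into \<open>(x\<^sub>1, \<dots>, x\<^sub>n) C\<^sub>i\<close>.\<close>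

definition minimal_free_resolution ::
  "('v, 'k::field, 'b) free_complex \<Rightarrow> ('v, 'k, 'm) gmod \<Rightarrow> bool"
  where "minimal_free_resolution C N \<longleftrightarrow>
    free_resolution C N \<and>
    (\<forall>i. cdiff C (Suc i) ` carrier (cmod C (Suc i)) \<subseteq> ideal_times_module irrelevant_ideal (cmod C i))"

text \<open>
  The differential is computed summand by summand. For \<open>j = 0\<close> the truncated index \<open>j - 1\<close> does no
  harm: \<open>\<phi>\<^sub>0 = 0\<close>, so the corresponding term is zero; likewise for \<open>k = 0\<close>.
\<close>

definition star_complex ::
  "('v, 'k::field, 'b) free_complex \<Rightarrow> ('v, 'k, 'c) free_complex \<Rightarrow>
   ('v, 'k, (nat \<times> nat) \<times> ('b \<times> 'c)) free_complex"
  where "star_complex F G =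
    \<lparr>cbasis = (\<lambda>i. direct_sum_basis {(j, k). j + k = i}
        (\<lambda>(j, k). star_basis (cbasis F j) (cbasis G k))),
     cdiff = (\<lambda>i x. \<Sum>(j, k)\<in>{(j, k). j + k = i}.
        incl (j - 1, k)
          (star_Id (cbasis F j) (cbasis F (j - 1)) (cdiff F j) (cbasis G k) (proj (j, k) x))
        + fsmult ((-1) ^ j)
          (incl (j, k - 1)
            (Id_star (cbasis F j) (cbasis G k) (cbasis G (k - 1)) (cdiff G k) (proj (j, k) x))))\<rparr>"

end

theory Submission
  imports Defs
begin

text \<open>
  Everything is visible one multidegree at a time. Fix \<open>a\<close>. A basis element \<open>b\<close> of a graded free
  module contributes to degree \<open>a\<close> exactly when \<open>u\<^sub>b\<close> divides \<open>x\<^sup>a\<close>, and then it contributes the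
  line spanned by \<open>x\<^sup>a / u\<^sub>b \<cdot> b\<close>; in these coordinates a multigraded map is the matrix of its scalars
  \<open>a\<^sub>f\<^sub>g\<close>. So the part of degree \<open>a\<close> (the strand) of a complex of free modules is a complex of vector
  spaces whose matrices do not depend on \<open>a\<close>; only the set of basis elements does
  (\<open>strand_hom\<close>). Since \<open>[u\<^sub>f, u\<^sub>g]\<close> divides \<open>x\<^sup>a\<close> iff both \<open>u\<^sub>f\<close> and \<open>u\<^sub>g\<close> do, the strand of \<open>F * G\<close> is
  the tensor product over the field of the strands of \<open>F\<close> and \<open>G\<close>, with the usual total differential
  (\<open>tensor_column_star_cdiff\<close>).

  Hence Kuenneth's theorem computes the homology. The strand of \<open>F\<close> is exact except in homological degree
  \<open>0\<close>, where its homology \<open>(S/I)\<^sub>a\<close> is \<open>0\<close> if \<open>x\<^sup>a \<in> I\<close> and one-dimensional otherwise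
  (\<open>cyclic_augmentation\<close>). Over a field such a complex has an explicit homotopy between the identity
  and a projection onto a line (\<open>contracting_homotopy\<close>), which acts on the tensor product and reduces
  every question about cycles to the strand of \<open>G\<close> (\<open>total_complex_exact\<close>). So \<open>F * G\<close> is exact
  in positive degrees, and in degree \<open>a\<close> its zeroth homology is \<open>0\<close> if \<open>x\<^sup>a \<in> I\<close> and \<open>M\<^sub>a\<close> otherwise.

  It remains to recognise \<open>(M/IM)\<^sub>a\<close>. If \<open>x\<^sup>a\<close> is not in \<open>I\<close>, no element of \<open>I M\<close> has a nonzero
  component of degree \<open>a\<close>, because every monomial dividing \<open>x\<^sup>a\<close> is outside \<open>I\<close> as well. If \<open>x\<^sup>a\<close> is in
  \<open>I\<close>, some minimal generator \<open>x\<^sup>b\<close> of \<open>I\<close> divides \<open>x\<^sup>a\<close>. No variable of \<open>x\<^sup>b\<close> occurs in the degrees of the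
  generators of \<open>M\<close>, so in each homogeneous expression of an element of \<open>M\<^sub>a\<close> through the generators all coefficients
  are divisible by \<open>x\<^sup>b\<close>, and \<open>M\<^sub>a \<subseteq> I M\<close> (\<open>gcomp_in_ideal_times_module\<close>). This is where the
  disjointness of the two sets of variables enters.
\<close>

section \<open>Finitely supported vectors over a field\<close>

abbreviation lookup where "lookup \<equiv> Poly_Mapping.lookup"
abbreviation keys where "keys \<equiv> Poly_Mapping.keys"
abbreviation single where "single \<equiv> Poly_Mapping.single"

definition pscale :: "'k::field \<Rightarrow> ('b \<Rightarrow>\<^sub>0 'k) \<Rightarrow> ('b \<Rightarrow>\<^sub>0 'k)"
  where "pscale c v = Poly_Mapping.map ((*) c) v"

lemma lookup_pscale [simp]: "lookup (pscale c v) b = c * lookup v b"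
  by (simp add: pscale_def Poly_Mapping.map.rep_eq when_def)

lemma keys_pscale: "keys (pscale c v) \<subseteq> keys v"
  by (auto simp: in_keys_iff)

interpretation kvs: vector_space pscale
  by unfold_locales
     (auto intro!: poly_mapping_eqI simp: lookup_add algebra_simps)

interpretation kvs_pair: vector_space_pair pscale pscale ..

abbreviation klinear :: "(('b \<Rightarrow>\<^sub>0 'k::field) \<Rightarrow> ('c \<Rightarrow>\<^sub>0 'k)) \<Rightarrow> bool"
  where "klinear \<equiv> Vector_Spaces.linear pscale pscale"

lemma klinearI:
  assumes "\<And>v w. f (v + w) = f v + f w" "\<And>c v. f (pscale c v) = pscale c (f v)"
  shows "klinear f"
  using assms
  by (intro Vector_Spaces.linear.intro module_hom.intro module_hom_axioms.intro)
     (simp_all add: kvs.module_axioms kvs.vector_space_axioms)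

text \<open>
  A matrix is given by its rows: \<open>A b\<close> is the image of the basis vector \<open>b\<close>. As bases may be infinite,
  it is essential that the rows, and not the columns, are finitely supported.
\<close>

definition mat_app :: "('b \<Rightarrow> ('c \<Rightarrow>\<^sub>0 'k::field)) \<Rightarrow> ('b \<Rightarrow>\<^sub>0 'k) \<Rightarrow> ('c \<Rightarrow>\<^sub>0 'k)"
  where "mat_app A v = (\<Sum>b\<in>keys v. pscale (lookup v b) (A b))"

lemma mat_app_superset:
  assumes "finite S" "keys v \<subseteq> S"
  shows "mat_app A v = (\<Sum>b\<in>S. pscale (lookup v b) (A b))"
  unfolding mat_app_def using assms
  by (intro sum.mono_neutral_left) (auto simp: in_keys_iff)

lemma lookup_mat_app: "lookup (mat_app A v) c = (\<Sum>b\<in>keys v. lookup v b * lookup (A b) c)"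
  by (simp add: mat_app_def lookup_sum)

lemma klinear_mat_app: "klinear (mat_app A)"
proof -
  have "mat_app A (v + w) = mat_app A v + mat_app A w" for v w
  proof -
    let ?S = "keys v \<union> keys w"
    have "keys (v + w) \<subseteq> ?S" by (rule keys_add)
    then show ?thesis
      using mat_app_superset[of ?S v A] mat_app_superset[of ?S w A] mat_app_superset[of ?S "v + w" A]
      by (simp add: lookup_add kvs.scale_left_distrib sum.distrib)
  qed
  moreover have "mat_app A (pscale c v) = pscale c (mat_app A v)" for c v
    using mat_app_superset[of "keys v" "pscale c v" A] keys_pscale[of c v]
    by (simp add: mat_app_def kvs.scale_sum_right)
  ultimately show ?thesis by (rule klinearI)
qed

lemmas mat_app_add = kvs_pair.linear_add[OF klinear_mat_app]
  and mat_app_scale = kvs_pair.linear_scale[OF klinear_mat_app]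
  and mat_app_zero [simp] = kvs_pair.linear_0[OF klinear_mat_app]
  and mat_app_diff = kvs_pair.linear_diff[OF klinear_mat_app]
  and mat_app_sum = kvs_pair.linear_sum[OF klinear_mat_app]

lemma mat_app_single [simp]: "mat_app A (single b c) = pscale c (A b)"
  by (simp add: mat_app_def)

abbreviation supported_on :: "'b set \<Rightarrow> ('b \<Rightarrow>\<^sub>0 'k::field) set"
  where "supported_on P \<equiv> {v. keys v \<subseteq> P}"

lemma subspace_supported_on: "kvs.subspace (supported_on P :: ('b \<Rightarrow>\<^sub>0 'k::field) set)"
proof (rule kvs.subspaceI)
  show "v + w \<in> supported_on P" if "v \<in> supported_on P" "w \<in> supported_on P" for v w
    using that keys_add[of v w] by auto
  show "pscale c v \<in> supported_on P" if "v \<in> supported_on P" for c v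
    using that keys_pscale[of c v] by auto
qed simp

definition functional :: "('b \<Rightarrow> 'k::field) \<Rightarrow> ('b \<Rightarrow>\<^sub>0 'k) \<Rightarrow> 'k"
  where "functional l v = (\<Sum>b\<in>keys v. lookup v b * l b)"

lemma functional_eq: "functional l v = lookup (mat_app (\<lambda>b. single () (l b)) v) ()"
  by (simp add: functional_def lookup_mat_app)

lemma functional_add: "functional l (v + w) = functional l v + functional l w"
  and functional_scale: "functional l (pscale c v) = c * functional l v"
  and functional_zero [simp]: "functional l 0 = 0"
  and functional_diff: "functional l (v - w) = functional l v - functional l w"
  and functional_sum: "functional l (sum h S) = (\<Sum>x\<in>S. functional l (h x))"
  by (simp_all add: functional_eq mat_app_add mat_app_scale mat_app_diff mat_app_sum lookup_add lookup_minus lookup_sum)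

lemma functional_null [simp]: "functional (\<lambda>_. 0) v = 0"
  by (simp add: functional_def)

text \<open>
  A based complex that is exact in positive degrees and whose zeroth homology is detected by a functional
  \<open>l\<close> with \<open>l e = 1\<close> (or is zero, with \<open>l = 0\<close> and \<open>e = 0\<close>) has a linear homotopy from the identity to the
  projection \<open>v \<mapsto> l(v) e\<close>. The two hypotheses on \<open>l\<close> and \<open>e\<close> cover both cases at once. Linearity is what
  later allows the homotopy to act on one factor of a tensor product; it is available because
  linear maps over a field have linear sections.
\<close>

lemma contracting_homotopy:
  fixes A :: "nat \<Rightarrow> 'b \<Rightarrow> ('b \<Rightarrow>\<^sub>0 'k::field)" and P :: "nat \<Rightarrow> 'b set"
  assumes cplx: "\<And>j v. v \<in> supported_on (P (Suc (Suc j))) \<Longrightarrow>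
      mat_app (A (Suc j)) (mat_app (A (Suc (Suc j))) v) = 0"
    and exact: "\<And>j v. v \<in> supported_on (P (Suc j)) \<Longrightarrow> mat_app (A (Suc j)) v = 0 \<Longrightarrow>
      v \<in> mat_app (A (Suc (Suc j))) ` supported_on (P (Suc (Suc j)))"
    and e: "e \<in> supported_on (P 0)"
    and l0: "\<And>v. v \<in> supported_on (P 1) \<Longrightarrow> functional l (mat_app (A 1) v) = 0"
    and l1: "\<And>v. v \<in> supported_on (P 0) \<Longrightarrow>
      v - pscale (functional l v) e \<in> mat_app (A 1) ` supported_on (P 1)"
  obtains s where "\<And>j. klinear (s j)"
    "\<And>j v. v \<in> supported_on (P j) \<Longrightarrow> s j v \<in> supported_on (P (Suc j))"
    "\<And>v. v \<in> supported_on (P 0) \<Longrightarrow> mat_app (A 1) (s 0 v) = v - pscale (functional l v) e"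
    "\<And>j v. v \<in> supported_on (P (Suc j)) \<Longrightarrow>
      mat_app (A (Suc (Suc j))) (s (Suc j) v) + s j (mat_app (A (Suc j)) v) = v"
proof -
  have "\<forall>j. \<exists>g. g ` UNIV \<subseteq> supported_on (P (Suc j)) \<and> klinear g \<and>
      (\<forall>v\<in>mat_app (A (Suc j)) ` supported_on (P (Suc j)). mat_app (A (Suc j)) (g v) = v)"
    by (rule allI, rule kvs_pair.linear_exists_right_inverse_on[OF klinear_mat_app subspace_supported_on])
  from choice[OF this] obtain g where
    "\<forall>j. range (g j) \<subseteq> supported_on (P (Suc j)) \<and> klinear (g j) \<and>
      (\<forall>v\<in>mat_app (A (Suc j)) ` supported_on (P (Suc j)). mat_app (A (Suc j)) (g j v) = v)" ..
  then have g: "\<And>j v. g j v \<in> supported_on (P (Suc j))" "\<And>j. klinear (g j)"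
     "\<And>j v. v \<in> mat_app (A (Suc j)) ` supported_on (P (Suc j)) \<Longrightarrow> mat_app (A (Suc j)) (g j v) = v"
    by (auto simp: image_subset_iff)
  note gl = kvs_pair.linear_add[OF g(2)] kvs_pair.linear_scale[OF g(2)] kvs_pair.linear_diff[OF g(2)]
  \<comment> \<open>\<open>g j\<close> is a linear section of the differential \<open>j + 1\<close>. The vector to which it is applied is a boundary,
    by exactness for \<open>j > 0\<close> and by the hypothesis on \<open>l\<close> and \<open>e\<close> for \<open>j = 0\<close>.\<close>
  define s where "s j v = g j (v - (if j = 0 then pscale (functional l v) e
      else g (j - 1) (mat_app (A j) v)))" for j v
  show thesis
  proof
    fix j
    have "klinear (\<lambda>v. v - (if j = 0 then pscale (functional l v) e else g (j - 1) (mat_app (A j) v)))"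
      by (intro klinearI)
        (simp_all add: functional_add functional_scale mat_app_add mat_app_scale gl
           kvs.scale_left_distrib kvs.scale_right_diff_distrib)
    from kvs_pair.linear_add[OF this] kvs_pair.linear_scale[OF this] show "klinear (s j)"
      by (intro klinearI) (simp_all only: s_def kvs_pair.linear_add[OF g(2)] kvs_pair.linear_scale[OF g(2)])
  next
    fix j and v :: "'b \<Rightarrow>\<^sub>0 'k" assume "v \<in> supported_on (P j)"
    then show "s j v \<in> supported_on (P (Suc j))" unfolding s_def by (rule_tac g(1))
  next
    fix v :: "'b \<Rightarrow>\<^sub>0 'k" assume "v \<in> supported_on (P 0)"
    then show "mat_app (A 1) (s 0 v) = v - pscale (functional l v) e"
      using g(3)[of "v - pscale (functional l v) e" 0] l1[of v] by (simp add: s_def)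
  next
    fix j and v :: "'b \<Rightarrow>\<^sub>0 'k" assume v: "v \<in> supported_on (P (Suc j))"
    let ?w = "v - g j (mat_app (A (Suc j)) v)"
    have im: "mat_app (A (Suc j)) (g j (mat_app (A (Suc j)) v)) = mat_app (A (Suc j)) v"
      by (rule g(3)) (use v in blast)
    have "?w \<in> supported_on (P (Suc j))"
      using kvs.subspace_diff[OF subspace_supported_on v g(1)] .
    moreover have "mat_app (A (Suc j)) ?w = 0" by (simp add: mat_app_diff im)
    ultimately have "?w \<in> mat_app (A (Suc (Suc j))) ` supported_on (P (Suc (Suc j)))" by (rule exact)
    then have 1: "mat_app (A (Suc (Suc j))) (s (Suc j) v) = ?w"
      using g(3)[of ?w "Suc j"] by (simp add: s_def)
    have 2: "s j (mat_app (A (Suc j)) v) = g j (mat_app (A (Suc j)) v)"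
    proof (cases j)
      case 0
      then show ?thesis using l0[of v] v by (simp add: s_def)
    next
      case (Suc j')
      have "mat_app (A j) (mat_app (A (Suc j)) v) = 0"
        using cplx[of v j'] v Suc by simp
      then show ?thesis using Suc g(2) by (simp add: s_def kvs_pair.linear_0)
    qed
    show "mat_app (A (Suc (Suc j))) (s (Suc j) v) + s j (mat_app (A (Suc j)) v) = v"
      by (simp only: 1 2) simp
  qed
qed

section \<open>The total complex of a tensor product\<close>

text \<open>
  An element of the tensor product of two based spaces is the family \<open>Z\<close> of its columns, indexed by the
  basis of the second factor, each column being a vector of the first factor. A matrix on the first factor
  acts on every column separately; \<open>row_app\<close> is the action of a matrix on the second factor, which mixes
  the columns. A linear map applied to the columns therefore commutes with it.
\<close>

definition row_app :: "('c \<Rightarrow> ('d \<Rightarrow>\<^sub>0 'k::field)) \<Rightarrow> ('c \<Rightarrow> ('b \<Rightarrow>\<^sub>0 'k)) \<Rightarrow> 'd \<Rightarrow> ('b \<Rightarrow>\<^sub>0 'k)"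
  where "row_app B Z g = (\<Sum>h\<in>{h. Z h \<noteq> 0}. pscale (lookup (B h) g) (Z h))"

lemma row_app_superset:
  assumes "finite S" "\<And>h. Z h \<noteq> 0 \<Longrightarrow> h \<in> S"
  shows "row_app B Z g = (\<Sum>h\<in>S. pscale (lookup (B h) g) (Z h))"
  unfolding row_app_def using assms by (intro sum.mono_neutral_left) auto

lemma row_app_klinear:
  assumes "klinear s" "finite {h. Z h \<noteq> 0}"
  shows "row_app B (\<lambda>h. s (Z h)) g = s (row_app B Z g)"
proof -
  have "row_app B (\<lambda>h. s (Z h)) g = (\<Sum>h\<in>{h. Z h \<noteq> 0}. pscale (lookup (B h) g) (s (Z h)))"
    by (rule row_app_superset) (use assms kvs_pair.linear_0[OF assms(1)] in auto)
  also have "\<dots> = s (row_app B Z g)"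
    by (simp add: row_app_def kvs_pair.linear_sum[OF assms(1)] kvs_pair.linear_scale[OF assms(1)])
  finally show ?thesis .
qed

lemma mat_app_row_app:
  assumes "finite {h. Z h \<noteq> 0}"
  shows "row_app B (\<lambda>h. mat_app A (Z h)) g = mat_app A (row_app B Z g)"
  using row_app_klinear[OF klinear_mat_app assms] .

definition total_diff :: "(nat \<Rightarrow> 'b \<Rightarrow> ('b \<Rightarrow>\<^sub>0 'k::field)) \<Rightarrow> (nat \<Rightarrow> 'c \<Rightarrow> ('c \<Rightarrow>\<^sub>0 'k)) \<Rightarrow>
    (nat \<Rightarrow> nat \<Rightarrow> 'c \<Rightarrow> ('b \<Rightarrow>\<^sub>0 'k)) \<Rightarrow> nat \<Rightarrow> nat \<Rightarrow> 'c \<Rightarrow> ('b \<Rightarrow>\<^sub>0 'k)"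
  where "total_diff A B Z j k g = mat_app (A (Suc j)) (Z (Suc j) k g)
    + pscale ((-1) ^ j) (row_app (B (Suc k)) (Z j (Suc k)) g)"

definition total_element :: "(nat \<Rightarrow> 'b set) \<Rightarrow> (nat \<Rightarrow> 'c set) \<Rightarrow> nat \<Rightarrow>
    (nat \<Rightarrow> nat \<Rightarrow> 'c \<Rightarrow> ('b \<Rightarrow>\<^sub>0 'k::field)) \<Rightarrow> bool"
  where "total_element P Q i Z \<longleftrightarrow> (\<forall>j k. j + k = i \<longrightarrow>
    (\<forall>g. Z j k g \<in> supported_on (P j)) \<and> finite {g. Z j k g \<noteq> 0} \<and> {g. Z j k g \<noteq> 0} \<subseteq> Q k)"

lemma total_elementD:
  assumes "total_element P Q i Z" "j + k = i"
  shows "keys (Z j k g) \<subseteq> P j" "finite {g. Z j k g \<noteq> 0}" "Z j k g \<noteq> 0 \<Longrightarrow> g \<in> Q k"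
  using assms unfolding total_element_def by blast+

text \<open>
  The homotopy \<open>s\<close> of the first factor, applied to all columns, contracts the total complex up to the
  projection onto \<open>e\<close> times the second factor: it anticommutes with the signed differential of the second
  factor, as it raises \<open>j\<close> by one. What is left of \<open>Z\<close> is the vector \<open>g \<mapsto> l (Z 0 i g)\<close> of the second
  complex, times \<open>e\<close>; if that vector is the boundary of \<open>y\<close>, then \<open>Z\<close> is a boundary. The cycle condition
  is vacuous for \<open>i = 0\<close>.
\<close>

lemma total_complex_exact:
  fixes A :: "nat \<Rightarrow> 'b \<Rightarrow> ('b \<Rightarrow>\<^sub>0 'k::field)" and B :: "nat \<Rightarrow> 'c \<Rightarrow> ('c \<Rightarrow>\<^sub>0 'k)"
  assumes F: "\<And>j v. v \<in> supported_on (P (Suc (Suc j))) \<Longrightarrow>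
      mat_app (A (Suc j)) (mat_app (A (Suc (Suc j))) v) = 0"
     "\<And>j v. v \<in> supported_on (P (Suc j)) \<Longrightarrow> mat_app (A (Suc j)) v = 0 \<Longrightarrow>
      v \<in> mat_app (A (Suc (Suc j))) ` supported_on (P (Suc (Suc j)))"
    and e: "e \<in> supported_on (P 0)"
    and l: "\<And>v. v \<in> supported_on (P 1) \<Longrightarrow> functional l (mat_app (A 1) v) = 0"
      "\<And>v. v \<in> supported_on (P 0) \<Longrightarrow>
      v - pscale (functional l v) e \<in> mat_app (A 1) ` supported_on (P 1)"
    and Z: "total_element P Q i Z"
    and cycle: "\<And>j k g. Suc (j + k) = i \<Longrightarrow> total_diff A B Z j k g = 0"
    and y: "y \<in> supported_on (Q (Suc i))"
      "\<And>g. lookup (mat_app (B (Suc i)) y) g = functional l (Z 0 i g)"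
  obtains Y where "total_element P Q (Suc i) Y"
    "\<And>j k g. j + k = i \<Longrightarrow> total_diff A B Y j k g = Z j k g"
proof -
  obtain s where s: "\<And>j. klinear (s j)"
    "\<And>j v. v \<in> supported_on (P j) \<Longrightarrow> s j v \<in> supported_on (P (Suc j))"
    "\<And>v. v \<in> supported_on (P 0) \<Longrightarrow> mat_app (A 1) (s 0 v) = v - pscale (functional l v) e"
    "\<And>j v. v \<in> supported_on (P (Suc j)) \<Longrightarrow>
      mat_app (A (Suc (Suc j))) (s (Suc j) v) + s j (mat_app (A (Suc j)) v) = v"
    using contracting_homotopy[of P A e l] F e l by blast
  have s0: "s j 0 = 0" for j using kvs_pair.linear_0[OF s(1)] .
  \<comment> \<open>The columns with \<open>j > 0\<close> come from the homotopy, those with \<open>j = 0\<close> form \<open>e\<close> times \<open>y\<close>.\<close>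
  define Y where "Y j k g = (if j = 0 then pscale (lookup y g) e else s (j - 1) (Z (j - 1) k g))" for j k g
  have ZP: "Z j k g \<in> supported_on (P j)" "finite {g. Z j k g \<noteq> 0}" "Z j k g \<noteq> 0 \<Longrightarrow> g \<in> Q k"
    if "j + k = i" for j k g using Z that unfolding total_element_def by blast+
  show thesis
  proof
    have "Y j k g \<in> supported_on (P j)" if "j + k = Suc i" for j k g
    proof (cases j)
      case 0
      then show ?thesis using kvs.subspace_scale[OF subspace_supported_on e] by (simp add: Y_def)
    next
      case (Suc j')
      then show ?thesis using s(2)[OF ZP(1)[of j' k]] that by (simp add: Y_def)
    qed
    moreover have "finite {g. Y j k g \<noteq> 0} \<and> {g. Y j k g \<noteq> 0} \<subseteq> Q k" if "j + k = Suc i" for j k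
    proof (cases j)
      case 0
      then have "{g. Y j k g \<noteq> 0} \<subseteq> keys y" by (auto simp: Y_def in_keys_iff)
      then show ?thesis using y(1) 0 that finite_subset by fastforce
    next
      case (Suc j')
      then have "{g. Y j k g \<noteq> 0} \<subseteq> {g. Z j' k g \<noteq> 0}" using s0 by (auto simp: Y_def)
      moreover have "j' + k = i" using Suc that by simp
      ultimately show ?thesis using ZP(2,3)[of j' k] by (metis (mono_tags, lifting) finite_subset mem_Collect_eq subset_iff)
    qed
    ultimately show "total_element P Q (Suc i) Y" unfolding total_element_def by blast
  next
    fix j k g assume jk: "j + k = i"
    show "total_diff A B Y j k g = Z j k g"
    proof (cases j)
      case 0
      have "row_app (B (Suc i)) (Y 0 (Suc i)) g = (\<Sum>h\<in>keys y. pscale (lookup (B (Suc i) h) g) (pscale (lookup y h) e))"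
        unfolding Y_def by (subst row_app_superset[of "keys y"]) (auto simp: in_keys_iff)
      also have "\<dots> = pscale (functional l (Z 0 i g)) e"
        unfolding y(2)[symmetric] lookup_mat_app kvs.scale_sum_left by (simp add: mult.commute)
      finally show ?thesis using s(3)[OF ZP(1)[of 0 i g]] 0 jk by (simp add: total_diff_def Y_def)
    next
      case (Suc j')
      have Yj: "Y (Suc j') (Suc k) = (\<lambda>h. s j' (Z j' (Suc k) h))"
        by (simp add: Y_def fun_eq_iff Suc)
      then have "row_app (B (Suc k)) (Y j (Suc k)) g = s j' (row_app (B (Suc k)) (Z j' (Suc k)) g)"
        using row_app_klinear[OF s(1)[of j'] ZP(2)[of j' "Suc k"], of "B (Suc k)" g] Suc jk by simp
      also have "pscale ((-1) ^ j) \<dots> = s j' (- pscale ((-1) ^ j') (row_app (B (Suc k)) (Z j' (Suc k)) g))"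
        by (simp add: Suc kvs_pair.linear_neg[OF s(1)] kvs_pair.linear_scale[OF s(1)])
      also have "- pscale ((-1) ^ j') (row_app (B (Suc k)) (Z j' (Suc k)) g) = mat_app (A j) (Z j k g)"
        using cycle[of j' k g] Suc jk by (simp add: total_diff_def add_eq_0_iff)
      finally show ?thesis using s(4)[of "Z j k g" j'] ZP(1)[OF jk, of g] Suc
        by (simp add: total_diff_def Yj) (simp add: Y_def)
    qed
  qed
qed

section \<open>Strands of a graded free module\<close>

lemma expo_diff_add [simp]: "d \<le> a \<Longrightarrow> a - d + d = (a :: 'v \<Rightarrow> nat)"
  by (auto simp: fun_eq_iff le_fun_def)

lemma expo_add_diff [simp]: "e + d - d = (e :: 'v \<Rightarrow> nat)"
  by (auto simp: fun_eq_iff)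

lemma expo_le_add [simp]: "d \<le> e + (d :: 'v \<Rightarrow> nat)" "d \<le> d + e"
  by (auto simp: le_fun_def)

lemma lookup_outside: "keys x \<subseteq> S \<Longrightarrow> b \<notin> S \<Longrightarrow> lookup x b = 0"
  by (auto simp: in_keys_iff)

lemma poly_mapping_sum_single: "(\<Sum>k\<in>keys p. single k (lookup p k)) = (p :: 'a \<Rightarrow>\<^sub>0 'b::comm_monoid_add)"
  by (rule poly_mapping_eqI) (simp add: lookup_sum lookup_single when_def in_keys_iff sum.delta)

lemma poly_mapping_induct_add [case_names zero single add]:
  fixes p :: "'a \<Rightarrow>\<^sub>0 'b::comm_monoid_add"
  assumes "P 0" "\<And>k v. v \<noteq> 0 \<Longrightarrow> P (single k v)" "\<And>p q. P p \<Longrightarrow> P q \<Longrightarrow> P (p + q)"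
  shows "P p"
proof -
  have "P (\<Sum>k\<in>S. single k (lookup p k))" if "finite S" "S \<subseteq> keys p" for S
    using that by (induction S) (auto intro: assms simp: in_keys_iff)
  from this[of "keys p"] show ?thesis by (simp add: poly_mapping_sum_single)
qed

lemma lookup_mult_single:
  fixes p :: "('v, 'k::field) mpoly"
  shows "lookup (p * single e c) a = (if e \<le> a then lookup p (a - e) * c else 0)"
proof (induction p rule: poly_mapping_induct_add)
  case (single k v)
  have "k + e = a \<longleftrightarrow> e \<le> a \<and> k = a - e" by auto
  then show ?case by (cases "k + e = a"; cases "e \<le> a") (auto simp: mult_single lookup_single when_def)
qed (simp_all add: distrib_right lookup_add fun_diff_def)

lemma lookup_fsmult [simp]: "lookup (fsmult s x) b = s * lookup x b"
  by (simp add: fsmult_def Poly_Mapping.map.rep_eq when_def)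

lemma keys_fsmult: "keys (fsmult s x) \<subseteq> keys x"
  by (auto simp: in_keys_iff)

lemma fsmult_simps [simp]: "fsmult s 0 = 0" "fsmult 0 x = 0" "fsmult 1 x = x"
  "fsmult s (single b p) = single b (s * p)"
  by (auto intro!: poly_mapping_eqI simp: lookup_single when_def)

lemma fsmult_distribs: "fsmult s (x + y) = fsmult s x + fsmult s y" "fsmult (s + t) x = fsmult s x + fsmult t x"
  "fsmult (s * t) x = fsmult s (fsmult t x)"
  by (auto intro!: poly_mapping_eqI simp: lookup_add algebra_simps)

lemma fsmult_sum: "fsmult s (sum h S) = (\<Sum>i\<in>S. fsmult s (h i))"
  by (auto intro!: poly_mapping_eqI simp: lookup_sum sum_distrib_left)

lemma linear_extension_superset:
  assumes "finite S" "keys x \<subseteq> S"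
  shows "linear_extension t x = (\<Sum>b\<in>S. fsmult (lookup x b) (t b))"
  unfolding linear_extension_def using assms
  by (intro sum.mono_neutral_left) (auto simp: in_keys_iff)

lemma linear_extension_add: "linear_extension t (x + y) = linear_extension t x + linear_extension t y"
  using linear_extension_superset[of "keys x \<union> keys y" x t] keys_add[of x y]
    linear_extension_superset[of "keys x \<union> keys y" y t]
    linear_extension_superset[of "keys x \<union> keys y" "x + y" t]
  by (simp add: lookup_add fsmult_distribs sum.distrib)

lemma linear_extension_fsmult: "linear_extension t (fsmult s x) = fsmult s (linear_extension t x)"
  using linear_extension_superset[of "keys x" "fsmult s x" t] keys_fsmult[of s x]
  by (simp add: linear_extension_def fsmult_distribs fsmult_sum)

lemma linear_extension_zero [simp]: "linear_extension t 0 = 0"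
  by (simp add: linear_extension_def)

lemma linear_extension_single [simp]: "linear_extension t (single b p) = fsmult p (t b)"
  by (cases "p = 0") (simp_all add: linear_extension_def)

lemma lookup_linear_extension: "lookup (linear_extension t x) c = (\<Sum>b\<in>keys x. lookup x b * lookup (t b) c)"
  by (simp add: linear_extension_def lookup_sum)

lemma carrier_free_module: "x \<in> carrier (free_module B) \<longleftrightarrow> keys x \<subseteq> bset B"
  and free_module_simps [simp]: "add (free_module B) = (+)" "ring.zero (free_module B) = 0"
    "module.smult (free_module B) = fsmult"
  by (simp_all add: free_module_def)

lemma gcomp_free_module: "x \<in> gcomp (free_module B) a \<longleftrightarrow>
    keys x \<subseteq> bset B \<and> (\<forall>b. \<forall>e \<in> keys (lookup x b). e + bdeg B b = a)"
  by (simp add: free_module_def)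

text \<open>
  Coordinates of the part of degree \<open>a\<close>: the coefficient of \<open>x\<^sup>a / u\<^sub>b \<cdot> b\<close> in \<open>x\<close>, for every basis element
  \<open>b\<close> whose degree divides \<open>a\<close>. The inverse is \<open>unstrand\<close>, on vectors supported on \<open>strand_basis B a\<close>.
\<close>

definition strand :: "('v, 'b) graded_basis \<Rightarrow> 'v expo \<Rightarrow> ('v, 'k::field, 'b) fvec \<Rightarrow> ('b \<Rightarrow>\<^sub>0 'k)"
  where "strand B a = Poly_Mapping.mapp (\<lambda>b p. if bdeg B b \<le> a then lookup p (a - bdeg B b) else 0)"

definition unstrand :: "('v, 'b) graded_basis \<Rightarrow> 'v expo \<Rightarrow> ('b \<Rightarrow>\<^sub>0 'k::field) \<Rightarrow> ('v, 'k, 'b) fvec"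
  where "unstrand B a = Poly_Mapping.mapp (\<lambda>b. single (a - bdeg B b))"

definition strand_basis :: "('v, 'b) graded_basis \<Rightarrow> 'v expo \<Rightarrow> 'b set"
  where "strand_basis B a = {b \<in> bset B. bdeg B b \<le> a}"

lemma lookup_strand:
  "lookup (strand B a x) b = (if bdeg B b \<le> a then lookup (lookup x b) (a - bdeg B b) else 0)"
  by (simp add: strand_def lookup_mapp when_def in_keys_iff)

lemma lookup_unstrand: "lookup (unstrand B a v) b = single (a - bdeg B b) (lookup v b)"
  by (simp add: unstrand_def lookup_mapp when_def in_keys_iff)

lemma strand_add: "strand B a (x + y) = strand B a x + strand B a y"
  and strand_zero [simp]: "strand B a 0 = 0"
  by (auto intro!: poly_mapping_eqI simp: lookup_strand lookup_add)

lemma strand_sum: "strand B a (sum h S) = (\<Sum>i\<in>S. strand B a (h i))"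
  by (induction S rule: infinite_finite_induct) (simp_all add: strand_add)

lemma unstrand_zero [simp]: "unstrand B a 0 = 0"
  by (rule poly_mapping_eqI) (simp add: lookup_unstrand)

lemma lookup_eq_strand: "lookup (lookup x b) e = lookup (strand B (e + bdeg B b) x) b"
  by (simp add: lookup_strand)

lemma strand_eqI: "(\<And>a. strand B a x = strand B a y) \<Longrightarrow> x = y"
  by (metis lookup_eq_strand poly_mapping_eqI)

lemma keys_strand: "x \<in> carrier (free_module B) \<Longrightarrow> strand B a x \<in> supported_on (strand_basis B a)"
  by (force simp: carrier_free_module strand_basis_def in_keys_iff lookup_strand split: if_splits)

lemma single_eq_zero_iff [simp]: "single k v = 0 \<longleftrightarrow> v = 0"
  by (metis lookup_single_eq lookup_zero single_zero)

lemma keys_unstrand: "keys (unstrand B a v) = keys v"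
  by (auto simp: in_keys_iff lookup_unstrand)

lemma unstrand_in_gcomp:
  "v \<in> supported_on (strand_basis B a) \<Longrightarrow> unstrand B a v \<in> gcomp (free_module B) a"
  using lookup_outside[of v "strand_basis B a"]
  by (auto simp: gcomp_free_module keys_unstrand lookup_unstrand strand_basis_def intro!: expo_diff_add split: if_splits)

lemma gcomp_carrier_free_module: "x \<in> gcomp (free_module B) a \<Longrightarrow> x \<in> carrier (free_module B)"
  by (simp add: gcomp_free_module carrier_free_module)

lemma strand_unstrand:
  "v \<in> supported_on (strand_basis B a) \<Longrightarrow> strand B a' (unstrand B a v) = (if a' = a then v else 0)"
proof (rule poly_mapping_eqI)
  fix b assume v: "v \<in> supported_on (strand_basis B a)"
  show "lookup (strand B a' (unstrand B a v)) b = lookup (if a' = a then v else 0) b"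
  proof (cases "b \<in> strand_basis B a")
    case True
    then have "bdeg B b \<le> a" by (simp add: strand_basis_def)
    moreover have "a' = a" if "bdeg B b \<le> a'" "a' - bdeg B b = a - bdeg B b"
      using that calculation expo_diff_add[of "bdeg B b"] by metis
    ultimately show ?thesis by (auto simp: lookup_strand lookup_unstrand lookup_single when_def)
  next
    case False
    then show ?thesis using v lookup_outside[of v _ b] by (simp add: lookup_strand lookup_unstrand)
  qed
qed

lemma gcomp_iff_strand:
  "x \<in> gcomp (free_module B) a \<longleftrightarrow> x \<in> carrier (free_module B) \<and> (\<forall>a'. a' \<noteq> a \<longrightarrow> strand B a' x = 0)"
proof (intro iffI conjI allI impI)
  fix a' assume x: "x \<in> gcomp (free_module B) a" "a' \<noteq> a"
  show "strand B a' x = 0"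
  proof (rule poly_mapping_eqI, rule ccontr)
    fix b assume "lookup (strand B a' x) b \<noteq> lookup 0 b"
    then have "bdeg B b \<le> a'" "a' - bdeg B b \<in> keys (lookup x b)"
      by (auto simp: lookup_strand in_keys_iff split: if_splits)
    moreover have "a' - bdeg B b + bdeg B b = a"
      using x(1) calculation(2) unfolding gcomp_free_module by blast
    ultimately show False using x(2) by simp
  qed
next
  assume *: "x \<in> carrier (free_module B) \<and> (\<forall>a'. a' \<noteq> a \<longrightarrow> strand B a' x = 0)"
  show "x \<in> gcomp (free_module B) a"
    unfolding gcomp_free_module
  proof (intro conjI allI ballI)
    show "keys x \<subseteq> bset B" using * by (simp add: carrier_free_module)
    fix b e assume "e \<in> keys (lookup x b)"
    then have "lookup (strand B (e + bdeg B b) x) b \<noteq> 0"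
      by (simp add: lookup_eq_strand[symmetric] in_keys_iff)
    then show "e + bdeg B b = a" using * by fastforce
  qed
qed (rule gcomp_carrier_free_module)

lemma unstrand_strand: "x \<in> gcomp (free_module B) a \<Longrightarrow> unstrand B a (strand B a x) = x"
  using strand_unstrand[OF keys_strand[of x B a]]
  by (intro strand_eqI[of B]) (auto simp: gcomp_iff_strand)

lemma finite_strands: "finite {a. strand B a x \<noteq> 0}"
proof (rule finite_subset)
  show "{a. strand B a x \<noteq> 0} \<subseteq> (\<Union>b\<in>keys x. (\<lambda>e. e + bdeg B b) ` keys (lookup x b))"
  proof
    fix a assume "a \<in> {a. strand B a x \<noteq> 0}"
    then obtain b where "lookup (strand B a x) b \<noteq> 0" using poly_mapping_eqI[of "strand B a x" 0] by force
    then have "bdeg B b \<le> a" "a - bdeg B b \<in> keys (lookup x b)" "b \<in> keys x"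
      by (auto simp: lookup_strand in_keys_iff split: if_splits)
    then show "a \<in> (\<Union>b\<in>keys x. (\<lambda>e. e + bdeg B b) ` keys (lookup x b))"
      by (auto intro!: bexI[of _ b] image_eqI[of _ _ "a - bdeg B b"])
  qed
qed simp

lemma sum_strands:
  assumes "x \<in> carrier (free_module B)"
  shows "(\<Sum>a\<in>{a. strand B a x \<noteq> 0}. unstrand B a (strand B a x)) = x"
proof (rule strand_eqI)
  fix a
  show "strand B a (\<Sum>a\<in>{a. strand B a x \<noteq> 0}. unstrand B a (strand B a x)) = strand B a x"
    by (simp add: strand_sum strand_unstrand[OF keys_strand[OF assms]] sum.delta finite_strands)
qed

text \<open>
  An element is the finite sum of its homogeneous parts, so additive statements may be checked degree by
  degree.
\<close>

lemma strands_closed: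
  assumes "x \<in> carrier (free_module B)" "0 \<in> N" "\<And>y z. y \<in> N \<Longrightarrow> z \<in> N \<Longrightarrow> y + z \<in> N"
    and "\<And>a. unstrand B a (strand B a x) \<in> N"
  shows "x \<in> N"
proof -
  have "(\<Sum>a\<in>S. unstrand B a (strand B a x)) \<in> N" if "finite S" for S
    using that by induction (auto intro: assms)
  from this[OF finite_strands[of B x]] show ?thesis by (simp add: sum_strands[OF assms(1)])
qed

lemma gcomp_lookup:
  assumes "x \<in> gcomp (free_module B) a"
  shows "lookup x b = single (a - bdeg B b) (lookup (strand B a x) b)"
  using unstrand_strand[OF assms] by (metis lookup_unstrand)

text \<open>
  The exponents are forced: a homogeneous \<open>t b\<close> is determined by scalars, and
  \<open>x\<^sup>a / u\<^sub>b \<cdot> u\<^sub>b / u\<^sub>c = x\<^sup>a / u\<^sub>c\<close>. Only the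
  scalars are left, and they do not depend on \<open>a\<close>.
\<close>

lemma strand_linear_extension:
  assumes "\<And>b. b \<in> keys x \<Longrightarrow> t b \<in> gcomp (free_module C) (bdeg B b)"
  shows "strand C a (linear_extension t x) = mat_app (\<lambda>b. strand C (bdeg B b) (t b)) (strand B a x)"
proof (rule poly_mapping_eqI)
  fix c
  have sub: "keys (strand B a x) \<subseteq> keys x"
    by (auto simp: in_keys_iff lookup_strand split: if_splits)
  have entry: "(if bdeg C c \<le> a then lookup (lookup x b * lookup (t b) c) (a - bdeg C c) else 0) =
      lookup (strand B a x) b * lookup (strand C (bdeg B b) (t b)) c" if "b \<in> keys x" for b
  proof (cases "lookup (strand C (bdeg B b) (t b)) c = 0")
    case True
    then show ?thesis using gcomp_lookup[OF assms[OF that], of c] by simp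
  next
    case False
    then have le: "bdeg C c \<le> bdeg B b" by (auto simp: lookup_strand split: if_splits)
    have "bdeg C c x \<le> a x \<and> bdeg B b x - bdeg C c x \<le> a x - bdeg C c x \<longleftrightarrow> bdeg B b x \<le> a x" for x
      using le[THEN le_funD, of x] by arith
    then have "bdeg C c \<le> a \<and> bdeg B b - bdeg C c \<le> a - bdeg C c \<longleftrightarrow> bdeg B b \<le> a"
      by (simp add: le_fun_def all_conj_distrib[symmetric])
    moreover have "a - bdeg C c - (bdeg B b - bdeg C c) = a - bdeg B b"
      using le by (auto simp: le_fun_def fun_eq_iff)
    ultimately show ?thesis using gcomp_lookup[OF assms[OF that], of c]
      by (auto simp: lookup_mult_single lookup_strand[of B])
  qed
  have "lookup (strand C a (linear_extension t x)) c =
      (\<Sum>b\<in>keys x. if bdeg C c \<le> a then lookup (lookup x b * lookup (t b) c) (a - bdeg C c) else 0)"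
    by (simp add: lookup_strand lookup_linear_extension lookup_sum)
  also have "\<dots> = (\<Sum>b\<in>keys x. lookup (strand B a x) b * lookup (strand C (bdeg B b) (t b)) c)"
    using entry by (intro sum.cong) auto
  also have "\<dots> = lookup (mat_app (\<lambda>b. strand C (bdeg B b) (t b)) (strand B a x)) c"
    by (simp add: mat_app_superset[OF _ sub] lookup_sum)
  finally show "lookup (strand C a (linear_extension t x)) c =
    lookup (mat_app (\<lambda>b. strand C (bdeg B b) (t b)) (strand B a x)) c" .
qed

text \<open>
  The matrix of the scalars \<open>a\<^sub>f\<^sub>g\<close> of a multigraded map, see \<open>lookup_scalar_matrix\<close>.
\<close>

definition scalar_matrix :: "('v, 'b) graded_basis \<Rightarrow> ('v, 'c) graded_basis \<Rightarrow>
    (('v, 'k::field, 'b) fvec \<Rightarrow> ('v, 'k, 'c) fvec) \<Rightarrow> 'b \<Rightarrow> ('c \<Rightarrow>\<^sub>0 'k)"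
  where "scalar_matrix B C \<phi> b = strand C (bdeg B b) (\<phi> (single b 1))"

lemma lookup_scalar_matrix: "lookup (scalar_matrix B C \<phi> b) c = scalar_entry B C \<phi> b c"
  by (simp add: scalar_matrix_def lookup_strand scalar_entry_def)

lemma single_in_gcomp: "b \<in> bset B \<Longrightarrow> single b 1 \<in> gcomp (free_module B) (bdeg B b)"
  by (auto simp: gcomp_free_module lookup_single when_def split: if_splits)

context
  fixes B :: "('v, 'b) graded_basis" and C :: "('v, 'c) graded_basis"
    and \<phi> :: "('v, 'k::field, 'b) fvec \<Rightarrow> ('v, 'k, 'c) fvec"
  assumes hom: "graded_hom (free_module B) (free_module C) \<phi>"
begin

lemma free_hom_carrier: "x \<in> carrier (free_module B) \<Longrightarrow> \<phi> x \<in> carrier (free_module C)"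
  and free_hom_add: "x \<in> carrier (free_module B) \<Longrightarrow> y \<in> carrier (free_module B) \<Longrightarrow> \<phi> (x + y) = \<phi> x + \<phi> y"
  and free_hom_fsmult: "x \<in> carrier (free_module B) \<Longrightarrow> \<phi> (fsmult s x) = fsmult s (\<phi> x)"
  and free_hom_gcomp: "x \<in> gcomp (free_module B) a \<Longrightarrow> \<phi> x \<in> gcomp (free_module C) a"
  using hom unfolding graded_hom_def free_module_simps by (blast dest: funcset_mem)+

lemma free_hom_zero: "\<phi> 0 = 0"
  using free_hom_fsmult[of 0 0] by (simp add: carrier_free_module)

lemma free_hom_linear_extension:
  assumes "x \<in> carrier (free_module B)"
  shows "\<phi> x = linear_extension (\<lambda>b. \<phi> (single b 1)) x"
proof -
  have "\<phi> (\<Sum>b\<in>S. single b (lookup x b)) = (\<Sum>b\<in>S. fsmult (lookup x b) (\<phi> (single b 1)))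
      \<and> (\<Sum>b\<in>S. single b (lookup x b)) \<in> carrier (free_module B)"
    if "finite S" "S \<subseteq> keys x" for S
    using that
  proof (induction S)
    case empty
    show ?case by (simp add: free_hom_zero carrier_free_module)
  next
    case (insert b S)
    have b: "single b (lookup x b) \<in> carrier (free_module B)" "single b 1 \<in> carrier (free_module B)"
      using insert.prems assms by (auto simp: carrier_free_module)
    have "single b (lookup x b) + (\<Sum>b\<in>S. single b (lookup x b)) \<in> carrier (free_module B)"
      using b insert keys_add[of "single b (lookup x b)" "\<Sum>b\<in>S. single b (lookup x b)"]
      unfolding carrier_free_module by blast
    then show ?case using insert b(1) free_hom_fsmult[OF b(2), of "lookup x b"]
      by (simp add: free_hom_add)
  qed
  from this[of "keys x"] show ?thesis by (simp add: poly_mapping_sum_single linear_extension_def)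
qed

lemma strand_hom:
  assumes "x \<in> carrier (free_module B)"
  shows "strand C a (\<phi> x) = mat_app (scalar_matrix B C \<phi>) (strand B a x)"
  unfolding free_hom_linear_extension[OF assms] scalar_matrix_def
  using assms by (intro strand_linear_extension free_hom_gcomp single_in_gcomp) (auto simp: carrier_free_module)

end

lemma graded_hom_linear_extension:
  assumes "\<And>b. b \<in> bset B \<Longrightarrow> t b \<in> gcomp (free_module C) (bdeg B b)"
  shows "graded_hom (free_module B) (free_module C) (linear_extension t)"
proof -
  have c: "linear_extension t x \<in> carrier (free_module C)" if "x \<in> carrier (free_module B)" for x
  proof -
    have "lookup (t b) c = 0" if "b \<in> keys x" "c \<notin> bset C" for b c
      using assms[of b] that \<open>x \<in> _\<close> lookup_outside[of "t b" "bset C" c]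
      by (auto simp: carrier_free_module gcomp_free_module)
    then have "lookup (linear_extension t x) c = 0" if "c \<notin> bset C" for c
      using that by (simp add: lookup_linear_extension)
    then show ?thesis by (auto simp: carrier_free_module in_keys_iff)
  qed
  have "linear_extension t x \<in> gcomp (free_module C) a" if "x \<in> gcomp (free_module B) a" for x a
  proof -
    have "x \<in> carrier (free_module B)" using that by (rule gcomp_carrier_free_module)
    then have "strand C a' (linear_extension t x) = mat_app (\<lambda>b. strand C (bdeg B b) (t b)) (strand B a' x)" for a'
      by (intro strand_linear_extension assms) (auto simp: carrier_free_module)
    then show ?thesis using that c by (simp add: gcomp_iff_strand)
  qed
  then show ?thesis using c
    by (auto simp: graded_hom_def linear_extension_add linear_extension_fsmult)
qed

section \<open>The star product of a map with an identity\<close>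

definition column :: "(('b \<times> 'c) \<Rightarrow>\<^sub>0 'k::zero) \<Rightarrow> 'c \<Rightarrow> ('b \<Rightarrow>\<^sub>0 'k)"
  where "column p h = Poly_Mapping.map_key (\<lambda>f. (f, h)) p"

lemma lookup_column [simp]: "lookup (column p h) f = lookup p (f, h)"
  by (simp add: column_def map_key.rep_eq inj_def)

lemma finite_columns: "finite {h. column p h \<noteq> 0}"
proof (rule finite_subset)
  have "\<exists>f. (f, h) \<in> keys p" if "column p h \<noteq> 0" for h
    using that poly_mapping_eqI[of "column p h" 0] by (auto simp: in_keys_iff)
  then show "{h. column p h \<noteq> 0} \<subseteq> snd ` keys p" by (force simp: image_iff)
qed simp

lemma column_mat_app:
  assumes "\<And>f h g h'. (f, h) \<in> keys p \<Longrightarrow> lookup (T (f, h)) (g, h') = (if h = h' then lookup (A f) g else 0)"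
  shows "column (mat_app T p) h = mat_app A (column p h)"
proof (rule poly_mapping_eqI)
  fix g
  have "(\<Sum>b\<in>keys p. lookup p b * lookup (T b) (g, h)) =
      (\<Sum>b\<in>(\<lambda>f. (f, h)) ` keys (column p h). lookup p b * lookup (T b) (g, h))"
    by (rule sum.mono_neutral_right) (auto simp: in_keys_iff assms image_iff)
  also have "\<dots> = (\<Sum>f\<in>keys (column p h). lookup (column p h) f * lookup (A f) g)"
    by (subst sum.reindex) (auto simp: inj_on_def in_keys_iff assms)
  finally show "lookup (column (mat_app T p) h) g = lookup (mat_app A (column p h)) g"
    by (simp add: lookup_mat_app)
qed

lemma column_row_app:
  assumes "\<And>f h g h'. (f, h) \<in> keys p \<Longrightarrow> lookup (T (f, h)) (g, h') = (if f = g then lookup (A h) h' else 0)"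
  shows "column (mat_app T p) h' = row_app A (column p) h'"
proof (rule poly_mapping_eqI)
  fix f
  let ?H = "{h. (f, h) \<in> keys p}"
  have sub: "?H \<subseteq> {h. column p h \<noteq> 0}"
    by (auto simp: in_keys_iff dest: arg_cong[of _ _ "\<lambda>q. lookup q f"])
  have "(\<Sum>b\<in>keys p. lookup p b * lookup (T b) (f, h')) =
      (\<Sum>b\<in>Pair f ` ?H. lookup p b * lookup (T b) (f, h'))"
    by (rule sum.mono_neutral_right) (auto simp: assms split: if_splits)
  also have "\<dots> = (\<Sum>h\<in>?H. lookup p (f, h) * lookup (A h) h')"
    by (subst sum.reindex) (auto simp: inj_on_def assms)
  also have "\<dots> = (\<Sum>h\<in>{h. column p h \<noteq> 0}. lookup (A h) h' * lookup (column p h) f)"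
    using sub by (intro sum.mono_neutral_cong_left finite_columns) (auto simp: in_keys_iff)
  finally show "lookup (column (mat_app T p) h') f = lookup (row_app A (column p) h') f"
    by (simp add: lookup_mat_app row_app_def lookup_sum)
qed

lemma star_basis_simps [simp]: "bset (star_basis F G) = bset F \<times> bset G"
  "bdeg (star_basis F G) (f, g) = sup (bdeg F f) (bdeg G g)"
  by (simp_all add: star_basis_def)

lemma direct_sum_basis_simps [simp]: "(j, b) \<in> bset (direct_sum_basis J B) \<longleftrightarrow> j \<in> J \<and> b \<in> bset (B j)"
  "bdeg (direct_sum_basis J B) (j, b) = bdeg (B j) b"
  by (simp_all add: direct_sum_basis_def)

lemma scalar_entry_outside: "g \<notin> keys (\<phi> (single f 1)) \<Longrightarrow> scalar_entry F G \<phi> f g = 0"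
  by (simp add: scalar_entry_def in_keys_iff)

lemma scalar_entry_le: "scalar_entry F G \<phi> f g \<noteq> 0 \<Longrightarrow> bdeg G g \<le> bdeg F f"
  by (simp add: scalar_entry_def split: if_splits)

lemma scalar_entry_bset:
  assumes "graded_hom (free_module F) (free_module G) \<phi>" "f \<in> bset F" "scalar_entry F G \<phi> f g \<noteq> 0"
  shows "g \<in> bset G"
  using free_hom_carrier[OF assms(1), of "single f 1"] assms scalar_entry_outside[of g \<phi> f F G]
  by (auto simp: carrier_free_module)

definition star_Id_entries :: "('v, 'b) graded_basis \<Rightarrow> ('v, 'c) graded_basis \<Rightarrow>
    (('v, 'k::field, 'b) fvec \<Rightarrow> ('v, 'k, 'c) fvec) \<Rightarrow> ('v, 'd) graded_basis \<Rightarrow>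
    'b \<times> 'd \<Rightarrow> ('v, 'k, 'c \<times> 'd) fvec"
  where "star_Id_entries F G \<phi> H = (\<lambda>(f, h). \<Sum>g\<in>keys (\<phi> (single f 1)). single (g, h)
        (single (sup (bdeg H h) (bdeg F f) - sup (bdeg H h) (bdeg G g)) (scalar_entry F G \<phi> f g)))"

definition Id_star_entries :: "('v, 'd) graded_basis \<Rightarrow> ('v, 'b) graded_basis \<Rightarrow> ('v, 'c) graded_basis \<Rightarrow>
    (('v, 'k::field, 'b) fvec \<Rightarrow> ('v, 'k, 'c) fvec) \<Rightarrow> 'd \<times> 'b \<Rightarrow> ('v, 'k, 'd \<times> 'c) fvec"
  where "Id_star_entries H F G \<phi> = (\<lambda>(h, f). \<Sum>g\<in>keys (\<phi> (single f 1)). single (h, g)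
        (single (sup (bdeg H h) (bdeg F f) - sup (bdeg H h) (bdeg G g)) (scalar_entry F G \<phi> f g)))"

lemma star_Id_eq: "star_Id F G \<phi> H = linear_extension (star_Id_entries F G \<phi> H)"
  and Id_star_eq: "Id_star H F G \<phi> = linear_extension (Id_star_entries H F G \<phi>)"
  by (simp_all add: star_Id_def star_Id_entries_def Id_star_def Id_star_entries_def)

context
  fixes F :: "('v, 'b) graded_basis" and G :: "('v, 'c) graded_basis"
    and \<phi> :: "('v, 'k::field, 'b) fvec \<Rightarrow> ('v, 'k, 'c) fvec"
  assumes hom: "graded_hom (free_module F) (free_module G) \<phi>"
begin

lemma star_Id_entry:
  fixes H :: "('v, 'd) graded_basis"
  shows star_Id_lookup: "lookup (star_Id_entries F G \<phi> H (f, h)) (g, h') = (if h = h' then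
        single (sup (bdeg H h) (bdeg F f) - sup (bdeg H h) (bdeg G g)) (scalar_entry F G \<phi> f g) else 0)"
    and star_Id_gcomp: "b \<in> bset (star_basis F H) \<Longrightarrow>
      star_Id_entries F G \<phi> H b \<in> gcomp (free_module (star_basis G H)) (bdeg (star_basis F H) b)"
proof -
  show 1: "lookup (star_Id_entries F G \<phi> H (f, h)) (g, h') = (if h = h' then
        single (sup (bdeg H h) (bdeg F f) - sup (bdeg H h) (bdeg G g)) (scalar_entry F G \<phi> f g) else 0)" for f h g h'
    by (auto simp: star_Id_entries_def lookup_sum lookup_single when_def scalar_entry_outside sum.delta)
  show "star_Id_entries F G \<phi> H b \<in> gcomp (free_module (star_basis G H)) (bdeg (star_basis F H) b)" if "b \<in> bset (star_basis F H)"
  proof -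
    obtain f h where b: "b = (f, h)" by (cases b)
    have "g \<in> bset G \<and> h' \<in> bset H" if "lookup (star_Id_entries F G \<phi> H (f, h)) (g, h') \<noteq> 0" for g h'
      using that scalar_entry_bset[OF hom, of f g] \<open>b \<in> _\<close> b by (auto simp: 1 split: if_splits)
    moreover have "e + bdeg (star_basis G H) (g, h') = bdeg (star_basis F H) b"
      if "e \<in> keys (lookup (star_Id_entries F G \<phi> H (f, h)) (g, h'))" for e g h'
    proof -
      have "h' = h" "scalar_entry F G \<phi> f g \<noteq> 0"
        "e = sup (bdeg H h) (bdeg F f) - sup (bdeg H h) (bdeg G g)"
        using that by (auto simp: 1 split: if_splits)
      moreover from this(2) have "sup (bdeg H h) (bdeg G g) \<le> sup (bdeg H h) (bdeg F f)"
        by (intro sup_mono order_refl scalar_entry_le)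
      ultimately show ?thesis by (simp add: b sup_commute)
    qed
    ultimately show ?thesis
      unfolding gcomp_free_module b star_basis_simps split_paired_all
      by (intro conjI allI ballI subsetI) (simp_all only: split_paired_all in_keys_iff mem_Sigma_iff star_basis_simps simp_thms)
  qed
qed

lemma Id_star_entry:
  fixes H :: "('v, 'd) graded_basis"
  shows Id_star_lookup: "lookup (Id_star_entries H F G \<phi> (h, f)) (h', g) = (if h = h' then
        single (sup (bdeg H h) (bdeg F f) - sup (bdeg H h) (bdeg G g)) (scalar_entry F G \<phi> f g) else 0)"
    and Id_star_gcomp: "b \<in> bset (star_basis H F) \<Longrightarrow>
      Id_star_entries H F G \<phi> b \<in> gcomp (free_module (star_basis H G)) (bdeg (star_basis H F) b)"
proof -
  show 1: "lookup (Id_star_entries H F G \<phi> (h, f)) (h', g) = (if h = h' then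
        single (sup (bdeg H h) (bdeg F f) - sup (bdeg H h) (bdeg G g)) (scalar_entry F G \<phi> f g) else 0)" for f h g h'
    by (auto simp: Id_star_entries_def lookup_sum lookup_single when_def scalar_entry_outside sum.delta)
  show "Id_star_entries H F G \<phi> b \<in> gcomp (free_module (star_basis H G)) (bdeg (star_basis H F) b)" if "b \<in> bset (star_basis H F)"
  proof -
    obtain f h where b: "b = (h, f)" by (cases b)
    have "g \<in> bset G \<and> h' \<in> bset H" if "lookup (Id_star_entries H F G \<phi> (h, f)) (h', g) \<noteq> 0" for g h'
      using that scalar_entry_bset[OF hom, of f g] \<open>b \<in> _\<close> b by (auto simp: 1 split: if_splits)
    moreover have "e + bdeg (star_basis H G) (h', g) = bdeg (star_basis H F) b"
      if "e \<in> keys (lookup (Id_star_entries H F G \<phi> (h, f)) (h', g))" for e g h'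
    proof -
      have "h' = h" "scalar_entry F G \<phi> f g \<noteq> 0"
        "e = sup (bdeg H h) (bdeg F f) - sup (bdeg H h) (bdeg G g)"
        using that by (auto simp: 1 split: if_splits)
      moreover from this(2) have "sup (bdeg H h) (bdeg G g) \<le> sup (bdeg H h) (bdeg F f)"
        by (intro sup_mono order_refl scalar_entry_le)
      ultimately show ?thesis by (simp add: b)
    qed
    ultimately show ?thesis
      unfolding gcomp_free_module b star_basis_simps split_paired_all
      by (intro conjI allI ballI subsetI) (simp_all only: split_paired_all in_keys_iff mem_Sigma_iff star_basis_simps simp_thms)
  qed
qed

lemma graded_hom_star_Id:
  "graded_hom (free_module (star_basis F H)) (free_module (star_basis G H)) (star_Id F G \<phi> H)"
  unfolding star_Id_eq by (rule graded_hom_linear_extension) (rule star_Id_gcomp)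

lemma graded_hom_Id_star:
  "graded_hom (free_module (star_basis H F)) (free_module (star_basis H G)) (Id_star H F G \<phi>)"
  unfolding Id_star_eq by (rule graded_hom_linear_extension) (rule Id_star_gcomp)

text \<open>
  In a strand the least common multiples are invisible, so \<open>\<phi> * Id(H)\<close> acts on each column by the scalar
  matrix of \<open>\<phi>\<close>, as \<open>\<phi> \<otimes> 1\<close> does.
\<close>

lemma column_star_Id:
  assumes "x \<in> carrier (free_module (star_basis F H))"
  shows "column (strand (star_basis G H) a (star_Id F G \<phi> H x)) h =
    mat_app (scalar_matrix F G \<phi>) (column (strand (star_basis F H) a x) h)"
  unfolding star_Id_eq
proof (subst strand_linear_extension[of x _ "star_basis G H" "star_basis F H"])
  fix b assume "b \<in> keys x"
  then show "star_Id_entries F G \<phi> H b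
      \<in> gcomp (free_module (star_basis G H)) (bdeg (star_basis F H) b)"
    using assms by (intro star_Id_gcomp) (auto simp: carrier_free_module)
next
  show "column (mat_app (\<lambda>b. strand (star_basis G H) (bdeg (star_basis F H) b)
      (star_Id_entries F G \<phi> H b))
      (strand (star_basis F H) a x)) h = mat_app (scalar_matrix F G \<phi>) (column (strand (star_basis F H) a x) h)"
  proof (rule column_mat_app)
    fix f h g h'
    show "lookup (strand (star_basis G H) (bdeg (star_basis F H) (f, h))
      (star_Id_entries F G \<phi> H (f, h))) (g, h') =
      (if h = h' then lookup (scalar_matrix F G \<phi> f) g else 0)"
      unfolding lookup_strand star_Id_lookup lookup_scalar_matrix star_basis_simps
      using le_supI2[OF scalar_entry_le[of F G \<phi> f g], of "bdeg H h"] by (auto simp: sup_commute)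
  qed
qed

lemma column_Id_star:
  assumes "x \<in> carrier (free_module (star_basis H F))"
  shows "column (strand (star_basis H G) a (Id_star H F G \<phi> x)) g =
    row_app (scalar_matrix F G \<phi>) (column (strand (star_basis H F) a x)) g"
  unfolding Id_star_eq
proof (subst strand_linear_extension[of x _ "star_basis H G" "star_basis H F"])
  fix b assume "b \<in> keys x"
  then show "Id_star_entries H F G \<phi> b
      \<in> gcomp (free_module (star_basis H G)) (bdeg (star_basis H F) b)"
    using assms by (intro Id_star_gcomp) (auto simp: carrier_free_module)
next
  show "column (mat_app (\<lambda>b. strand (star_basis H G) (bdeg (star_basis H F) b)
      (Id_star_entries H F G \<phi> b))
      (strand (star_basis H F) a x)) g = row_app (scalar_matrix F G \<phi>) (column (strand (star_basis H F) a x)) g"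
  proof (rule column_row_app)
    fix f h g h'
    show "lookup (strand (star_basis H G) (bdeg (star_basis H F) (h, f))
      (Id_star_entries H F G \<phi> (h, f))) (h', g) =
      (if h = h' then lookup (scalar_matrix F G \<phi> f) g else 0)"
      unfolding lookup_strand Id_star_lookup lookup_scalar_matrix star_basis_simps
      using le_supI2[OF scalar_entry_le[of F G \<phi> f g], of "bdeg H h"] by (auto simp: sup_commute)
  qed
qed

end

lemma lookup_proj [simp]: "lookup (proj j x) b = lookup x (j, b)"
proof -
  have "lookup (proj j x) b = (\<Sum>c\<in>keys x. if c = (j, b) then lookup x c else 0)"
    unfolding proj_def lookup_linear_extension
    by (intro sum.cong) (auto simp: lookup_single when_def split: prod.splits)
  then show ?thesis by (simp add: in_keys_iff)
qed

lemma lookup_incl: "lookup (incl j x) (j', b) = (if j' = j then lookup x b else 0)"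
proof -
  have "lookup (incl j x) (j', b) = (\<Sum>c\<in>keys x. if c = b then (if j' = j then lookup x c else 0) else 0)"
    unfolding incl_def lookup_linear_extension
    by (intro sum.cong) (auto simp: lookup_single when_def)
  then show ?thesis by (simp add: in_keys_iff)
qed

lemma graded_hom_proj:
  assumes "j \<in> J"
  shows "graded_hom (free_module (direct_sum_basis J B)) (free_module (B j)) (proj j)"
  unfolding proj_def
  by (rule graded_hom_linear_extension)
     (auto simp: single_in_gcomp gcomp_free_module[of 0] split: prod.splits)

lemma graded_hom_incl:
  assumes "j \<in> J"
  shows "graded_hom (free_module (B j)) (free_module (direct_sum_basis J B)) (incl j)"
  unfolding incl_def
proof (rule graded_hom_linear_extension)
  fix b assume "b \<in> bset (B j)"
  then show "single (j, b) 1 \<in> gcomp (free_module (direct_sum_basis J B)) (bdeg (B j) b)"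
    using single_in_gcomp[of "(j, b)" "direct_sum_basis J B"] assms by simp
qed

lemma strand_proj: "lookup (strand (B j) a (proj j x)) b = lookup (strand (direct_sum_basis J B) a x) (j, b)"
  by (simp add: lookup_strand)

lemma strand_incl: "lookup (strand (direct_sum_basis J B) a (incl j x)) (j', b) =
    (if j' = j then lookup (strand (B j) a x) b else 0)"
  by (simp add: lookup_strand lookup_incl)

lemma graded_hom_comp:
  "graded_hom L M \<phi> \<Longrightarrow> graded_hom M N \<psi> \<Longrightarrow> graded_hom L N (\<lambda>x. \<psi> (\<phi> x))"
  unfolding graded_hom_def by (auto simp: Pi_iff image_subset_iff)

lemma carrier_free_add:
    "x \<in> carrier (free_module B) \<Longrightarrow> y \<in> carrier (free_module B) \<Longrightarrow> x + y \<in> carrier (free_module B)"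
  and carrier_free_fsmult: "x \<in> carrier (free_module B) \<Longrightarrow> fsmult s x \<in> carrier (free_module B)"
  using keys_add[of x y] keys_fsmult[of s x] by (auto simp: carrier_free_module)

lemma graded_hom_free_add:
  assumes "graded_hom (free_module B) (free_module C) \<phi>" "graded_hom (free_module B) (free_module C) \<psi>"
  shows "graded_hom (free_module B) (free_module C) (\<lambda>x. \<phi> x + \<psi> x)"
proof -
  have c: "\<phi> x + \<psi> x \<in> carrier (free_module C)" if "x \<in> carrier (free_module B)" for x
    using free_hom_carrier[OF assms(1) that] free_hom_carrier[OF assms(2) that] keys_add[of "\<phi> x" "\<psi> x"]
    by (auto simp: carrier_free_module)
  have g: "\<phi> x + \<psi> x \<in> gcomp (free_module C) a" if "x \<in> gcomp (free_module B) a" for x a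
    using free_hom_gcomp[OF assms(1) that] free_hom_gcomp[OF assms(2) that] c[OF gcomp_carrier_free_module[OF that]]
    by (simp add: gcomp_iff_strand strand_add)
  show ?thesis
    using c g free_hom_add[OF assms(1)] free_hom_add[OF assms(2)] free_hom_fsmult[OF assms(1)] free_hom_fsmult[OF assms(2)]
    unfolding graded_hom_def by (auto simp: fsmult_distribs)
qed

lemma graded_hom_free_zero:
  fixes \<phi> :: "('v, 'k::field, 'b) fvec \<Rightarrow> ('v, 'k, 'c) fvec"
  assumes "\<And>x. x \<in> carrier (free_module B) \<Longrightarrow> \<phi> x = 0"
  shows "graded_hom (free_module B) (free_module C) \<phi>"
proof -
  have "\<phi> x = 0" if "x \<in> gcomp (free_module B) a" for x a
    using assms gcomp_carrier_free_module that by blast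
  moreover have "(0 :: ('v, 'k, 'c) fvec) \<in> carrier (free_module C)" "(0 :: ('v, 'k, 'c) fvec) \<in> gcomp (free_module C) a" for a
    by (simp_all add: carrier_free_module gcomp_free_module)
  ultimately show ?thesis using assms unfolding graded_hom_def
    by (auto simp: image_subset_iff carrier_free_add carrier_free_fsmult)
qed

lemma graded_hom_free_sum:
  assumes "finite S" "\<And>s. s \<in> S \<Longrightarrow> graded_hom (free_module B) (free_module C) (\<phi> s)"
  shows "graded_hom (free_module B) (free_module C) (\<lambda>x. \<Sum>s\<in>S. \<phi> s x)"
  using assms by (induction S) (simp_all add: graded_hom_free_add graded_hom_free_zero)

lemma strand_neg_one_power: "strand B a (fsmult ((-1) ^ j) x) = pscale ((-1) ^ j) (strand B a x)"
proof -
  have "lookup ((- 1) ^ j * p) e = (- 1) ^ j * lookup p e" for p :: "('v, 'k::field) mpoly" and e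
    by (cases "even j") simp_all
  then show ?thesis by (auto intro!: poly_mapping_eqI simp: lookup_strand)
qed

lemma fsmult_commute: "fsmult s (fsmult t x) = fsmult t (fsmult s x)"
  by (simp add: fsmult_distribs(3)[symmetric] mult.commute)

lemma graded_hom_neg_one_power:
  assumes "graded_hom (free_module B) (free_module C) \<phi>"
  shows "graded_hom (free_module B) (free_module C) (\<lambda>x. fsmult ((-1) ^ j) (\<phi> x))"
proof -
  have c: "fsmult ((-1) ^ j) (\<phi> x) \<in> carrier (free_module C)" if "x \<in> carrier (free_module B)" for x
    using free_hom_carrier[OF assms(1) that] keys_fsmult[of "(-1) ^ j" "\<phi> x"]
    by (auto simp: carrier_free_module)
  have g: "fsmult ((-1) ^ j) (\<phi> x) \<in> gcomp (free_module C) a" if "x \<in> gcomp (free_module B) a" for x a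
    using free_hom_gcomp[OF assms(1) that] c[OF gcomp_carrier_free_module[OF that]]
    by (simp add: gcomp_iff_strand strand_neg_one_power)
  show ?thesis
    using c g free_hom_add[OF assms(1)] free_hom_fsmult[OF assms(1)]
    unfolding graded_hom_def by (auto simp: fsmult_distribs(1) fsmult_commute[of "(-1) ^ j"])
qed

section \<open>Strands of a complex\<close>

text \<open>
  For \<open>i = 0\<close> the truncated index \<open>i - 1\<close> makes \<open>C\<^sub>0\<close> its own target; this is harmless because the
  differential of a complex vanishes on \<open>C\<^sub>0\<close>.
\<close>

definition diff_matrix :: "('v, 'k::field, 'b) free_complex \<Rightarrow> nat \<Rightarrow> 'b \<Rightarrow> ('b \<Rightarrow>\<^sub>0 'k)"
  where "diff_matrix C i = scalar_matrix (cbasis C i) (cbasis C (i - 1)) (cdiff C i)"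

abbreviation cstrand :: "('v, 'k::field, 'b) free_complex \<Rightarrow> 'v expo \<Rightarrow> nat \<Rightarrow> 'b set"
  where "cstrand C a i \<equiv> strand_basis (cbasis C i) a"

lemma is_complex_hom:
  assumes "is_complex C"
  shows "graded_hom (free_module (cbasis C i)) (free_module (cbasis C (i - 1))) (cdiff C i)"
  using assms graded_hom_free_zero by (cases i) (auto simp: is_complex_def cmod_def)

lemma strand_cdiff:
  assumes "is_complex C" "x \<in> carrier (cmod C i)"
  shows "strand (cbasis C (i - 1)) a (cdiff C i x) = mat_app (diff_matrix C i) (strand (cbasis C i) a x)"
  using strand_hom[OF is_complex_hom[OF assms(1)]] assms(2) by (simp add: cmod_def diff_matrix_def)

lemma unstrand_carrier:
  "v \<in> supported_on (strand_basis B a) \<Longrightarrow> unstrand B a v \<in> carrier (free_module B)"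
  using unstrand_in_gcomp gcomp_carrier_free_module by blast

lemma diff_matrix_supported:
  assumes "is_complex C" "v \<in> supported_on (cstrand C a i)"
  shows "mat_app (diff_matrix C i) v \<in> supported_on (cstrand C a (i - 1))"
proof -
  have u: "unstrand (cbasis C i) a v \<in> carrier (cmod C i)"
    unfolding cmod_def by (rule unstrand_carrier[OF assms(2)])
  have "cdiff C i (unstrand (cbasis C i) a v) \<in> carrier (free_module (cbasis C (i - 1)))"
    by (rule free_hom_carrier[OF is_complex_hom[OF assms(1)] u[unfolded cmod_def]])
  from keys_strand[OF this, of a] show ?thesis
    unfolding strand_cdiff[OF assms(1) u, of a] by (simp add: strand_unstrand[OF assms(2)])
qed

lemma diff_matrix_square:
  assumes "is_complex C" "v \<in> supported_on (cstrand C a (Suc (Suc j)))"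
  shows "mat_app (diff_matrix C (Suc j)) (mat_app (diff_matrix C (Suc (Suc j))) v) = 0"
proof -
  let ?x = "unstrand (cbasis C (Suc (Suc j))) a v"
  have u: "?x \<in> carrier (cmod C (Suc (Suc j)))"
    unfolding cmod_def by (rule unstrand_carrier[OF assms(2)])
  then have "cdiff C (Suc (Suc j)) ?x \<in> carrier (cmod C (Suc j))"
    using free_hom_carrier[OF is_complex_hom[OF assms(1), of "Suc (Suc j)"]] by (simp add: cmod_def)
  from strand_cdiff[OF assms(1) this, of a] strand_cdiff[OF assms(1) u, of a] assms u
  show ?thesis by (simp add: is_complex_def strand_unstrand)
qed

text \<open>
  Differentials are homogeneous, so preimages can be chosen degree by degree and added up.
\<close>

lemma boundary_iff_strands:
  assumes "is_complex C" "y \<in> carrier (cmod C i)"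
  shows "y \<in> cdiff C (Suc i) ` carrier (cmod C (Suc i)) \<longleftrightarrow>
    (\<forall>a. strand (cbasis C i) a y \<in> mat_app (diff_matrix C (Suc i)) ` supported_on (cstrand C a (Suc i)))"
    (is "y \<in> ?I \<longleftrightarrow> _")
proof
  assume "y \<in> ?I"
  then obtain x where x: "x \<in> carrier (cmod C (Suc i))" "y = cdiff C (Suc i) x" by blast
  then show "\<forall>a. strand (cbasis C i) a y \<in> mat_app (diff_matrix C (Suc i)) ` supported_on (cstrand C a (Suc i))"
    using strand_cdiff[OF assms(1) x(1)] keys_strand x(1) unfolding cmod_def by fastforce
next
  assume *: "\<forall>a. strand (cbasis C i) a y \<in> mat_app (diff_matrix C (Suc i)) ` supported_on (cstrand C a (Suc i))"
  note hom = is_complex_hom[OF assms(1), of "Suc i"]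
  show "y \<in> ?I"
  proof (rule strands_closed[OF assms(2)[unfolded cmod_def]])
    show "0 \<in> ?I" using free_hom_zero[OF hom] by (auto simp: cmod_def carrier_free_module intro!: image_eqI[of _ _ 0])
    show "z + w \<in> ?I" if "z \<in> ?I" "w \<in> ?I" for z w
      using that carrier_free_add free_hom_add[OF hom] unfolding cmod_def by (force intro: image_eqI[of _ _ "_ + _"])
    fix a
    obtain v where v: "v \<in> supported_on (cstrand C a (Suc i))" "strand (cbasis C i) a y = mat_app (diff_matrix C (Suc i)) v"
      using * by blast
    let ?x = "unstrand (cbasis C (Suc i)) a v"
    have u: "?x \<in> gcomp (cmod C (Suc i)) a" unfolding cmod_def by (rule unstrand_in_gcomp[OF v(1)])
    then have u': "?x \<in> carrier (cmod C (Suc i))" unfolding cmod_def by (rule gcomp_carrier_free_module)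
    have "cdiff C (Suc i) ?x \<in> gcomp (free_module (cbasis C i)) a"
      using free_hom_gcomp[OF hom] u unfolding cmod_def by simp
    from unstrand_strand[OF this] have "unstrand (cbasis C i) a (strand (cbasis C i) a y) = cdiff C (Suc i) ?x"
      using strand_cdiff[OF assms(1) u', of a] v by (simp add: strand_unstrand)
    then show "unstrand (cbasis C i) a (strand (cbasis C i) a y) \<in> ?I" using u' by simp
  qed
qed

lemma all_if_mem_iff: "\<forall>a'. z \<in> R a' \<Longrightarrow> (\<forall>a'. (if a' = a then v else z) \<in> R a') \<longleftrightarrow> v \<in> R a"
  by auto

lemma unstrand_boundary_iff:
  assumes "is_complex C" "v \<in> supported_on (cstrand C a i)"
  shows "unstrand (cbasis C i) a v \<in> cdiff C (Suc i) ` carrier (cmod C (Suc i)) \<longleftrightarrow>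
    v \<in> mat_app (diff_matrix C (Suc i)) ` supported_on (cstrand C a (Suc i))"
proof -
  have u: "unstrand (cbasis C i) a v \<in> carrier (cmod C i)"
    unfolding cmod_def by (rule unstrand_carrier[OF assms(2)])
  have "\<forall>a'. 0 \<in> mat_app (diff_matrix C (Suc i)) ` supported_on (cstrand C a' (Suc i))"
    by (rule allI, rule image_eqI[of _ _ 0]) simp_all
  from all_if_mem_iff[OF this, of a v] boundary_iff_strands[OF assms(1) u] show ?thesis
    by (simp only: strand_unstrand[OF assms(2)])
qed

definition exact_at :: "('v, 'k::field, 'b) free_complex \<Rightarrow> nat \<Rightarrow> bool"
  where "exact_at C i \<longleftrightarrow> (\<forall>x\<in>carrier (cmod C i). cdiff C i x = 0 \<longrightarrow>
    x \<in> cdiff C (Suc i) ` carrier (cmod C (Suc i)))"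

lemma exact_at_iff_strands:
  assumes "is_complex C"
  shows "exact_at C (Suc i) \<longleftrightarrow> (\<forall>a. \<forall>v\<in>supported_on (cstrand C a (Suc i)). mat_app (diff_matrix C (Suc i)) v = 0 \<longrightarrow>
    v \<in> mat_app (diff_matrix C (Suc (Suc i))) ` supported_on (cstrand C a (Suc (Suc i))))"
proof (intro iffI allI ballI impI)
  fix a v assume *: "exact_at C (Suc i)" "v \<in> supported_on (cstrand C a (Suc i))" "mat_app (diff_matrix C (Suc i)) v = 0"
  let ?x = "unstrand (cbasis C (Suc i)) a v"
  have u: "?x \<in> carrier (cmod C (Suc i))"
    unfolding cmod_def by (rule unstrand_carrier[OF *(2)])
  have "strand (cbasis C i) a' (cdiff C (Suc i) ?x) = 0" for a'
    using strand_cdiff[OF assms u, of a'] *(3) by (simp add: strand_unstrand[OF *(2)])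
  then have "cdiff C (Suc i) ?x = 0" by (intro strand_eqI[of "cbasis C i"]) simp
  then show "v \<in> mat_app (diff_matrix C (Suc (Suc i))) ` supported_on (cstrand C a (Suc (Suc i)))"
    using *(1) u unstrand_boundary_iff[OF assms *(2)] by (simp add: exact_at_def)
next
  assume *: "\<forall>a. \<forall>v\<in>supported_on (cstrand C a (Suc i)). mat_app (diff_matrix C (Suc i)) v = 0 \<longrightarrow>
    v \<in> mat_app (diff_matrix C (Suc (Suc i))) ` supported_on (cstrand C a (Suc (Suc i)))"
  show "exact_at C (Suc i)" unfolding exact_at_def
  proof (intro ballI impI)
    fix x assume x: "x \<in> carrier (cmod C (Suc i))" "cdiff C (Suc i) x = 0"
    show "x \<in> cdiff C (Suc (Suc i)) ` carrier (cmod C (Suc (Suc i)))"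
      unfolding boundary_iff_strands[OF assms x(1)]
    proof
      fix a
      show "strand (cbasis C (Suc i)) a x \<in> mat_app (diff_matrix C (Suc (Suc i))) ` supported_on (cstrand C a (Suc (Suc i)))"
        using *[rule_format, OF keys_strand[OF x(1)[unfolded cmod_def], of a]] strand_cdiff[OF assms x(1), of a] x(2)
        by simp
    qed
  qed
qed

section \<open>The star complex as a total complex\<close>

lemma graded_hom_star_cdiff:
  fixes F :: "('v, 'k::field, 'b) free_complex" and G :: "('v, 'k, 'c) free_complex"
  assumes F: "is_complex F" and G: "is_complex G"
  shows "graded_hom (free_module (cbasis (star_complex F G) (Suc i))) (free_module (cbasis (star_complex F G) i))
    (cdiff (star_complex F G) (Suc i))"
proof -
  let ?B = "\<lambda>(j, k). star_basis (cbasis F j) (cbasis G k)"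
  let ?S = "\<lambda>i. direct_sum_basis {(j, k). j + k = i} ?B"
  have p: "graded_hom (free_module (?S (Suc i))) (free_module (star_basis (cbasis F j) (cbasis G k)))
      (proj (j, k) :: ('v, 'k, (nat \<times> nat) \<times> ('b \<times> 'c)) fvec \<Rightarrow> _)"
    if "j + k = Suc i" for j k
    using graded_hom_proj[of "(j, k)" "{(j, k). j + k = Suc i}" ?B] that by simp
  have q: "graded_hom (free_module (star_basis (cbasis F j) (cbasis G k))) (free_module (?S i))
      (incl (j, k) :: ('v, 'k, 'b \<times> 'c) fvec \<Rightarrow> _)"
    if "j + k = i" for j k
    using graded_hom_incl[of "(j, k)" "{(j, k). j + k = i}" ?B] that by simp
  have t1: "graded_hom (free_module (?S (Suc i))) (free_module (?S i))
      (\<lambda>x. incl (j - 1, k) (star_Id (cbasis F j) (cbasis F (j - 1)) (cdiff F j) (cbasis G k) (proj (j, k) x)))"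
    if jk: "j + k = Suc i" for j k
  proof (cases j)
    case 0
    have "star_Id (cbasis F 0) (cbasis F (0 - 1)) (cdiff F 0) (cbasis G k) y = 0"
      if "y \<in> carrier (free_module (star_basis (cbasis F 0) (cbasis G k)))" for y
    proof -
      have "cdiff F 0 (single f 1) = 0" if "f \<in> bset (cbasis F 0)" for f
        using F that by (simp add: is_complex_def cmod_def carrier_free_module)
      then show ?thesis using that
        unfolding star_Id_def linear_extension_def
        by (intro sum.neutral) (auto simp: carrier_free_module)
    qed
    then show ?thesis
      using free_hom_carrier[OF p[OF jk]] 0 by (intro graded_hom_free_zero) (simp add: incl_def)
  next
    case (Suc j')
    show ?thesis
      by (rule graded_hom_comp[OF graded_hom_comp[OF p[OF jk] graded_hom_star_Id[OF is_complex_hom[OF F]]] q])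
        (use Suc jk in simp)
  qed
  have t2: "graded_hom (free_module (?S (Suc i))) (free_module (?S i))
      (\<lambda>x. incl (j, k - 1) (Id_star (cbasis F j) (cbasis G k) (cbasis G (k - 1)) (cdiff G k) (proj (j, k) x)))"
    if jk: "j + k = Suc i" for j k
  proof (cases k)
    case 0
    have "Id_star (cbasis F j) (cbasis G 0) (cbasis G (0 - 1)) (cdiff G 0) y = 0"
      if "y \<in> carrier (free_module (star_basis (cbasis F j) (cbasis G 0)))" for y
    proof -
      have "cdiff G 0 (single g 1) = 0" if "g \<in> bset (cbasis G 0)" for g
        using G that by (simp add: is_complex_def cmod_def carrier_free_module)
      then show ?thesis using that
        unfolding Id_star_def linear_extension_def
        by (intro sum.neutral) (auto simp: carrier_free_module)
    qed
    then show ?thesis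
      using free_hom_carrier[OF p[OF jk]] 0 by (intro graded_hom_free_zero) (simp add: incl_def)
  next
    case (Suc k')
    show ?thesis
      by (rule graded_hom_comp[OF graded_hom_comp[OF p[OF jk] graded_hom_Id_star[OF is_complex_hom[OF G]]] q])
        (use Suc jk in simp)
  qed
  have "finite {(j, k). j + k = Suc i}"
    by (rule finite_subset[of _ "{..Suc i} \<times> {..Suc i}"]) auto
  then have "graded_hom (free_module (?S (Suc i))) (free_module (?S i))
     (\<lambda>x. \<Sum>s\<in>{(j, k). j + k = Suc i}.
        incl (fst s - 1, snd s) (star_Id (cbasis F (fst s)) (cbasis F (fst s - 1)) (cdiff F (fst s)) (cbasis G (snd s)) (proj (fst s, snd s) x))
        + fsmult ((-1) ^ fst s)
          (incl (fst s, snd s - 1) (Id_star (cbasis F (fst s)) (cbasis G (snd s)) (cbasis G (snd s - 1)) (cdiff G (snd s)) (proj (fst s, snd s) x))))"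
  proof (rule graded_hom_free_sum)
    fix s assume "s \<in> {(j, k). j + k = Suc i}"
    then have "fst s + snd s = Suc i" by auto
    from graded_hom_free_add[OF t1[OF this] graded_hom_neg_one_power[OF t2[OF this]]]
    show "graded_hom (free_module (?S (Suc i))) (free_module (?S i)) (\<lambda>x.
        incl (fst s - 1, snd s) (star_Id (cbasis F (fst s)) (cbasis F (fst s - 1)) (cdiff F (fst s)) (cbasis G (snd s)) (proj (fst s, snd s) x))
        + fsmult ((-1) ^ fst s)
          (incl (fst s, snd s - 1) (Id_star (cbasis F (fst s)) (cbasis G (snd s)) (cbasis G (snd s - 1)) (cdiff G (snd s)) (proj (fst s, snd s) x))))" .
  qed
  then show ?thesis
    by (simp add: star_complex_def split_beta)
qed

text \<open>
  The column of \<open>p\<close> at \<open>g\<close> in bidegree \<open>(j, k)\<close>, for a strand \<open>p\<close> of the star complex.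
\<close>

definition tensor_column :: "((nat \<times> nat) \<times> ('b \<times> 'c) \<Rightarrow>\<^sub>0 'k::zero) \<Rightarrow> nat \<Rightarrow> nat \<Rightarrow> 'c \<Rightarrow> ('b \<Rightarrow>\<^sub>0 'k)"
  where "tensor_column p j k = column (Poly_Mapping.map_key (Pair (j, k)) p)"

lemma lookup_tensor_column [simp]: "lookup (tensor_column p j k g) f = lookup p ((j, k), (f, g))"
  by (simp add: tensor_column_def map_key.rep_eq inj_def)

lemma tensor_column_eqI:
  fixes p q :: "(nat \<times> nat) \<times> ('a \<times> 'b) \<Rightarrow>\<^sub>0 'k::zero"
  assumes "\<And>j k g. tensor_column p j k g = tensor_column q j k g"
  shows "p = q"
proof (rule poly_mapping_eqI)
  fix b :: "(nat \<times> nat) \<times> ('a \<times> 'b)" obtain j k f g where b: "b = ((j, k), (f, g))" by (cases b) auto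
  show "lookup p b = lookup q b" using arg_cong[OF assms[of j k g], of "\<lambda>q. lookup q f"] b by simp
qed

lemma tensor_column_zero [simp]: "tensor_column 0 j k g = 0"
  by (rule poly_mapping_eqI) simp

text \<open>
  The strands of the star complex form the total complex of the tensor product of the strands of \<open>F\<close>
  and \<open>G\<close>: of all summands of the differential, only those starting in bidegrees \<open>(j + 1, k)\<close> and
  \<open>(j, k + 1)\<close> reach bidegree \<open>(j, k)\<close>.
\<close>

lemma tensor_column_star_cdiff:
  assumes F: "is_complex F" and G: "is_complex G" and x: "x \<in> carrier (cmod (star_complex F G) (Suc i))"
    and jk: "j + k = i"
  shows "tensor_column (strand (cbasis (star_complex F G) i) a (cdiff (star_complex F G) (Suc i) x)) j k g =
    total_diff (diff_matrix F) (diff_matrix G) (tensor_column (strand (cbasis (star_complex F G) (Suc i)) a x)) j k g"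
proof (rule poly_mapping_eqI)
  fix f
  let ?B = "\<lambda>(j, k). star_basis (cbasis F j) (cbasis G k)"
  let ?S = "\<lambda>i. direct_sum_basis {(j, k). j + k = i} ?B"
  let ?st = "\<lambda>j k. strand (star_basis (cbasis F j) (cbasis G k)) a"
  let ?p = "strand (?S (Suc i)) a x"
  let ?u = "\<lambda>j1 k1. star_Id (cbasis F j1) (cbasis F (j1 - 1)) (cdiff F j1) (cbasis G k1) (proj (j1, k1) x)"
  let ?v = "\<lambda>j1 k1. Id_star (cbasis F j1) (cbasis G k1) (cbasis G (k1 - 1)) (cdiff G k1) (proj (j1, k1) x)"
  let ?J = "{(j, k). j + k = Suc i}"
  have SB: "cbasis (star_complex F G) n = ?S n" for n by (simp add: star_complex_def)
  have fin: "finite ?J"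
    by (rule finite_subset[of _ "{..Suc i} \<times> {..Suc i}"]) auto
  have x': "x \<in> carrier (free_module (?S (Suc i)))" using x by (simp add: cmod_def star_complex_def)
  have pr: "proj (j, k) x \<in> carrier (free_module (star_basis (cbasis F j) (cbasis G k)))" if "j + k = Suc i" for j k
    using free_hom_carrier[OF graded_hom_proj x', of "(j, k)"] that by simp
  have st: "?st j k (proj (j, k) x) = Poly_Mapping.map_key (Pair (j, k)) ?p" for j k
    using strand_proj[of ?B "(j, k)" a x] by (intro poly_mapping_eqI) (simp add: map_key.rep_eq inj_def)
  have inc: "lookup (strand (?S i) a (incl (j1, k1) y)) ((j, k), b) =
      (if (j, k) = (j1, k1) then lookup (?st j k y) b else 0)" for j1 k1 y b
    using strand_incl[of "{(j, k). j + k = i}" ?B a "(j1, k1)" y "(j, k)" b] by auto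
  have D: "cdiff (star_complex F G) (Suc i) x =
      (\<Sum>s\<in>?J. incl (fst s - 1, snd s) (?u (fst s) (snd s)) + fsmult ((-1) ^ fst s) (incl (fst s, snd s - 1) (?v (fst s) (snd s))))"
    by (simp add: star_complex_def split_beta)
  have "lookup (strand (?S i) a (cdiff (star_complex F G) (Suc i) x)) ((j, k), (f, g)) =
      (\<Sum>s\<in>?J. (if s = (Suc j, k) then lookup (?st j k (?u (Suc j) k)) (f, g) else 0)
        + (if s = (j, Suc k) then (-1) ^ j * lookup (?st j k (?v j (Suc k))) (f, g) else 0))"
    unfolding D strand_sum lookup_sum strand_add lookup_add strand_neg_one_power lookup_pscale inc
  proof (rule sum.cong[OF refl])
    fix s assume "s \<in> ?J"
    then obtain j1 k1 where s: "s = (j1, k1)" "j1 + k1 = Suc i" by auto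
    have "(j, k) = (j1 - 1, k1) \<longleftrightarrow> s = (Suc j, k)" "(j, k) = (j1, k1 - 1) \<longleftrightarrow> s = (j, Suc k)"
      using s jk by auto
    then show "(if (j, k) = (fst s - 1, snd s) then lookup (?st j k (?u (fst s) (snd s))) (f, g) else 0) +
         (- 1) ^ fst s * (if (j, k) = (fst s, snd s - 1) then lookup (?st j k (?v (fst s) (snd s))) (f, g) else 0) =
        (if s = (Suc j, k) then lookup (?st j k (?u (Suc j) k)) (f, g) else 0)
        + (if s = (j, Suc k) then (-1) ^ j * lookup (?st j k (?v j (Suc k))) (f, g) else 0)"
      using s(1) by auto
  qed
  also have "\<dots> = lookup (?st j k (?u (Suc j) k)) (f, g) + (-1) ^ j * lookup (?st j k (?v j (Suc k))) (f, g)"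
    using fin jk by (simp add: sum.distrib)
  also have "lookup (?st j k (?u (Suc j) k)) (f, g) = lookup (mat_app (diff_matrix F (Suc j)) (tensor_column ?p (Suc j) k g)) f"
    using arg_cong[OF column_star_Id[OF is_complex_hom[OF F, of "Suc j"] pr, of k a g], of "\<lambda>q. lookup q f"] jk
    by (simp add: st tensor_column_def diff_matrix_def)
  also have "lookup (?st j k (?v j (Suc k))) (f, g) = lookup (row_app (diff_matrix G (Suc k)) (tensor_column ?p j (Suc k)) g) f"
    using arg_cong[OF column_Id_star[OF is_complex_hom[OF G, of "Suc k"] pr, of j a g], of "\<lambda>q. lookup q f"] jk
    by (simp add: st tensor_column_def diff_matrix_def)
  finally show "lookup (tensor_column (strand (cbasis (star_complex F G) i) a (cdiff (star_complex F G) (Suc i) x)) j k g) f =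
    lookup (total_diff (diff_matrix F) (diff_matrix G) (tensor_column (strand (cbasis (star_complex F G) (Suc i)) a x)) j k g) f"
    by (simp only: SB total_diff_def lookup_add lookup_pscale lookup_tensor_column)
qed

lemma row_app_add:
  assumes "finite {h. Z h \<noteq> 0}" "finite {h. W h \<noteq> 0}"
  shows "row_app B (\<lambda>h. Z h + W h) g = row_app B Z g + row_app B W g"
proof -
  let ?S = "{h. Z h \<noteq> 0} \<union> {h. W h \<noteq> 0}"
  have "finite ?S" using assms by simp
  then show ?thesis
    using row_app_superset[of ?S Z B g] row_app_superset[of ?S W B g] row_app_superset[of ?S "\<lambda>h. Z h + W h" B g]
    by (force simp: kvs.scale_right_distrib sum.distrib)
qed

lemma row_app_nonzero:
  assumes "row_app B Z g \<noteq> 0"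
  shows "\<exists>h. Z h \<noteq> 0 \<and> g \<in> keys (B h)"
proof (rule ccontr)
  assume "\<not> ?thesis"
  then have "row_app B Z g = 0"
    unfolding row_app_def by (intro sum.neutral) (auto simp: in_keys_iff)
  with assms show False by simp
qed

lemma finite_row_app:
  assumes "finite {h. Z h \<noteq> 0}"
  shows "finite {g. row_app B Z g \<noteq> 0}"
proof (rule finite_subset)
  show "{g. row_app B Z g \<noteq> 0} \<subseteq> (\<Union>h\<in>{h. Z h \<noteq> 0}. keys (B h))"
    using row_app_nonzero[of B Z] by auto
qed (use assms in simp)

lemma row_app_row_app:
  assumes "finite {h. Z h \<noteq> 0}"
  shows "row_app B (row_app B' Z) g = row_app (\<lambda>h. mat_app B (B' h)) Z g"
proof -
  let ?Z = "{h. Z h \<noteq> 0}" and ?S = "\<Union>h\<in>{h. Z h \<noteq> 0}. keys (B' h)"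
  have S: "finite ?S" using assms by simp
  have "row_app B (row_app B' Z) g = (\<Sum>l\<in>?S. pscale (lookup (B l) g) (row_app B' Z l))"
    by (rule row_app_superset[OF S]) (use row_app_nonzero[of B' Z] in auto)
  also have "\<dots> = (\<Sum>h\<in>?Z. \<Sum>l\<in>?S. pscale (lookup (B' h) l * lookup (B l) g) (Z h))"
    unfolding row_app_def kvs.scale_sum_right by (subst sum.swap) (simp add: mult.commute)
  also have "\<dots> = (\<Sum>h\<in>?Z. pscale (lookup (mat_app B (B' h)) g) (Z h))"
  proof (rule sum.cong[OF refl])
    fix h assume "h \<in> ?Z"
    then have "mat_app B (B' h) = (\<Sum>l\<in>?S. pscale (lookup (B' h) l) (B l))"
      by (intro mat_app_superset S) blast
    then show "(\<Sum>l\<in>?S. pscale (lookup (B' h) l * lookup (B l) g) (Z h)) = pscale (lookup (mat_app B (B' h)) g) (Z h)"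
      by (simp add: lookup_sum kvs.scale_sum_left)
  qed
  finally show ?thesis by (simp add: row_app_def)
qed

lemma row_app_scale: "row_app B (\<lambda>h. pscale c (Z h)) g = pscale c (row_app B Z g)"
proof (cases "c = 0")
  case False
  then show ?thesis by (simp add: row_app_def kvs.scale_sum_right mult.commute)
qed (simp add: row_app_def)

text \<open>
  The two mixed terms cancel: the matrices of the two factors commute, and they occur with the opposite
  signs \<open>(-1)\<^sup>j\<^sup>+\<^sup>1\<close> and \<open>(-1)\<^sup>j\<close>. The family \<open>W\<close> is the boundary of \<open>Z\<close> where it matters.
\<close>

lemma total_diff_total_diff:
  assumes A: "mat_app (A (Suc j)) (mat_app (A (Suc (Suc j))) (Z (Suc (Suc j)) k g)) = 0"
    and B: "\<And>h. Z j (Suc (Suc k)) h \<noteq> 0 \<Longrightarrow> mat_app (B (Suc k)) (B (Suc (Suc k)) h) = 0"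
    and fin: "finite {h. Z (Suc j) (Suc k) h \<noteq> 0}" "finite {h. Z j (Suc (Suc k)) h \<noteq> 0}"
    and W: "W (Suc j) k g = total_diff A B Z (Suc j) k g" "W j (Suc k) = total_diff A B Z j (Suc k)"
  shows "total_diff A B W j k g = 0"
proof -
  have f1: "finite {h. mat_app (A (Suc j)) (Z (Suc j) (Suc k) h) \<noteq> 0}"
    by (rule finite_subset[OF _ fin(1)]) auto
  have f2: "finite {h. pscale ((-1) ^ j) (row_app (B (Suc (Suc k))) (Z j (Suc (Suc k))) h) \<noteq> 0}"
    by (rule finite_subset[OF _ finite_row_app[OF fin(2)]]) auto
  have "row_app (\<lambda>h. mat_app (B (Suc k)) (B (Suc (Suc k)) h)) (Z j (Suc (Suc k))) g = 0"
    unfolding row_app_def by (intro sum.neutral) (simp add: B)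
  then have "row_app (B (Suc k)) (W j (Suc k)) g = mat_app (A (Suc j)) (row_app (B (Suc k)) (Z (Suc j) (Suc k)) g)"
    unfolding W(2) total_diff_def row_app_add[OF f1 f2] row_app_scale row_app_row_app[OF fin(2)] mat_app_row_app[OF fin(1)]
    by simp
  then show ?thesis
    by (simp add: total_diff_def W(1) mat_app_add mat_app_diff mat_app_scale A)
qed

text \<open>
  The map \<open>l \<otimes> 1\<close> from bidegree \<open>(0, i)\<close> of the tensor product to the second factor.
\<close>

definition augmentation_row :: "('b \<Rightarrow> 'k::field) \<Rightarrow> nat \<Rightarrow> ((nat \<times> nat) \<times> ('b \<times> 'c) \<Rightarrow>\<^sub>0 'k) \<Rightarrow> ('c \<Rightarrow>\<^sub>0 'k)"
  where "augmentation_row l i v = Abs_poly_mapping (\<lambda>g. functional l (tensor_column v 0 i g))"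

lemma lookup_augmentation_row: "lookup (augmentation_row l i v) g = functional l (tensor_column v 0 i g)"
proof -
  have "finite {g. functional l (tensor_column v 0 i g) \<noteq> 0}"
    by (rule finite_subset[OF _ finite_columns[of "Poly_Mapping.map_key (Pair (0, i)) v"]]) (auto simp: tensor_column_def)
  then show ?thesis by (simp add: augmentation_row_def)
qed

context
  fixes F :: "('v, 'k::field, 'b) free_complex" and G :: "('v, 'k, 'c) free_complex"
  assumes F: "is_complex F" and G: "is_complex G"
begin

lemma mem_cstrand_star:
  "((j, k), (f, g)) \<in> cstrand (star_complex F G) a i \<longleftrightarrow> j + k = i \<and> f \<in> cstrand F a j \<and> g \<in> cstrand G a k"
  by (auto simp: strand_basis_def star_complex_def)

lemma tensor_column_total_element:
  assumes "p \<in> supported_on (cstrand (star_complex F G) a i)"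
  shows "total_element (cstrand F a) (cstrand G a) i (tensor_column p)"
proof -
  have *: "f \<in> cstrand F a j" "g \<in> cstrand G a k" if "lookup (tensor_column p j k g) f \<noteq> 0" for j k f g
    using that assms mem_cstrand_star[where j = j and k = k and f = f and g = g and a = a and i = i] by (auto simp: in_keys_iff)
  have "\<exists>f. lookup (tensor_column p j k g) f \<noteq> 0" if "tensor_column p j k g \<noteq> 0" for j k g
    using that poly_mapping_eqI[of "tensor_column p j k g" 0] by auto
  then show ?thesis
    unfolding total_element_def using * by (auto simp: in_keys_iff tensor_column_def finite_columns) blast
qed

lemma tensor_column_outside:
  assumes "p \<in> supported_on (cstrand (star_complex F G) a i)" "j + k \<noteq> i"
  shows "tensor_column p j k g = 0"
  using assms mem_cstrand_star[where j = j and k = k and g = g and a = a and i = i] by (intro poly_mapping_eqI) (auto simp: in_keys_iff)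

lemma assemble_tensor_columns:
  assumes "total_element (cstrand F a) (cstrand G a) i Y"
  obtains p where "p \<in> supported_on (cstrand (star_complex F G) a i)"
    "\<And>j k g. j + k = i \<Longrightarrow> tensor_column p j k g = Y j k g"
proof -
  define y where "y = (\<lambda>((j, k), (f, g)). if j + k = i then lookup (Y j k g) f else 0)"
  note Y = total_elementD[OF assms]
  have "{b. y b \<noteq> 0} \<subseteq> (\<Union>(j, k)\<in>{..i} \<times> {..i}. \<Union>g\<in>{g. j + k = i \<and> Y j k g \<noteq> 0}. (\<lambda>f. ((j, k), (f, g))) ` keys (Y j k g))"
  proof
    fix b assume b: "b \<in> {b. y b \<noteq> 0}"
    obtain j k f g where [simp]: "b = ((j, k), (f, g))" by (cases b) auto
    have *: "j + k = i" "lookup (Y j k g) f \<noteq> 0" using b by (auto simp: y_def split: if_splits)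
    then have "Y j k g \<noteq> 0" by auto
    then show "b \<in> (\<Union>(j, k)\<in>{..i} \<times> {..i}. \<Union>g\<in>{g. j + k = i \<and> Y j k g \<noteq> 0}. (\<lambda>f. ((j, k), (f, g))) ` keys (Y j k g))"
      using * by (intro UN_I[of "(j, k)"]) (auto simp: in_keys_iff)
  qed
  moreover have "finite (\<Union>(j, k)\<in>{..i} \<times> {..i}. \<Union>g\<in>{g. j + k = i \<and> Y j k g \<noteq> 0}. (\<lambda>f. ((j, k), (f, g))) ` keys (Y j k g))"
    using Y(2) by (auto intro!: finite_UN_I)
  ultimately have fin: "finite {b. y b \<noteq> 0}" by (rule finite_subset)
  define p where "p = Abs_poly_mapping y"
  have p: "lookup p = y" unfolding p_def using fin by simp
  show thesis
  proof
    show "p \<in> supported_on (cstrand (star_complex F G) a i)"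
    proof safe
      fix j k f g assume "((j, k), (f, g)) \<in> keys p"
      then have *: "j + k = i" "lookup (Y j k g) f \<noteq> 0" by (auto simp: in_keys_iff p y_def split: if_splits)
      then have "Y j k g \<noteq> 0" by auto
      then show "((j, k), (f, g)) \<in> cstrand (star_complex F G) a i"
        using * Y(1,3)[of j k g] by (auto simp: mem_cstrand_star in_keys_iff)
    qed
    show "tensor_column p j k g = Y j k g" if "j + k = i" for j k g
      using that by (intro poly_mapping_eqI) (simp add: p y_def)
  qed
qed

lemma star_cdiff_zero:
  "x \<in> carrier (cmod (star_complex F G) 0) \<Longrightarrow> cdiff (star_complex F G) 0 x = 0"
proof -
  assume "x \<in> carrier (cmod (star_complex F G) 0)"
  then have x: "keys (proj (0, 0) x) \<subseteq> bset (cbasis F 0) \<times> bset (cbasis G 0)"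
    by (auto simp: cmod_def carrier_free_module star_complex_def in_keys_iff direct_sum_basis_def subset_iff)
  have "cdiff F 0 (single f 1) = 0" if "f \<in> bset (cbasis F 0)" for f
    using F that by (simp add: is_complex_def cmod_def carrier_free_module)
  then have 1: "star_Id (cbasis F 0) (cbasis F 0) (cdiff F 0) (cbasis G 0) (proj (0, 0) x) = 0"
    unfolding star_Id_def linear_extension_def using x by (intro sum.neutral) auto
  have "cdiff G 0 (single g 1) = 0" if "g \<in> bset (cbasis G 0)" for g
    using G that by (simp add: is_complex_def cmod_def carrier_free_module)
  then have 2: "Id_star (cbasis F 0) (cbasis G 0) (cbasis G 0) (cdiff G 0) (proj (0, 0) x) = 0"
    unfolding Id_star_def linear_extension_def using x by (intro sum.neutral) auto
  have "{(j, k). j + k = (0::nat)} = {(0, 0)}" by auto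
  then show ?thesis by (simp add: star_complex_def 1 2 incl_def)
qed

lemma is_complex_star: "is_complex (star_complex F G)"
  unfolding is_complex_def
proof (intro conjI allI ballI)
  fix i x
  let ?T = "star_complex F G"
  show hom: "graded_hom (cmod ?T (Suc i)) (cmod ?T i) (cdiff ?T (Suc i))" for i
    unfolding cmod_def by (rule graded_hom_star_cdiff[OF F G])
  show D0: "cdiff ?T 0 x = 0" if "x \<in> carrier (cmod ?T 0)" for x
    using that by (rule star_cdiff_zero)
  assume x: "x \<in> carrier (cmod ?T (Suc i))"
  have Dx: "cdiff ?T (Suc i) x \<in> carrier (cmod ?T i)"
    using free_hom_carrier[OF hom[unfolded cmod_def]] x unfolding cmod_def by blast
  show "cdiff ?T i (cdiff ?T (Suc i) x) = 0"
  proof (cases i)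
    case 0
    then show ?thesis using D0 Dx by simp
  next
    case (Suc n)
    let ?y = "cdiff ?T (Suc i) x"
    have y: "?y \<in> carrier (cmod ?T (Suc n))" using Dx Suc by simp
    have DD: "cdiff ?T (Suc n) ?y \<in> carrier (cmod ?T n)"
      using free_hom_carrier[OF hom[unfolded cmod_def]] y unfolding cmod_def by blast
    have "strand (cbasis ?T n) a (cdiff ?T (Suc n) ?y) = 0" for a
    proof (rule tensor_column_eqI)
      fix j k g
      let ?Z = "tensor_column (strand (cbasis ?T (Suc i)) a x)" and ?W = "tensor_column (strand (cbasis ?T (Suc n)) a ?y)"
      have Z: "total_element (cstrand F a) (cstrand G a) (Suc i) ?Z"
        using tensor_column_total_element keys_strand x unfolding cmod_def by blast
      show "tensor_column (strand (cbasis ?T n) a (cdiff ?T (Suc n) ?y)) j k g = tensor_column 0 j k g"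
      proof (cases "j + k = n")
        case True
        have W: "?W j' k' g' = total_diff (diff_matrix F) (diff_matrix G) ?Z j' k' g'" if "j' + k' = Suc n" for j' k' g'
          using tensor_column_star_cdiff[OF F G x, of j' k' a g'] that Suc by simp
        have "total_diff (diff_matrix F) (diff_matrix G) ?W j k g = 0"
        proof (rule total_diff_total_diff)
          show "mat_app (diff_matrix F (Suc j)) (mat_app (diff_matrix F (Suc (Suc j))) (?Z (Suc (Suc j)) k g)) = 0"
            using diff_matrix_square[OF F, where a = a and j = j] total_elementD(1)[OF Z, of "Suc (Suc j)" k g] True Suc by simp
          show "?W (Suc j) k g = total_diff (diff_matrix F) (diff_matrix G) ?Z (Suc j) k g"
            "?W j (Suc k) = total_diff (diff_matrix F) (diff_matrix G) ?Z j (Suc k)"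
            using W True by auto
          show "finite {h. ?Z (Suc j) (Suc k) h \<noteq> 0}" "finite {h. ?Z j (Suc (Suc k)) h \<noteq> 0}"
            by (simp_all add: tensor_column_def finite_columns)
          fix h assume "?Z j (Suc (Suc k)) h \<noteq> 0"
          then have "h \<in> cstrand G a (Suc (Suc k))"
            using total_elementD(3)[OF Z, of j "Suc (Suc k)" h] True Suc by simp
          then have "single h 1 \<in> supported_on (cstrand G a (Suc (Suc k)))" by simp
          from diff_matrix_square[OF G this] show "mat_app (diff_matrix G (Suc k)) (diff_matrix G (Suc (Suc k)) h) = 0" by simp
        qed
        then show ?thesis using tensor_column_star_cdiff[OF F G y True, of a g] by simp
      next
        case False
        have "strand (cbasis ?T n) a (cdiff ?T (Suc n) ?y) \<in> supported_on (cstrand ?T a n)"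
          using keys_strand DD unfolding cmod_def by blast
        from tensor_column_outside[OF this False] show ?thesis by simp
      qed
    qed
    then have "cdiff ?T (Suc n) ?y = 0" by (intro strand_eqI[of "cbasis ?T n"]) simp
    then show ?thesis using Suc by simp
  qed
qed

lemma tensor_column_diff_matrix:
  assumes "v \<in> supported_on (cstrand (star_complex F G) a (Suc i))" "j + k = i"
  shows "tensor_column (mat_app (diff_matrix (star_complex F G) (Suc i)) v) j k g = total_diff (diff_matrix F) (diff_matrix G) (tensor_column v) j k g"
proof -
  let ?T = "star_complex F G"
  have u: "unstrand (cbasis ?T (Suc i)) a v \<in> carrier (cmod ?T (Suc i))"
    unfolding cmod_def by (rule unstrand_carrier[OF assms(1)])
  show ?thesis
    using tensor_column_star_cdiff[OF F G u assms(2), of a g] strand_cdiff[OF is_complex_star u, of a]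
    by (simp add: strand_unstrand[OF assms(1)])
qed

lemma augmentation_row_supported:
  assumes "v \<in> supported_on (cstrand (star_complex F G) a i)"
  shows "augmentation_row l i v \<in> supported_on (cstrand G a i)"
proof safe
  fix g assume "g \<in> keys (augmentation_row l i v)"
  then have "tensor_column v 0 i g \<noteq> 0" by (auto simp: in_keys_iff lookup_augmentation_row)
  then show "g \<in> cstrand G a i"
    using total_elementD(3)[OF tensor_column_total_element[OF assms], of 0 i g] by simp
qed

text \<open>
  As \<open>l\<close> kills the boundaries of the first factor, \<open>l \<otimes> 1\<close> is a map of complexes.
\<close>

lemma augmentation_row_diff_matrix:
  assumes l: "\<And>w. w \<in> supported_on (cstrand F a 1) \<Longrightarrow> functional l (mat_app (diff_matrix F 1) w) = 0"
    and v: "v \<in> supported_on (cstrand (star_complex F G) a (Suc i))"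
  shows "augmentation_row l i (mat_app (diff_matrix (star_complex F G) (Suc i)) v) =
    mat_app (diff_matrix G (Suc i)) (augmentation_row l (Suc i) v)"
proof (rule poly_mapping_eqI)
  fix g
  let ?Z = "tensor_column v 0 (Suc i)" and ?B = "diff_matrix G (Suc i)"
  have "tensor_column v 1 i g \<in> supported_on (cstrand F a 1)"
    using total_elementD(1)[OF tensor_column_total_element[OF v], of 1 i g] by simp
  then have "functional l (total_diff (diff_matrix F) (diff_matrix G) (tensor_column v) 0 i g) = functional l (row_app ?B ?Z g)"
    using l by (simp add: total_diff_def functional_add)
  also have "\<dots> = (\<Sum>h\<in>{h. ?Z h \<noteq> 0}. lookup (augmentation_row l (Suc i) v) h * lookup (?B h) g)"
    by (simp add: row_app_def functional_sum functional_scale lookup_augmentation_row mult.commute)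
  also have "\<dots> = lookup (mat_app ?B (augmentation_row l (Suc i) v)) g"
    unfolding lookup_mat_app
    by (rule sum.mono_neutral_right)
       (auto simp: tensor_column_def finite_columns in_keys_iff lookup_augmentation_row)
  finally show "lookup (augmentation_row l i (mat_app (diff_matrix (star_complex F G) (Suc i)) v)) g =
    lookup (mat_app (diff_matrix G (Suc i)) (augmentation_row l (Suc i) v)) g"
    by (simp add: lookup_augmentation_row tensor_column_diff_matrix[OF v])
qed

text \<open>
  \<open>total_complex_exact\<close> for a strand of the star complex, in positive degrees and in degree zero alike: a cycle
  is a boundary as soon as its image under \<open>l \<otimes> 1\<close> is.
\<close>

lemma star_strand_boundary:
  assumes exF: "\<And>j. exact_at F (Suc j)"
    and e: "e \<in> supported_on (cstrand F a 0)"
    and l: "\<And>w. w \<in> supported_on (cstrand F a 1) \<Longrightarrow> functional l (mat_app (diff_matrix F 1) w) = 0"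
      "\<And>w. w \<in> supported_on (cstrand F a 0) \<Longrightarrow>
        w - pscale (functional l w) e \<in> mat_app (diff_matrix F 1) ` supported_on (cstrand F a 1)"
    and v: "v \<in> supported_on (cstrand (star_complex F G) a i)"
      "\<And>n. i = Suc n \<Longrightarrow> mat_app (diff_matrix (star_complex F G) i) v = 0"
    and row: "augmentation_row l i v \<in> mat_app (diff_matrix G (Suc i)) ` supported_on (cstrand G a (Suc i))"
  shows "v \<in> mat_app (diff_matrix (star_complex F G) (Suc i)) ` supported_on (cstrand (star_complex F G) a (Suc i))"
proof -
  obtain y where y: "y \<in> supported_on (cstrand G a (Suc i))" "mat_app (diff_matrix G (Suc i)) y = augmentation_row l i v"
    using row by force
  have cyc: "total_diff (diff_matrix F) (diff_matrix G) (tensor_column v) j k g = 0" if "Suc (j + k) = i" for j k g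
    using tensor_column_diff_matrix[where v = v and a = a and i = "j + k" and j = j and k = k and g = g] v(1) v(2)[OF that[symmetric]] that
    by simp
  have y2: "lookup (mat_app (diff_matrix G (Suc i)) y) g = functional l (tensor_column v 0 i g)" for g
    by (simp add: y(2) lookup_augmentation_row)
  obtain Y where Y: "total_element (cstrand F a) (cstrand G a) (Suc i) Y"
    "\<And>j k g. j + k = i \<Longrightarrow> total_diff (diff_matrix F) (diff_matrix G) Y j k g = tensor_column v j k g"
    by (rule total_complex_exact[of "cstrand F a" "diff_matrix F" e l "cstrand G a" i "tensor_column v" "diff_matrix G" y,
        OF _ _ e l tensor_column_total_element[OF v(1)] cyc y(1) y2])
       (use diff_matrix_square[OF F] exF[unfolded exact_at_iff_strands[OF F]] in blast)+
  obtain p where p: "p \<in> supported_on (cstrand (star_complex F G) a (Suc i))"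
    "\<And>j k g. j + k = Suc i \<Longrightarrow> tensor_column p j k g = Y j k g"
    using assemble_tensor_columns[OF Y(1)] by blast
  have "mat_app (diff_matrix (star_complex F G) (Suc i)) p = v"
  proof (rule tensor_column_eqI)
    fix j k g
    show "tensor_column (mat_app (diff_matrix (star_complex F G) (Suc i)) p) j k g = tensor_column v j k g"
    proof (cases "j + k = i")
      case True
      have "total_diff (diff_matrix F) (diff_matrix G) (tensor_column p) j k g = total_diff (diff_matrix F) (diff_matrix G) Y j k g"
      proof -
        have "tensor_column p j (Suc k) = Y j (Suc k)" "tensor_column p (Suc j) k g = Y (Suc j) k g"
          using p(2) True by auto
        then show ?thesis by (simp add: total_diff_def)
      qed
      then show ?thesis using Y(2)[OF True] tensor_column_diff_matrix[OF p(1) True] by simp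
    next
      case False
      have "mat_app (diff_matrix (star_complex F G) (Suc i)) p \<in> supported_on (cstrand (star_complex F G) a i)"
        using diff_matrix_supported[OF is_complex_star p(1)] by simp
      then show ?thesis using tensor_column_outside[OF _ False] v(1) by metis
    qed
  qed
  then show ?thesis using p(1) by blast
qed

text \<open>
  A cycle of positive total degree is sent by \<open>l \<otimes> 1\<close> to a cycle of positive degree in \<open>G\<close>, which is a
  boundary; this is what \<open>star_strand_boundary\<close> asks for.
\<close>

lemma exact_at_star:
  assumes exF: "\<And>j. exact_at F (Suc j)" and exG: "\<And>k. exact_at G (Suc k)"
    and aug: "\<And>a. \<exists>e l. e \<in> supported_on (cstrand F a 0) \<and>
      (\<forall>w\<in>supported_on (cstrand F a 1). functional l (mat_app (diff_matrix F 1) w) = 0) \<and>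
      (\<forall>w\<in>supported_on (cstrand F a 0).
        w - pscale (functional l w) e \<in> mat_app (diff_matrix F 1) ` supported_on (cstrand F a 1))"
  shows "exact_at (star_complex F G) (Suc n)"
  unfolding exact_at_iff_strands[OF is_complex_star]
proof (intro allI ballI impI)
  fix a v
  let ?T = "star_complex F G"
  assume v: "v \<in> supported_on (cstrand ?T a (Suc n))" "mat_app (diff_matrix ?T (Suc n)) v = 0"
  obtain e l where e: "e \<in> supported_on (cstrand F a 0)"
    and l: "\<And>w. w \<in> supported_on (cstrand F a 1) \<Longrightarrow> functional l (mat_app (diff_matrix F 1) w) = 0"
      "\<And>w. w \<in> supported_on (cstrand F a 0) \<Longrightarrow>
        w - pscale (functional l w) e \<in> mat_app (diff_matrix F 1) ` supported_on (cstrand F a 1)"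
    using aug[of a] by blast
  have "augmentation_row l n (0 :: (nat \<times> nat) \<times> ('b \<times> 'c) \<Rightarrow>\<^sub>0 'k) = 0"
    by (rule poly_mapping_eqI) (simp add: lookup_augmentation_row)
  then have "mat_app (diff_matrix G (Suc n)) (augmentation_row l (Suc n) v) = 0"
    using augmentation_row_diff_matrix[OF l(1) v(1)] v(2) by simp
  then have row: "augmentation_row l (Suc n) v \<in> mat_app (diff_matrix G (Suc (Suc n))) ` supported_on (cstrand G a (Suc (Suc n)))"
    using exG[unfolded exact_at_iff_strands[OF G]] augmentation_row_supported[OF v(1)] by blast
  show "v \<in> mat_app (diff_matrix ?T (Suc (Suc n))) ` supported_on (cstrand ?T a (Suc (Suc n)))"
    by (rule star_strand_boundary[OF exF e l v(1) _ row]) (use v(2) in simp_all)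
qed

end

section \<open>Quotients and augmentations\<close>

lemma mpoly_ring_simps [simp]: "carrier (mpoly_ring :: ('v, 'k::field) mpoly ring) = UNIV"
  "add (mpoly_ring :: ('v, 'k::field) mpoly ring) = (+)" "monoid.mult (mpoly_ring :: ('v, 'k::field) mpoly ring) = (*)"
  "one (mpoly_ring :: ('v, 'k::field) mpoly ring) = 1" "ring.zero (mpoly_ring :: ('v, 'k::field) mpoly ring) = 0"
  by (simp_all add: ring_of_type_algebra_def)

lemma cring_mpoly_ring: "cring (mpoly_ring :: ('v, 'k::field) mpoly ring)"
  by (rule cring_from_type_algebra)

lemma module_free_module: "module mpoly_ring (free_module B :: ('v, 'k::field, ('v, 'k, 'b) fvec) gmod)"
proof (rule moduleI[OF cring_mpoly_ring])
  show "abelian_group (free_module B :: ('v, 'k, ('v, 'k, 'b) fvec) gmod)"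
  proof (rule abelian_groupI)
    fix x :: "('v, 'k, 'b) fvec" assume "x \<in> carrier (free_module B)"
    then show "\<exists>y\<in>carrier (free_module B). y \<oplus>\<^bsub>free_module B\<^esub> x = \<zero>\<^bsub>free_module B\<^esub>"
      by (intro bexI[of _ "- x"]) (auto simp: carrier_free_module in_keys_iff)
  qed (auto simp: carrier_free_add add.assoc add.commute carrier_free_module[of 0])
qed (auto simp: carrier_free_fsmult fsmult_distribs)

lemma module_regular_module: "module mpoly_ring (regular_module :: ('v, 'k::field, ('v, 'k) mpoly) gmod)"
proof (rule moduleI[OF cring_mpoly_ring])
  show "abelian_group (regular_module :: ('v, 'k, ('v, 'k) mpoly) gmod)"
    by (rule abelian_groupI)
       (auto simp: regular_module_def add.assoc add.commute intro: exI[of _ "- _"])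
qed (auto simp: regular_module_def algebra_simps)

locale module_with_submodule = module mpoly_ring M for M :: "('v, 'k::field, 'm) gmod" (structure) +
  fixes N :: "'m set"
  assumes submod: "submodule N mpoly_ring M"
begin

lemma N_zero: "\<zero> \<in> N"
  and N_smult: "x \<in> N \<Longrightarrow> s \<odot> x \<in> N"
  using submoduleE[OF submod] subgroup.one_closed[OF submodule.axioms(1)[OF submod]] by auto

lemma N_subgroup: "abelian_subgroup N M"
  using submodule.axioms(1)[OF submod]
  by (intro abelian_subgroupI3 additive_subgroupI abelian_group_axioms)

interpretation N: abelian_subgroup N M by (rule N_subgroup)

lemma carrier_quotient: "carrier (quotient_module M N) = (\<lambda>x. N +> x) ` carrier M"
  by (auto simp: quotient_module_def A_RCOSETS_def')

lemma coset_mem: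
  assumes "x \<in> carrier M" "y \<in> N +> x"
  shows "y \<in> carrier M" "N +> y = N +> x" "y \<ominus> x \<in> N"
  using N.a_elemrcos_carrier[OF assms] N.a_repr_independence'[OF assms(2,1)] N.a_rcos_module_imp[OF assms]
  by (simp_all add: a_minus_def)

lemma coset_eq_iff:
  assumes "x \<in> carrier M" "y \<in> carrier M"
  shows "N +> x = N +> y \<longleftrightarrow> x \<ominus> y \<in> N"
proof
  assume "N +> x = N +> y"
  then show "x \<ominus> y \<in> N" using N.a_rcos_self[OF assms(1)] coset_mem(3)[OF assms(2)] by simp
next
  assume "x \<ominus> y \<in> N"
  then have "x \<in> N +> y" using N.a_rcos_module_rev[OF assms(2,1)] by (simp add: a_minus_def)
  then show "N +> x = N +> y" by (rule coset_mem(2)[OF assms(2)])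
qed

lemma coset_eq_self_iff:
  assumes "x \<in> carrier M"
  shows "N +> x = N \<longleftrightarrow> x \<in> N"
  using N.a_rcos_const[of x] N.a_rcos_self[OF assms] by auto

lemma coset_add:
  "x \<in> carrier M \<Longrightarrow> y \<in> carrier M \<Longrightarrow> (N +> x) \<oplus>\<^bsub>quotient_module M N\<^esub> (N +> y) = N +> (x \<oplus> y)"
  by (simp add: quotient_module_def N.a_rcos_sum)

text \<open>
  The scalar action on cosets is a union over all representatives, all of which give the same coset.
\<close>

lemma coset_smult:
  assumes "x \<in> carrier M"
  shows "s \<odot>\<^bsub>quotient_module M N\<^esub> (N +> x) = N +> (s \<odot> x)"
proof -
  have const: "N +> (s \<odot> y) = N +> (s \<odot> x)" if y: "y \<in> N +> x" for y
  proof -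
    note yc = coset_mem(1,3)[OF assms y]
    have "s \<odot> y \<ominus> s \<odot> x = s \<odot> (y \<ominus> x)"
      using yc(1) assms by (simp add: a_minus_def smult_r_distr smult_r_minus)
    then show ?thesis using N_smult[OF yc(2)] yc(1) assms by (simp add: coset_eq_iff)
  qed
  have "s \<odot>\<^bsub>quotient_module M N\<^esub> (N +> x) = (\<Union>y\<in>N +> x. N +> (s \<odot> y))"
    by (simp add: quotient_module_def)
  also have "\<dots> = (\<Union>y\<in>N +> x. N +> (s \<odot> x))"
    using const by (rule SUP_cong[OF refl])
  also have "\<dots> = N +> (s \<odot> x)"
    using N.a_rcos_self[OF assms] by (simp only: UN_constant split: if_split) blast
  finally show ?thesis .
qed

lemma graded_hom_coset: 
  assumes "\<And>a. gcomp M a \<subseteq> carrier M"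
  shows "graded_hom M (quotient_module M N) (\<lambda>x. N +> x)"
  unfolding graded_hom_def
  using coset_add coset_smult carrier_quotient by (auto simp: quotient_module_def)

text \<open>
  The first isomorphism theorem. The kernel is described by equality of values instead of by zeros, so that
  nothing about the module structure of \<open>L\<close> has to be known.
\<close>

lemma graded_isomorphic_quotient_iff:
  fixes L :: "('v, 'k, 'l) gmod"
  assumes g: "\<And>a. gcomp M a \<subseteq> carrier M"
  shows "graded_isomorphic (quotient_module M N) L \<longleftrightarrow>
    (\<exists>\<epsilon>. graded_hom M L \<epsilon> \<and> \<epsilon> ` carrier M = carrier L \<and>
      (\<forall>x\<in>carrier M. \<forall>y\<in>carrier M. \<epsilon> x = \<epsilon> y \<longleftrightarrow> x \<ominus> y \<in> N))"
proof
  assume "graded_isomorphic (quotient_module M N) L"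
  then obtain h where h: "graded_hom (quotient_module M N) L h"
    "bij_betw h (carrier (quotient_module M N)) (carrier L)"
    unfolding graded_isomorphic_def by blast
  let ?e = "\<lambda>x. h (N +> x)"
  have "graded_hom M L ?e" using graded_hom_comp[OF graded_hom_coset[OF g] h(1)] .
  moreover have "?e ` carrier M = carrier L"
    using h(2) unfolding bij_betw_def carrier_quotient by auto
  moreover have "?e x = ?e y \<longleftrightarrow> x \<ominus> y \<in> N" if "x \<in> carrier M" "y \<in> carrier M" for x y
    using h(2) that unfolding bij_betw_def carrier_quotient coset_eq_iff[OF that, symmetric]
    by (auto dest: inj_onD)
  ultimately show "\<exists>\<epsilon>. graded_hom M L \<epsilon> \<and> \<epsilon> ` carrier M = carrier L \<and>
      (\<forall>x\<in>carrier M. \<forall>y\<in>carrier M. \<epsilon> x = \<epsilon> y \<longleftrightarrow> x \<ominus> y \<in> N)" by blast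
next
  assume "\<exists>\<epsilon>. graded_hom M L \<epsilon> \<and> \<epsilon> ` carrier M = carrier L \<and>
      (\<forall>x\<in>carrier M. \<forall>y\<in>carrier M. \<epsilon> x = \<epsilon> y \<longleftrightarrow> x \<ominus> y \<in> N)"
  then obtain \<epsilon> where e: "graded_hom M L \<epsilon>" "\<epsilon> ` carrier M = carrier L"
    "\<And>x y. x \<in> carrier M \<Longrightarrow> y \<in> carrier M \<Longrightarrow> \<epsilon> x = \<epsilon> y \<longleftrightarrow> x \<ominus> y \<in> N" by blast
  define h where "h = (\<lambda>T. \<epsilon> (SOME x. x \<in> T))"
  have h: "h (N +> x) = \<epsilon> x" if x: "x \<in> carrier M" for x
  proof -
    have "(SOME z. z \<in> N +> x) \<in> N +> x" using N.a_rcos_self[OF x] by (rule someI)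
    from coset_mem[OF x this] show ?thesis unfolding h_def using x e(3) by simp
  qed
  have "graded_hom (quotient_module M N) L h"
    unfolding graded_hom_def
  proof (intro conjI ballI allI)
    show "h \<in> carrier (quotient_module M N) \<rightarrow> carrier L"
      using e(2) h by (auto simp: carrier_quotient)
    show "h (T \<oplus>\<^bsub>quotient_module M N\<^esub> U) = h T \<oplus>\<^bsub>L\<^esub> h U"
      if "T \<in> carrier (quotient_module M N)" "U \<in> carrier (quotient_module M N)" for T U
      using that e(1) by (auto simp: carrier_quotient coset_add h graded_hom_def)
    show "h (s \<odot>\<^bsub>quotient_module M N\<^esub> T) = s \<odot>\<^bsub>L\<^esub> h T" if "T \<in> carrier (quotient_module M N)" for s T
      using that e(1) by (auto simp: carrier_quotient coset_smult h graded_hom_def)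
    show "h ` gcomp (quotient_module M N) a \<subseteq> gcomp L a" for a
    proof -
      have "h (N +> x) \<in> gcomp L a" if "x \<in> gcomp M a" for x
        using that e(1) h[OF subsetD[OF g that]] unfolding graded_hom_def by (simp add: image_subset_iff)
      then show ?thesis by (auto simp: quotient_module_def)
    qed
  qed
  moreover have "bij_betw h (carrier (quotient_module M N)) (carrier L)"
    unfolding bij_betw_def
  proof
    have "N +> x = N +> y" if "x \<in> carrier M" "y \<in> carrier M" "h (N +> x) = h (N +> y)" for x y
      using that(3) e(3)[OF that(1,2)] coset_eq_iff[OF that(1,2)] h[OF that(1)] h[OF that(2)] by simp
    then show "inj_on h (carrier (quotient_module M N))"
      unfolding carrier_quotient inj_on_def by blast
    show "h ` carrier (quotient_module M N) = carrier L"
      unfolding carrier_quotient e(2)[symmetric] image_image using h by auto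
  qed
  ultimately show "graded_isomorphic (quotient_module M N) L" unfolding graded_isomorphic_def by blast
qed

end

lemma image_submodule:
  fixes \<phi> :: "('v, 'k::field, 'b) fvec \<Rightarrow> ('v, 'k, 'c) fvec"
  assumes "graded_hom (free_module B) (free_module C) \<phi>"
  shows "submodule (\<phi> ` carrier (free_module B)) mpoly_ring (free_module C)"
proof (rule module.submoduleI[OF module_free_module])
  interpret C: module mpoly_ring "free_module C :: ('v, 'k, ('v, 'k, 'c) fvec) gmod" by (rule module_free_module)
  show "\<phi> ` carrier (free_module B) \<subseteq> carrier (free_module C)"
    using free_hom_carrier[OF assms] by blast
  show "\<zero>\<^bsub>free_module C\<^esub> \<in> \<phi> ` carrier (free_module B)"
    using free_hom_zero[OF assms] by (auto simp: carrier_free_module intro!: image_eqI[of _ _ 0])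
  show add: "x \<oplus>\<^bsub>free_module C\<^esub> y \<in> \<phi> ` carrier (free_module B)"
    if xy: "x \<in> \<phi> ` carrier (free_module B)" "y \<in> \<phi> ` carrier (free_module B)" for x y
  proof -
    obtain z w where "z \<in> carrier (free_module B)" "w \<in> carrier (free_module B)" "x = \<phi> z" "y = \<phi> w"
      using xy by blast
    then show ?thesis using free_hom_add[OF assms] carrier_free_add by (intro image_eqI[of _ _ "z + w"]) simp_all
  qed
  show smult: "s \<odot>\<^bsub>free_module C\<^esub> x \<in> \<phi> ` carrier (free_module B)" if x: "x \<in> \<phi> ` carrier (free_module B)" for s x
  proof -
    obtain z where "z \<in> carrier (free_module B)" "x = \<phi> z" using x by blast
    then show ?thesis
      using free_hom_fsmult[OF assms] carrier_free_fsmult by (intro image_eqI[of _ _ "fsmult s z"]) simp_all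
  qed
  show "\<ominus>\<^bsub>free_module C\<^esub> x \<in> \<phi> ` carrier (free_module B)" if x: "x \<in> \<phi> ` carrier (free_module B)" for x
  proof -
    have "x \<in> carrier (free_module C)" using x free_hom_carrier[OF assms] by blast
    then have "\<ominus>\<^bsub>free_module C\<^esub> x = (\<ominus>\<^bsub>mpoly_ring\<^esub> 1) \<odot>\<^bsub>free_module C\<^esub> x"
      using C.smult_l_minus[of 1 x] by simp
    then show ?thesis using smult[OF x] by simp
  qed
qed

lemma a_minus_free_module:
  fixes x y :: "('v, 'k::field, 'c) fvec"
  assumes x: "x \<in> carrier (free_module C)" and y: "y \<in> carrier (free_module C)"
  shows "x \<ominus>\<^bsub>free_module C\<^esub> y = x - y"
proof -
  interpret C: module mpoly_ring "free_module C :: ('v, 'k, ('v, 'k, 'c) fvec) gmod" by (rule module_free_module)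
  have "- y \<in> carrier (free_module C)" using y by (simp add: carrier_free_module subset_iff in_keys_iff)
  then have "\<ominus>\<^bsub>free_module C\<^esub> y = - y" using C.minus_equality[of "- y" y] y by simp
  then show ?thesis by (simp add: a_minus_def)
qed

lemma resolution_augmentation_iff:
  fixes N :: "('v, 'k::field, 'n) gmod"
  assumes C: "is_complex C"
  shows "graded_isomorphic (homology C 0) N \<longleftrightarrow>
    (\<exists>\<epsilon>. graded_hom (cmod C 0) N \<epsilon> \<and> \<epsilon> ` carrier (cmod C 0) = carrier N \<and>
      (\<forall>x\<in>carrier (cmod C 0). \<forall>y\<in>carrier (cmod C 0). \<epsilon> x = \<epsilon> y \<longleftrightarrow> x - y \<in> cdiff C 1 ` carrier (cmod C 1)))"
proof -
  interpret module_with_submodule "cmod C 0" "cdiff C 1 ` carrier (cmod C 1)"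
    using image_submodule[OF is_complex_hom[OF C, of 1]]
    by (simp add: module_with_submodule_def module_with_submodule_axioms_def cmod_def module_free_module)
  have hom: "homology C 0 = quotient_module (cmod C 0) (cdiff C 1 ` carrier (cmod C 1))"
  proof -
    have "{x \<in> carrier (cmod C 0). cdiff C 0 x = 0} = carrier (cmod C 0)"
      using C by (auto simp: is_complex_def)
    moreover have "restrict_module (cmod C 0) (carrier (cmod C 0)) = cmod C 0"
      unfolding restrict_module_def cmod_def free_module_def by (auto simp: fun_eq_iff)
    ultimately show ?thesis by (simp add: homology_def)
  qed
  have g: "gcomp (cmod C 0) a \<subseteq> carrier (cmod C 0)" for a
    unfolding cmod_def using gcomp_carrier_free_module by blast
  have m: "x \<ominus>\<^bsub>cmod C 0\<^esub> y = x - y" if "x \<in> carrier (cmod C 0)" "y \<in> carrier (cmod C 0)" for x y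
    using that unfolding cmod_def by (rule a_minus_free_module)
  show ?thesis
    unfolding hom graded_isomorphic_quotient_iff[OF g] by (simp add: m cong: conj_cong)
qed

lemma homology_zero_iff:
  assumes C: "is_complex C"
  shows "carrier (homology C (Suc i)) = {\<zero>\<^bsub>homology C (Suc i)\<^esub>} \<longleftrightarrow> exact_at C (Suc i)"
proof -
  let ?i = "Suc i"
  let ?N = "cdiff C (Suc ?i) ` carrier (cmod C (Suc ?i))"
  let ?Z = "{x \<in> carrier (cmod C ?i). cdiff C ?i x = 0}"
  interpret module_with_submodule "cmod C ?i" ?N
    using image_submodule[OF is_complex_hom[OF C, of "Suc ?i"]]
    by (simp add: module_with_submodule_def module_with_submodule_axioms_def cmod_def module_free_module)
  have rc: "?N +>\<^bsub>restrict_module (cmod C ?i) ?Z\<^esub> x = ?N +>\<^bsub>cmod C ?i\<^esub> x" for x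
    by (simp add: a_r_coset_def' restrict_module_def)
  have car: "carrier (homology C ?i) = (\<lambda>x. ?N +>\<^bsub>cmod C ?i\<^esub> x) ` ?Z"
    unfolding homology_def quotient_module_def A_RCOSETS_def' by (auto simp: rc[unfolded restrict_module_def] restrict_module_def)
  have zero: "\<zero>\<^bsub>homology C ?i\<^esub> = ?N" by (simp add: homology_def quotient_module_def)
  have iff: "?N +>\<^bsub>cmod C ?i\<^esub> x = ?N \<longleftrightarrow> x \<in> ?N" if "x \<in> carrier (cmod C ?i)" for x
    using that by (rule coset_eq_self_iff)
  have "0 \<in> ?Z"
    using free_hom_zero[OF is_complex_hom[OF C, of ?i]] by (simp add: cmod_def carrier_free_module)
  then have "carrier (homology C ?i) = {?N} \<longleftrightarrow> (\<forall>x\<in>?Z. ?N +>\<^bsub>cmod C ?i\<^esub> x = ?N)"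
    unfolding car by blast
  also have "\<dots> \<longleftrightarrow> exact_at C ?i"
    using iff by (auto simp: exact_at_def)
  finally show ?thesis by (simp add: zero)
qed

lemma free_resolution_iff:
  fixes N :: "('v, 'k::field, 'n) gmod"
  shows "free_resolution C N \<longleftrightarrow> is_complex C \<and> (\<forall>i. exact_at C (Suc i)) \<and>
    (\<exists>\<epsilon>. graded_hom (cmod C 0) N \<epsilon> \<and> \<epsilon> ` carrier (cmod C 0) = carrier N \<and>
      (\<forall>x\<in>carrier (cmod C 0). \<forall>y\<in>carrier (cmod C 0). \<epsilon> x = \<epsilon> y \<longleftrightarrow> x - y \<in> cdiff C 1 ` carrier (cmod C 1)))"
  unfolding free_resolution_def
  using homology_zero_iff resolution_augmentation_iff[of C N] gr0_conv_Suc by metis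

section \<open>Monomial ideals\<close>

text \<open>
  The polynomials whose monomials are all divisible by some monomial of \<open>A\<close> form an ideal, and each of them
  is a sum of multiples of such monomials.
\<close>

lemma mem_Idl_monomials:
  fixes p :: "('v, 'k::field) mpoly"
  shows "p \<in> Idl\<^bsub>mpoly_ring\<^esub> (monomial ` A) \<longleftrightarrow> (\<forall>e\<in>keys p. \<exists>b\<in>A. b \<le> e)"
proof -
  let ?R = "mpoly_ring :: ('v, 'k) mpoly ring"
  let ?J = "{p :: ('v, 'k) mpoly. \<forall>e\<in>keys p. \<exists>b\<in>A. b \<le> e}"
  interpret R: cring ?R by (rule cring_mpoly_ring)
  have mult: "q * p \<in> ?J" if p: "p \<in> ?J" for p q
  proof safe
    fix e assume "e \<in> keys (q * p)"
    then obtain u w where e: "e = u + w" "w \<in> keys p" using keys_mult[of q p] by blast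
    then obtain b where "b \<in> A" "b \<le> w" using p by blast
    then show "\<exists>b\<in>A. b \<le> e" using e(1) by (meson expo_le_add(1) order_trans)
  qed
  have "ideal ?J ?R"
  proof (rule idealI)
    show "subgroup ?J (add_monoid ?R)"
    proof (rule R.add.subgroupI)
      show "\<ominus>\<^bsub>?R\<^esub> p \<in> ?J" if "p \<in> ?J" for p
      proof -
        have "\<ominus>\<^bsub>?R\<^esub> p = - p"
          using R.minus_equality[of "- p" p] by simp
        then show ?thesis using that by (simp add: in_keys_iff)
      qed
      show "p \<oplus>\<^bsub>?R\<^esub> q \<in> ?J" if "p \<in> ?J" "q \<in> ?J" for p q
        using that keys_add[of p q] by auto
      show "?J \<noteq> {}" by (auto intro!: exI[of _ 0])
    qed simp
  qed (use mult R.ring_axioms in \<open>auto simp: mult.commute\<close>)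
  moreover have "monomial ` A \<subseteq> ?J" by (auto simp: monomial_def)
  ultimately have "Idl\<^bsub>?R\<^esub> (monomial ` A) \<subseteq> ?J" by (rule R.genideal_minimal)
  moreover have "p \<in> Idl\<^bsub>?R\<^esub> (monomial ` A)" if p: "p \<in> ?J" for p
  proof -
    interpret J: ideal "Idl\<^bsub>?R\<^esub> (monomial ` A)" ?R by (rule R.genideal_ideal) simp
    have "(\<Sum>k\<in>S. single k (lookup p k)) \<in> Idl\<^bsub>?R\<^esub> (monomial ` A)" if "finite S" "S \<subseteq> keys p" for S
      using that
    proof (induction S)
      case empty
      show ?case using J.zero_closed by simp
    next
      case (insert k S)
      then obtain b where b: "b \<in> A" "b \<le> k" using p by blast
      have "monomial b \<in> Idl\<^bsub>?R\<^esub> (monomial ` A)" using R.genideal_self[of "monomial ` A"] b by auto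
      from J.I_l_closed[OF this, of "single (k - b) (lookup p k)"]
      have "single k (lookup p k) \<in> Idl\<^bsub>?R\<^esub> (monomial ` A)"
        using b by (simp add: monomial_def mult_single)
      from J.a_closed[OF this insert.IH] insert show ?case by simp
    qed
    from this[of "keys p"] show ?thesis by (simp add: poly_mapping_sum_single)
  qed
  ultimately show ?thesis by blast
qed

definition monomials_in :: "('v, 'k::field) mpoly set \<Rightarrow> 'v expo set"
  where "monomials_in I = {a. monomial a \<in> I}"

context
  fixes I :: "('v::finite, 'k::field) mpoly set"
  assumes I: "monomial_ideal I"
begin

lemma mem_monomial_ideal_iff: "p \<in> I \<longleftrightarrow> keys p \<subseteq> monomials_in I"
  and monomials_in_upward: "a \<in> monomials_in I \<Longrightarrow> a \<le> b \<Longrightarrow> b \<in> monomials_in I"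
proof -
  obtain A where A: "I = Idl\<^bsub>mpoly_ring\<^esub> (monomial ` A)" using I unfolding monomial_ideal_def by blast
  have *: "a \<in> monomials_in I \<longleftrightarrow> (\<exists>b\<in>A. b \<le> a)" for a
    unfolding A monomials_in_def mem_Collect_eq mem_Idl_monomials by (simp add: monomial_def)
  show "p \<in> I \<longleftrightarrow> keys p \<subseteq> monomials_in I"
    unfolding subset_iff * by (auto simp: A mem_Idl_monomials)
  show "a \<in> monomials_in I \<Longrightarrow> a \<le> b \<Longrightarrow> b \<in> monomials_in I"
    unfolding * using order_trans by blast
qed

text \<open>
  The monomials of \<open>I\<close> that are minimal under divisibility form the minimal generating set; their existence
  below any monomial of \<open>I\<close> rests on the finiteness of the set of variables.
\<close>

definition minimal_monomials :: "'v expo set"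
  where "minimal_monomials = {a \<in> monomials_in I. \<forall>b\<in>monomials_in I. b \<le> a \<longrightarrow> b = a}"

lemma minimal_monomial_below:
  assumes "a \<in> monomials_in I"
  shows "\<exists>b\<in>minimal_monomials. b \<le> a"
  using assms
proof (induction "\<Sum>i\<in>UNIV. a i" arbitrary: a rule: less_induct)
  case less
  show ?case
  proof (cases "a \<in> minimal_monomials")
    case False
    then obtain b where b: "b \<in> monomials_in I" "b \<le> a" "b \<noteq> a"
      using less.prems by (auto simp: minimal_monomials_def)
    then obtain i where "b i < a i" by (metis le_funD le_neq_implies_less ext)
    then have "(\<Sum>i\<in>UNIV. b i) < (\<Sum>i\<in>UNIV. a i)"
      using b(2) by (intro sum_strict_mono_ex1) (auto simp: le_fun_def)
    from less.hyps[OF this b(1)] show ?thesis using b(2) order_trans by blast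
  qed blast
qed

lemma minimal_monomials_generate: "minimal_monomial_generators I minimal_monomials"
  unfolding minimal_monomial_generators_def
proof (intro conjI allI impI)
  have "p \<in> Idl\<^bsub>mpoly_ring\<^esub> (monomial ` minimal_monomials) \<longleftrightarrow> p \<in> I" for p
    unfolding mem_Idl_monomials mem_monomial_ideal_iff
    using minimal_monomial_below monomials_in_upward by (auto simp: minimal_monomials_def)
  then show "Idl\<^bsub>mpoly_ring\<^esub> (monomial ` minimal_monomials) = I" by blast
  fix B assume B: "B \<subset> minimal_monomials"
  then obtain a where a: "a \<in> minimal_monomials" "a \<notin> B" by blast
  have "monomial a \<notin> Idl\<^bsub>mpoly_ring\<^esub> (monomial ` B)"
  proof
    assume "monomial a \<in> Idl\<^bsub>mpoly_ring\<^esub> (monomial ` B)"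
    then obtain b where "b \<in> B" "b \<le> a" unfolding mem_Idl_monomials by (auto simp: monomial_def)
    then show False using a B by (auto simp: minimal_monomials_def)
  qed
  moreover have "monomial a \<in> I" using a(1) by (simp add: minimal_monomials_def monomials_in_def)
  ultimately show "Idl\<^bsub>mpoly_ring\<^esub> (monomial ` B) \<noteq> I" by blast
qed

lemma minimal_monomials_Gens: "b \<in> minimal_monomials \<Longrightarrow> 0 < b i \<Longrightarrow> i \<in> Gens_ideal I"
  unfolding Gens_ideal_def using minimal_monomials_generate by blast

end

section \<open>Homogeneous components and the submodule \<open>I M\<close>\<close>

lemma submodule_mspan:
  assumes "module mpoly_ring M" "A \<subseteq> carrier M"
  shows "submodule (mspan M A) mpoly_ring M"
proof -
  interpret module mpoly_ring M by (rule assms(1))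
  have c: "submodule (carrier M) mpoly_ring M" by (rule submoduleI) auto
  note E = submoduleE[unfolded mpoly_ring_simps]
  show ?thesis
  proof (rule submoduleI)
    show "mspan M A \<subseteq> carrier M" using c assms(2) by (auto simp: mspan_def)
    show "\<zero>\<^bsub>M\<^esub> \<in> mspan M A"
      using subgroup.one_closed[OF submodule.axioms(1)] by (fastforce simp: mspan_def)
  qed (auto simp: mspan_def intro: E)
qed

lemma mspan_superset: "A \<subseteq> mspan M A"
  and mspan_minimal: "submodule N mpoly_ring M \<Longrightarrow> A \<subseteq> N \<Longrightarrow> mspan M A \<subseteq> N"
  by (auto simp: mspan_def)

context multigraded_module
begin

lemma gcomp_carrier: "x \<in> gcomp M a \<Longrightarrow> x \<in> carrier M"
  and gcomp_zero: "\<zero> \<in> gcomp M a"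
  and gcomp_add: "x \<in> gcomp M a \<Longrightarrow> y \<in> gcomp M a \<Longrightarrow> x \<oplus> y \<in> gcomp M a"
  using subgroup.subset[OF gcomp_subgroup] subgroup.one_closed[OF gcomp_subgroup] subgroup.m_closed[OF gcomp_subgroup]
  by auto

lemma one_smult: "x \<in> carrier M \<Longrightarrow> 1 \<odot> x = x"
  using smult_one[of x] by simp

definition component :: "'m \<Rightarrow> 'v expo \<Rightarrow> 'm"
  where "component x = (THE c. (\<forall>a. c a \<in> gcomp M a) \<and> finite {a. c a \<noteq> \<zero>} \<and> x = (\<Oplus>a\<in>{a. c a \<noteq> \<zero>}. c a))"

lemma component_properties:
  assumes "x \<in> carrier M"
  shows "component x a \<in> gcomp M a" "finite {a. component x a \<noteq> \<zero>}"
    "x = (\<Oplus>a\<in>{a. component x a \<noteq> \<zero>}. component x a)"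
  using theI'[OF gcomp_direct_sum[OF assms]] unfolding component_def by blast+

lemma component_carrier: "x \<in> carrier M \<Longrightarrow> component x a \<in> carrier M"
  by (rule gcomp_carrier[OF component_properties(1)])

lemma component_unique:
  assumes "\<And>a. c a \<in> gcomp M a" "finite S" "\<And>a. a \<notin> S \<Longrightarrow> c a = \<zero>" "x = (\<Oplus>a\<in>S. c a)"
  shows "component x = c"
proof -
  have c: "c a \<in> carrier M" for a using assms(1) gcomp_carrier by blast
  then have x: "x \<in> carrier M" unfolding assms(4) by (intro finsum_closed) auto
  have sub: "{a. c a \<noteq> \<zero>} \<subseteq> S" using assms(3) by blast
  have "(\<Oplus>a\<in>{a. c a \<noteq> \<zero>}. c a) = (\<Oplus>a\<in>S. c a)"
    using sub assms(2) c by (intro M.add.finprod_mono_neutral_cong_left) auto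
  then have "(\<forall>a. c a \<in> gcomp M a) \<and> finite {a. c a \<noteq> \<zero>} \<and> x = (\<Oplus>a\<in>{a. c a \<noteq> \<zero>}. c a)"
    using assms finite_subset[OF sub] by simp
  then show ?thesis
    unfolding component_def by (intro the1_equality gcomp_direct_sum[OF x])
qed

lemma finsum_component_superset:
  assumes "x \<in> carrier M" "finite S" "{a. component x a \<noteq> \<zero>} \<subseteq> S"
  shows "x = (\<Oplus>a\<in>S. component x a)"
proof -
  have "(\<Oplus>a\<in>{a. component x a \<noteq> \<zero>}. component x a) = (\<Oplus>a\<in>S. component x a)"
    using assms component_properties(1)[OF assms(1)] gcomp_carrier
    by (intro M.add.finprod_mono_neutral_cong_left) auto
  then show ?thesis using component_properties(3)[OF assms(1)] by simp
qed

lemma component_add: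
  assumes "x \<in> carrier M" "y \<in> carrier M"
  shows "component (x \<oplus> y) a = component x a \<oplus> component y a"
proof -
  let ?S = "{a. component x a \<noteq> \<zero>} \<union> {a. component y a \<noteq> \<zero>}"
  have S: "finite ?S" using component_properties(2) assms by simp
  note cp = component_properties(1)[OF assms(1)] component_properties(1)[OF assms(2)]
  have "component (x \<oplus> y) = (\<lambda>a. component x a \<oplus> component y a)"
  proof (rule component_unique[OF _ S])
    have "(\<Oplus>a\<in>?S. component x a \<oplus> component y a) = (\<Oplus>a\<in>?S. component x a) \<oplus> (\<Oplus>a\<in>?S. component y a)"
      using cp gcomp_carrier by (intro finsum_addf) auto
    then show "x \<oplus> y = (\<Oplus>a\<in>?S. component x a \<oplus> component y a)"
      using finsum_component_superset[OF assms(1) S] finsum_component_superset[OF assms(2) S] by auto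
  qed (use cp gcomp_add in auto)
  then show ?thesis by simp
qed

lemma component_homogeneous:
  assumes "x \<in> gcomp M b"
  shows "component x a = (if a = b then x else \<zero>)"
proof -
  have "component x = (\<lambda>a. if a = b then x else \<zero>)"
    by (rule component_unique[of _ "{b}"]) (use assms gcomp_zero gcomp_carrier in auto)
  then show ?thesis by simp
qed

lemma component_smult:
  assumes "x \<in> carrier M"
  shows "component (single t k \<odot> x) a = (if t \<le> a then single t k \<odot> component x (a - t) else \<zero>)"
proof -
  let ?S = "{a. component x a \<noteq> \<zero>}"
  let ?c = "\<lambda>a. if t \<le> a then single t k \<odot> component x (a - t) else \<zero>"
  have S: "finite ?S" using component_properties(2) assms by simp
  note cp = component_properties(1)[OF assms] gcomp_carrier[OF component_properties(1)[OF assms]]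
  have inj: "inj_on (\<lambda>a. a + t) ?S" by (auto intro!: inj_onI simp: fun_eq_iff)
  have "component (single t k \<odot> x) = ?c"
  proof (rule component_unique)
    show "?c a \<in> gcomp M a" for a
    proof (cases "t \<le> a")
      case True
      then have "t + (a - t) = a" using expo_diff_add[of t a] by (simp add: add.commute)
      then show ?thesis using gcomp_smult[OF cp(1), of t k "a - t"] True by simp
    qed (use gcomp_zero in simp)
    show "finite ((\<lambda>a. a + t) ` ?S)" using S by simp
    show "?c a = \<zero>" if "a \<notin> (\<lambda>a. a + t) ` ?S" for a
    proof (cases "t \<le> a")
      case True
      then have "a - t \<notin> ?S" using that by (metis (no_types, lifting) expo_diff_add imageI)
      then show ?thesis by simp
    qed simp
    have "(\<Oplus>a\<in>(\<lambda>a. a + t) ` ?S. ?c a) = (\<Oplus>a\<in>?S. ?c (a + t))"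
      using cp by (intro finsum_reindex[OF _ inj]) auto
    also have "\<dots> = (\<Oplus>a\<in>?S. single t k \<odot> component x a)"
      using cp by (intro finsum_cong') auto
    also have "\<dots> = single t k \<odot> (\<Oplus>a\<in>?S. component x a)"
      using cp S by (intro finsum_smult_ldistr[symmetric]) auto
    also have "\<dots> = single t k \<odot> x" using component_properties(3)[OF assms] by simp
    finally show "single t k \<odot> x = (\<Oplus>a\<in>(\<lambda>a. a + t) ` ?S. ?c a)" ..
  qed
  then show ?thesis by simp
qed

text \<open>
  A family of subgroups that is stable under multiplication by monomials cuts out a submodule. Since the
  span of a set is the smallest submodule containing it, such families are the means to control the
  homogeneous components of all elements of a span by looking at generators only.
\<close>

lemma submodule_by_components:
  assumes zero: "\<And>a. \<zero> \<in> P a"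
    and add: "\<And>a x y. x \<in> P a \<Longrightarrow> y \<in> P a \<Longrightarrow> x \<oplus> y \<in> P a"
    and shift: "\<And>a t k x. x \<in> P a \<Longrightarrow> single t k \<odot> x \<in> P (t + a)"
  shows "submodule {x \<in> carrier M. \<forall>a. component x a \<in> P a} mpoly_ring M" (is "submodule ?N _ _")
proof -
  have 0: "\<zero> \<in> ?N" using component_homogeneous[OF gcomp_zero] zero by simp
  have add': "x \<oplus> y \<in> ?N" if "x \<in> ?N" "y \<in> ?N" for x y
    using that add by (simp add: component_add)
  have mono: "single t k \<odot> x \<in> ?N" if x: "x \<in> ?N" for t k x
  proof -
    have "component (single t k \<odot> x) a \<in> P a" for a
    proof (cases "t \<le> a")
      case True
      then have "t + (a - t) = a" using expo_diff_add[of t a] by (simp add: add.commute)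
      then show ?thesis using True x shift[of "component x (a - t)" "a - t" t k] by (simp add: component_smult)
    qed (use x zero in \<open>simp add: component_smult\<close>)
    then show ?thesis using x by simp
  qed
  have smult: "s \<odot> x \<in> ?N" if x: "x \<in> ?N" for s x
  proof (induction s rule: poly_mapping_induct_add)
    case zero
    then show ?case using x 0 smult_l_null[of x] by simp
  next
    case (single t k)
    show ?case using mono x .
  next
    case (add p q)
    then show ?case using add' smult_l_distr[of p q x] x by simp
  qed
  show ?thesis
  proof (rule submoduleI)
    show "\<ominus> x \<in> ?N" if "x \<in> ?N" for x
    proof -
      have "\<ominus> x = (\<ominus>\<^bsub>mpoly_ring\<^esub> 1) \<odot> x" using smult_l_minus[of 1 x] that by (simp add: one_smult)
      then show ?thesis using smult[OF that] by simp
    qed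
  qed (use 0 add' smult in auto)
qed

lemma submodule_smult_closed_keys:
  assumes N: "submodule N mpoly_ring M" and x: "x \<in> carrier M"
    and "\<And>t. t \<in> keys s \<Longrightarrow> single t (lookup s t) \<odot> x \<in> N"
  shows "s \<odot> x \<in> N"
proof -
  have "(\<Sum>t\<in>S. single t (lookup s t)) \<odot> x \<in> N" if "finite S" "S \<subseteq> keys s" for S
    using that
  proof (induction S)
    case empty
    then show ?case using subgroup.one_closed[OF submodule.axioms(1)[OF N]] smult_l_null[OF x] by simp
  next
    case (insert t S)
    then show ?case using assms(3)[of t] submoduleE(5)[OF N] smult_l_distr[of "single t (lookup s t)" "\<Sum>t\<in>S. single t (lookup s t)" x] x
      by simp
  qed
  from this[of "keys s"] show ?thesis by (simp add: poly_mapping_sum_single)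
qed

lemma submodule_ideal_times_module: "submodule (ideal_times_module I M) mpoly_ring M"
  unfolding ideal_times_module_def by (rule submodule_mspan[OF module_axioms]) auto

lemma smult_in_ideal_times_module: "s \<in> I \<Longrightarrow> x \<in> carrier M \<Longrightarrow> s \<odot> x \<in> ideal_times_module I M"
  unfolding ideal_times_module_def by (rule subsetD[OF mspan_superset]) blast

text \<open>
  Monomials that divide \<open>x\<^sup>a\<close> are outside \<open>I\<close> when \<open>x\<^sup>a\<close> is, so a multiple of an element of \<open>I\<close> has nothing
  in degree \<open>a\<close>.
\<close>

lemma component_ideal_times_module:
  assumes I: "monomial_ideal I" and x: "x \<in> ideal_times_module I M" and a: "a \<notin> monomials_in I"
  shows "component x a = \<zero>"
proof -
  define P where "P a = (if a \<in> monomials_in I then carrier M else {\<zero>})" for a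
  have N: "submodule {x \<in> carrier M. \<forall>a. component x a \<in> P a} mpoly_ring M" (is "submodule ?N _ _")
  proof (rule submodule_by_components)
    fix a t k x assume "x \<in> P a"
    moreover have "t + a \<in> monomials_in I" if "a \<in> monomials_in I"
      using monomials_in_upward[OF I that, of "t + a"] by simp
    ultimately show "single t k \<odot> x \<in> P (t + a)" by (auto simp: P_def smult_r_null split: if_splits)
  qed (auto simp: P_def split: if_splits)
  have "s \<odot> m \<in> ?N" if s: "s \<in> I" and m: "m \<in> carrier M" for s m
  proof (rule submodule_smult_closed_keys[OF N m])
    fix t assume t: "t \<in> keys s"
    then have "t \<in> monomials_in I" using s mem_monomial_ideal_iff[OF I] by blast
    then have "t \<le> a \<Longrightarrow> a \<in> monomials_in I" for a using monomials_in_upward[OF I] by blast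
    then show "single t (lookup s t) \<odot> m \<in> ?N"
      using m component_carrier[OF m] by (auto simp: component_smult P_def)
  qed
  then have "ideal_times_module I M \<subseteq> ?N"
    unfolding ideal_times_module_def by (intro mspan_minimal N) auto
  then show ?thesis using x a by (auto simp: P_def split: if_splits)
qed

text \<open>
  The components of finitely many generators are again finitely many generators, and a finite generating
  set contains a minimal one.
\<close>

lemma ex_minimal_homogeneous_generators:
  assumes "finitely_generated M"
  shows "\<exists>A. minimal_homogeneous_generators M A"
proof -
  obtain A where A: "finite A" "A \<subseteq> carrier M" "mspan M A = carrier M"
    using assms unfolding finitely_generated_def by blast
  let ?H = "\<Union>x\<in>A. component x ` {a. component x a \<noteq> \<zero>}"
  have fin: "finite ?H" using A component_properties(2) by blast
  have Hc: "?H \<subseteq> carrier M" using A(2) component_properties(1) gcomp_carrier by blast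
  note sub = submodule_mspan[OF module_axioms Hc]
  have "x \<in> mspan M ?H" if x: "x \<in> A" for x
  proof -
    have "(\<Oplus>a\<in>S. component x a) \<in> mspan M ?H" if "finite S" "S \<subseteq> {a. component x a \<noteq> \<zero>}" for S
      using that
    proof (induction S)
      case empty
      then show ?case using subgroup.one_closed[OF submodule.axioms(1)[OF sub]] by simp
    next
      case (insert a S)
      have "component x a \<in> mspan M ?H" using mspan_superset[of ?H M] x insert.prems by blast
      moreover have "(\<Oplus>a\<in>insert a S. component x a) = component x a \<oplus> (\<Oplus>a\<in>S. component x a)"
        using insert.hyps A(2) x component_carrier by (intro finsum_insert) auto
      ultimately show ?case using submoduleE(5)[OF sub] insert by simp
    qed
    from this[of "{a. component x a \<noteq> \<zero>}"] show ?thesis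
      using component_properties(2,3)[of x] A(2) x by auto
  qed
  then have "carrier M \<subseteq> mspan M ?H" using mspan_minimal[OF sub, of A] A(3) by blast
  then have "mspan M ?H = carrier M" using submoduleE(1)[OF sub] by blast
  then have ne: "{B \<in> Pow ?H. mspan M B = carrier M} \<noteq> {}" by blast
  have "finite {B \<in> Pow ?H. mspan M B = carrier M}" using fin by simp
  from finite_has_minimal[OF this ne] obtain B where
    B': "B \<in> {B \<in> Pow ?H. mspan M B = carrier M}"
      "\<forall>B'\<in>{B \<in> Pow ?H. mspan M B = carrier M}. B' \<le> B \<longrightarrow> B = B'"
    by (rule bexE)
  have B: "B \<subseteq> ?H" "mspan M B = carrier M" using B'(1) by simp_all
  have min: "mspan M B' \<noteq> carrier M" if "B' \<subset> B" for B'
  proof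
    assume "mspan M B' = carrier M"
    moreover have "B' \<in> Pow ?H" using that B(1) by (meson PowI psubset_imp_subset subset_trans)
    ultimately have "B = B'" using B'(2) that by (simp add: psubset_imp_subset)
    then show False using that by simp
  qed
  have "\<exists>a. m \<in> gcomp M a" if m: "m \<in> B" for m
  proof -
    obtain x a where "x \<in> A" "m = component x a" using m B(1) by blast
    then show ?thesis using component_properties(1)[of x a] A(2) by auto
  qed
  then show ?thesis using B(2) min unfolding minimal_homogeneous_generators_def by blast
qed

text \<open>
  A minimal generating set does not contain zero, so the degree of each member is unique.
\<close>

lemma mdegree_generator:
  assumes "minimal_homogeneous_generators M A" "m \<in> A" "m \<in> gcomp M a"
  shows "mdegree M m = a"
proof -
  have "m \<noteq> \<zero>"
  proof
    assume "m = \<zero>"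
    then have "{N. submodule N mpoly_ring M \<and> A \<subseteq> N} = {N. submodule N mpoly_ring M \<and> A - {m} \<subseteq> N}"
      using subgroup.one_closed[OF submodule.axioms(1)] by fastforce
    then have "mspan M (A - {m}) = mspan M A" by (simp add: mspan_def)
    moreover have "A - {m} \<subset> A" using assms(2) by blast
    ultimately show False using assms(1) unfolding minimal_homogeneous_generators_def by metis
  qed
  then have "b = a" if "m \<in> gcomp M b" for b
    using component_homogeneous[OF that, of a] component_homogeneous[OF assms(3), of a] by (auto split: if_splits)
  then show ?thesis unfolding mdegree_def using assms(3) by (intro the_equality)
qed

text \<open>
  Let \<open>r a\<close> be the part of \<open>a\<close> in the variables outside \<open>Gens(M)\<close>. Then \<open>M\<^sub>a \<subseteq> x\<^sup>r\<^sup>(\<^sup>a\<^sup>) M\<close>: the generators have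
  degrees with \<open>r = 0\<close>, and the property passes to monomial multiples as \<open>r (t + a) \<le> t + r a\<close>. If \<open>x\<^sup>a\<close> is in \<open>I\<close>, a
  minimal generator of \<open>I\<close> divides \<open>x\<^sup>a\<close>; having no variable in \<open>Gens(M)\<close>, it divides already \<open>x\<^sup>r\<^sup>(\<^sup>a\<^sup>)\<close>.
\<close>

lemma gcomp_in_ideal_times_module:
  assumes I: "monomial_ideal I" and fg: "finitely_generated M" and disj: "Gens_ideal I \<inter> Gens_module M = {}"
    and a: "a \<in> monomials_in I" and x: "x \<in> gcomp M a"
  shows "x \<in> ideal_times_module I M"
proof -
  define r where "r a = (\<lambda>i. if i \<in> Gens_module M then 0 else a i)" for a :: "'v expo"
  define P where "P a = (\<lambda>y. single (r a) 1 \<odot> y) ` carrier M" for a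
  have N: "submodule {x \<in> carrier M. \<forall>a. component x a \<in> P a} mpoly_ring M" (is "submodule ?N _ _")
  proof (rule submodule_by_components)
    show "\<zero> \<in> P a" for a
      unfolding P_def by (rule image_eqI[of _ _ \<zero>]) (simp_all add: smult_r_null)
    show "x \<oplus> y \<in> P a" if "x \<in> P a" "y \<in> P a" for a x y
    proof -
      obtain z w where "z \<in> carrier M" "w \<in> carrier M" "x = single (r a) 1 \<odot> z" "y = single (r a) 1 \<odot> w"
        using \<open>x \<in> P a\<close> \<open>y \<in> P a\<close> unfolding P_def by blast
      then show ?thesis unfolding P_def by (intro image_eqI[of _ _ "z \<oplus> w"]) (simp_all add: smult_r_distr)
    qed
    show "single t k \<odot> x \<in> P (t + a)" if "x \<in> P a" for a t k x
    proof -
      obtain z where z: "z \<in> carrier M" "x = single (r a) 1 \<odot> z" using \<open>x \<in> P a\<close> unfolding P_def by blast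
      have "r (t + a) + (t - r t) = t + r a" by (auto simp: r_def fun_eq_iff)
      then have e1: "single t k * single (r a) 1 = single (r (t + a)) 1 * single (t - r t) k"
        by (simp add: mult_single)
      have e2: "single t k \<odot> x = (single t k * single (r a) 1) \<odot> z"
        using z smult_assoc1[of "single t k" "single (r a) 1" z] by simp
      have e3: "(single (r (t + a)) 1 * single (t - r t) k) \<odot> z = single (r (t + a)) 1 \<odot> (single (t - r t) k \<odot> z)"
        using z smult_assoc1[of "single (r (t + a)) 1" "single (t - r t) k" z] by simp
      have "single t k \<odot> x = single (r (t + a)) 1 \<odot> (single (t - r t) k \<odot> z)"
        using e2 unfolding e1 e3 .
      then show ?thesis unfolding P_def by (rule image_eqI) (use z(1) in simp)
    qed
  qed
  obtain A where A: "minimal_homogeneous_generators M A"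
    using ex_minimal_homogeneous_generators[OF fg] by blast
  have "m \<in> ?N" if m: "m \<in> A" for m
  proof -
    obtain d where d: "m \<in> gcomp M d" using A m unfolding minimal_homogeneous_generators_def by blast
    have "i \<in> Gens_module M" if "0 < d i" for i
      using A m that mdegree_generator[OF A m d] unfolding Gens_module_def by auto
    then have "r d = 0" by (auto simp: r_def fun_eq_iff)
    then have "m = single (r d) 1 \<odot> m" using gcomp_carrier[OF d] one_smult[of m] by simp
    then have "m \<in> P d" unfolding P_def using gcomp_carrier[OF d] by blast
    moreover have "\<zero> \<in> P a" for a
      unfolding P_def by (rule image_eqI[of _ _ \<zero>]) (simp_all add: smult_r_null)
    ultimately show ?thesis using gcomp_carrier[OF d] component_homogeneous[OF d] by simp
  qed
  then have "carrier M \<subseteq> ?N" using mspan_minimal[OF N, of A] A unfolding minimal_homogeneous_generators_def by blast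
  then have "component x a \<in> P a" using gcomp_carrier[OF x] by blast
  then obtain y where y: "y \<in> carrier M" "x = single (r a) 1 \<odot> y"
    using component_homogeneous[OF x] unfolding P_def by auto
  obtain b where b: "b \<in> minimal_monomials I" "b \<le> a" using minimal_monomial_below[OF I a] by blast
  have "b \<le> r a"
  proof (rule le_funI)
    fix i show "b i \<le> r a i"
      using minimal_monomials_Gens[OF I b(1), of i] disj le_funD[OF b(2), of i] by (auto simp: r_def)
  qed
  moreover have "b \<in> monomials_in I" using b(1) by (simp add: minimal_monomials_def[OF I])
  ultimately have "r a \<in> monomials_in I" using monomials_in_upward[OF I] by blast
  then have "single (r a) 1 \<in> I" by (simp add: monomials_in_def monomial_def)
  then show ?thesis unfolding y(2) using y(1) by (rule smult_in_ideal_times_module)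
qed

end

section \<open>The augmentation of the star complex\<close>

lemma submodule_monomial_ideal:
  fixes I :: "('v::finite, 'k::field) mpoly set"
  assumes "monomial_ideal I"
  shows "submodule I mpoly_ring regular_module"
proof -
  interpret R: module mpoly_ring "regular_module :: ('v, 'k, ('v, 'k) mpoly) gmod" by (rule module_regular_module)
  note iff = mem_monomial_ideal_iff[OF assms]
  have [simp]: "add regular_module = ((+) :: ('v, 'k) mpoly \<Rightarrow> _)"
    "module.smult regular_module = ((*) :: ('v, 'k) mpoly \<Rightarrow> _)" "carrier regular_module = (UNIV :: ('v, 'k) mpoly set)"
    "ring.zero regular_module = (0 :: ('v, 'k) mpoly)"
    by (simp_all add: regular_module_def)
  have mult: "s * p \<in> I" if "p \<in> I" for s p
  proof -
    have "e \<in> monomials_in I" if "e \<in> keys (s * p)" for e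
    proof -
      obtain u w where "e = u + w" "w \<in> keys p" using keys_mult[of s p] \<open>e \<in> _\<close> by blast
      then show ?thesis using \<open>p \<in> I\<close> iff[of p] monomials_in_upward[OF assms, of w e] by auto
    qed
    then show ?thesis unfolding iff by blast
  qed
  show ?thesis
  proof (rule R.submoduleI)
    show "\<ominus>\<^bsub>regular_module\<^esub> p \<in> I" if "p \<in> I" for p
    proof -
      have "\<ominus>\<^bsub>regular_module\<^esub> p = - p" using R.minus_equality[of "- p" p] by simp
      then show ?thesis using mult[OF that, of "- 1"] by simp
    qed
    show "p \<oplus>\<^bsub>regular_module\<^esub> q \<in> I" if "p \<in> I" "q \<in> I" for p q
      using that keys_add[of p q] unfolding iff by auto
  qed (use mult in \<open>auto simp: iff\<close>)
qed

text \<open>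
  The augmentation \<open>F\<^sub>0 \<rightarrow> S/I\<close> sends a basis element \<open>f\<close> to the class of \<open>c\<^sub>f u\<^sub>f\<close> for some scalar \<open>c\<^sub>f\<close>, which is
  arbitrary if \<open>u\<^sub>f\<close> is in \<open>I\<close>. Thus in degree \<open>a\<close> it sends a vector \<open>w\<close> of coordinates to the class of \<open>c(w) x\<^sup>a\<close>,
  and the strand of \<open>F\<close> has zeroth homology \<open>0\<close> or one-dimensional according to whether \<open>x\<^sup>a\<close> is in \<open>I\<close>.
\<close>

lemma cyclic_augmentation:
  fixes I :: "('v::finite, 'k::field) mpoly set" and F :: "('v, 'k, 'b) free_complex"
  assumes I: "monomial_ideal I" and F: "free_resolution F (quotient_module regular_module I)"
  obtains c where
    "\<And>a w. w \<in> supported_on (cstrand F a 0) \<Longrightarrow>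
      w \<in> mat_app (diff_matrix F 1) ` supported_on (cstrand F a 1) \<longleftrightarrow> a \<in> monomials_in I \<or> functional c w = 0"
    "\<And>a. a \<notin> monomials_in I \<Longrightarrow> \<exists>e\<in>supported_on (cstrand F a 0). functional c e = 1"
proof -
  let ?Q = "quotient_module regular_module I" and ?B = "cbasis F 0"
  interpret module_with_submodule "regular_module :: ('v, 'k, ('v, 'k) mpoly) gmod" I
    by (simp add: module_with_submodule_def module_with_submodule_axioms_def module_regular_module submodule_monomial_ideal[OF I])
  have reg [simp]: "x \<oplus>\<^bsub>regular_module\<^esub> y = x + y" "s \<odot>\<^bsub>regular_module\<^esub> x = s * x" "x \<in> carrier regular_module"
    "\<zero>\<^bsub>regular_module\<^esub> = 0" for x y s :: "('v, 'k) mpoly"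
    by (simp_all add: regular_module_def)
  have minus: "x \<ominus>\<^bsub>regular_module\<^esub> y = x - y" for x y :: "('v, 'k) mpoly"
    using minus_equality[of "- y" y] by (simp add: a_minus_def)
  define co where "co p = I +>\<^bsub>regular_module\<^esub> p" for p
  have co_eq: "co p = co q \<longleftrightarrow> p - q \<in> I" for p q
    using coset_eq_iff[of p q] by (simp add: co_def minus)
  have co_add: "co p \<oplus>\<^bsub>?Q\<^esub> co q = co (p + q)" for p q
    using coset_add[of p q] by (simp add: co_def)
  have co_smult: "s \<odot>\<^bsub>?Q\<^esub> co p = co (s * p)" for s p
    using coset_smult[of p s] by (simp add: co_def)
  have C: "is_complex F" using F by (simp add: free_resolution_iff)
  have "\<exists>\<epsilon>. graded_hom (cmod F 0) ?Q \<epsilon> \<and> \<epsilon> ` carrier (cmod F 0) = carrier ?Q \<and>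
      (\<forall>x\<in>carrier (cmod F 0). \<forall>y\<in>carrier (cmod F 0). \<epsilon> x = \<epsilon> y \<longleftrightarrow> x - y \<in> cdiff F 1 ` carrier (cmod F 1))"
    using F unfolding free_resolution_iff by (elim conjE)
  then obtain \<epsilon> where "graded_hom (cmod F 0) ?Q \<epsilon>"
    and e2: "\<epsilon> ` carrier (cmod F 0) = carrier ?Q"
    and e3: "\<forall>x\<in>carrier (cmod F 0). \<forall>y\<in>carrier (cmod F 0). \<epsilon> x = \<epsilon> y \<longleftrightarrow> x - y \<in> cdiff F 1 ` carrier (cmod F 1)"
    by (elim exE conjE)
  then have e: "graded_hom (free_module ?B) ?Q \<epsilon>" "\<epsilon> ` carrier (cmod F 0) = carrier ?Q"
    "\<And>x y. x \<in> carrier (cmod F 0) \<Longrightarrow> y \<in> carrier (cmod F 0) \<Longrightarrow>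
      \<epsilon> x = \<epsilon> y \<longleftrightarrow> x - y \<in> cdiff F 1 ` carrier (cmod F 1)"
    by (simp_all add: cmod_def)
  have e_add: "\<epsilon> (x + y) = \<epsilon> x \<oplus>\<^bsub>?Q\<^esub> \<epsilon> y"
    if "x \<in> carrier (free_module ?B)" "y \<in> carrier (free_module ?B)" for x y
    using e(1) that by (simp add: graded_hom_def)
  have e_smult: "\<epsilon> (fsmult s x) = s \<odot>\<^bsub>?Q\<^esub> \<epsilon> x" if "x \<in> carrier (free_module ?B)" for s x
    using e(1) that by (simp add: graded_hom_def)
  have "\<exists>c. f \<in> bset ?B \<longrightarrow> \<epsilon> (single f 1) = co (single (bdeg ?B f) c)" for f
  proof (cases "f \<in> bset ?B")
    case True
    have "\<epsilon> ` gcomp (free_module ?B) (bdeg ?B f) \<subseteq> gcomp ?Q (bdeg ?B f)"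
      using e(1) unfolding graded_hom_def by blast
    then have "\<epsilon> (single f 1) \<in> gcomp ?Q (bdeg ?B f)" using single_in_gcomp[OF True] by blast
    then show ?thesis by (auto simp: quotient_module_def regular_module_def[where ?'v = 'v] co_def)
  qed simp
  then obtain c where c: "\<And>f. f \<in> bset ?B \<Longrightarrow> \<epsilon> (single f 1) = co (single (bdeg ?B f) (c f))" by metis
  \<comment> \<open>\<open>\<pi>\<close> lifts the augmentation to a map into the polynomial ring.\<close>
  define \<pi> where "\<pi> x = (\<Sum>f\<in>keys x. lookup x f * single (bdeg ?B f) (c f))" for x
  have lookup_pi: "lookup (\<pi> x) a = functional c (strand ?B a x)" for x a
  proof -
    have "lookup (\<pi> x) a = (\<Sum>f\<in>keys x. lookup (strand ?B a x) f * c f)"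
      by (auto simp: \<pi>_def lookup_sum lookup_mult_single lookup_strand intro!: sum.cong)
    also have "\<dots> = functional c (strand ?B a x)"
      unfolding functional_def by (rule sum.mono_neutral_right) (auto simp: in_keys_iff lookup_strand split: if_splits)
    finally show ?thesis .
  qed
  have pi: "\<epsilon> x = co (\<pi> x)" if x: "x \<in> carrier (free_module ?B)" for x
  proof -
    have "\<epsilon> (\<Sum>f\<in>S. single f (lookup x f)) = co (\<Sum>f\<in>S. lookup x f * single (bdeg ?B f) (c f))
        \<and> (\<Sum>f\<in>S. single f (lookup x f)) \<in> carrier (free_module ?B)"
      if "finite S" "S \<subseteq> keys x" for S
      using that
    proof (induction S)
      case empty
      have 0: "0 \<in> carrier (free_module ?B)" by (simp add: carrier_free_module)
      then have "\<epsilon> 0 \<in> carrier ?Q" using e(2) by (auto simp: cmod_def)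
      then obtain p where "\<epsilon> 0 = co p" unfolding carrier_quotient co_def by blast
      then have "\<epsilon> 0 = co 0" using e_smult[OF 0, of 0] co_smult[of 0 p] by simp
      then show ?case using 0 by simp
    next
      case (insert f S)
      then have f: "f \<in> bset ?B" using x by (auto simp: carrier_free_module)
      then have 1: "single f 1 \<in> carrier (free_module ?B)" by (simp add: carrier_free_module)
      have "single f (lookup x f) = fsmult (lookup x f) (single f 1)" by simp
      then have 2: "single f (lookup x f) \<in> carrier (free_module ?B)"
        "\<epsilon> (single f (lookup x f)) = co (lookup x f * single (bdeg ?B f) (c f))"
        using carrier_free_fsmult[OF 1] e_smult[OF 1] c[OF f] co_smult by metis+
      show ?case using insert 2 e_add[OF 2(1)] carrier_free_add[OF 2(1)] by (simp add: co_add)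
    qed
    from this[of "keys x"] show ?thesis by (simp add: poly_mapping_sum_single \<pi>_def)
  qed
  have image_iff: "x \<in> cdiff F 1 ` carrier (cmod F 1) \<longleftrightarrow>
      (\<forall>a. a \<notin> monomials_in I \<longrightarrow> functional c (strand ?B a x) = 0)" if x: "x \<in> carrier (cmod F 0)" for x
  proof -
    have 0: "0 \<in> carrier (cmod F 0)" by (simp add: cmod_def carrier_free_module)
    have "\<pi> 0 = 0" by (simp add: \<pi>_def)
    then have "\<epsilon> x = \<epsilon> 0 \<longleftrightarrow> \<pi> x \<in> I" using x 0 by (simp add: cmod_def pi co_eq)
    then show ?thesis
      using e(3)[OF x 0] by (auto simp: mem_monomial_ideal_iff[OF I] in_keys_iff lookup_pi)
  qed
  show thesis
  proof
    fix a and w :: "'b \<Rightarrow>\<^sub>0 'k" assume w: "w \<in> supported_on (cstrand F a 0)"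
    have "w \<in> mat_app (diff_matrix F 1) ` supported_on (cstrand F a 1) \<longleftrightarrow>
        unstrand ?B a w \<in> cdiff F 1 ` carrier (cmod F 1)"
      using unstrand_boundary_iff[OF C w] by simp
    also have "\<dots> \<longleftrightarrow> (\<forall>a'. a' \<notin> monomials_in I \<longrightarrow> functional c (strand ?B a' (unstrand ?B a w)) = 0)"
      by (rule image_iff) (simp add: cmod_def unstrand_carrier[OF w])
    also have "\<dots> \<longleftrightarrow> a \<in> monomials_in I \<or> functional c w = 0"
      unfolding strand_unstrand[OF w] by auto
    finally show "w \<in> mat_app (diff_matrix F 1) ` supported_on (cstrand F a 1) \<longleftrightarrow> a \<in> monomials_in I \<or> functional c w = 0" .
  next
    fix a assume a: "a \<notin> monomials_in I"
    have "co (single a 1) \<in> carrier ?Q" unfolding carrier_quotient co_def by (rule imageI) simp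
    then have "co (single a 1) \<in> \<epsilon> ` carrier (cmod F 0)" by (simp only: e(2))
    then obtain x where x: "x \<in> carrier (cmod F 0)" "\<epsilon> x = co (single a 1)" by (elim imageE) simp
    then have "\<pi> x - single a 1 \<in> I" using pi by (simp add: cmod_def co_eq)
    then have "lookup (\<pi> x - single a 1) a = 0"
      using a by (auto simp: mem_monomial_ideal_iff[OF I] in_keys_iff)
    then have "functional c (strand ?B a x) = 1" by (simp add: lookup_minus lookup_pi)
    moreover have "strand ?B a x \<in> supported_on (cstrand F a 0)"
      using keys_strand x(1) unfolding cmod_def by blast
    ultimately show "\<exists>e\<in>supported_on (cstrand F a 0). functional c e = 1" by blast
  qed
qed

context multigraded_module
begin

context
  fixes B :: "('v, 'b) graded_basis" and \<epsilon> :: "('v, 'k, 'b) fvec \<Rightarrow> 'm"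
  assumes hom: "graded_hom (free_module B) M \<epsilon>"
begin

lemma hom_from_free_carrier: "x \<in> carrier (free_module B) \<Longrightarrow> \<epsilon> x \<in> carrier M"
  and hom_from_free_add: "x \<in> carrier (free_module B) \<Longrightarrow> y \<in> carrier (free_module B) \<Longrightarrow> \<epsilon> (x + y) = \<epsilon> x \<oplus> \<epsilon> y"
  and hom_from_free_gcomp: "x \<in> gcomp (free_module B) a \<Longrightarrow> \<epsilon> x \<in> gcomp M a"
  using hom unfolding graded_hom_def free_module_simps by (blast dest: funcset_mem)+

lemma hom_from_free_zero: "\<epsilon> 0 = \<zero>"
proof -
  have 0: "0 \<in> carrier (free_module B)" by (simp add: carrier_free_module)
  then have "\<epsilon> (fsmult 0 0) = 0 \<odot> \<epsilon> 0" using hom unfolding graded_hom_def free_module_simps by blast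
  then show ?thesis using smult_l_null[OF hom_from_free_carrier[OF 0]] by simp
qed

lemma component_hom_from_free:
  assumes x: "x \<in> carrier (free_module B)"
  shows "component (\<epsilon> x) a = \<epsilon> (unstrand B a (strand B a x))"
proof -
  let ?u = "\<lambda>a. unstrand B a (strand B a x)"
  have u: "?u a \<in> gcomp (free_module B) a" for a by (rule unstrand_in_gcomp[OF keys_strand[OF x]])
  have *: "\<epsilon> (\<Sum>a\<in>S. ?u a) = (\<Oplus>a\<in>S. \<epsilon> (?u a)) \<and> (\<Sum>a\<in>S. ?u a) \<in> carrier (free_module B)" if "finite S" for S
    using that
  proof (induction S)
    case empty
    show ?case by (simp add: hom_from_free_zero carrier_free_module)
  next
    case (insert a S)
    have ua: "?u b \<in> carrier (free_module B)" for b by (rule gcomp_carrier_free_module[OF u])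
    have "(\<Oplus>b\<in>insert a S. \<epsilon> (?u b)) = \<epsilon> (?u a) \<oplus> (\<Oplus>b\<in>S. \<epsilon> (?u b))"
      using insert.hyps hom_from_free_carrier[OF ua] by (intro finsum_insert) auto
    then show ?case using insert ua[of a] by (simp add: hom_from_free_add carrier_free_add)
  qed
  have "component (\<epsilon> x) = (\<lambda>a. \<epsilon> (?u a))"
  proof (rule component_unique[OF _ finite_strands[of B x]])
    show "\<epsilon> x = (\<Oplus>a\<in>{a. strand B a x \<noteq> 0}. \<epsilon> (?u a))"
      using *[OF finite_strands[of B x]] by (simp add: sum_strands[OF x])
  qed (use hom_from_free_gcomp[OF u] hom_from_free_zero in auto)
  then show ?thesis by simp
qed

end

text \<open>
  In the degrees of monomials of \<open>I\<close> the submodule \<open>I M\<close> is everything, in all other degrees it is zero.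
\<close>

lemma mem_ideal_times_module_iff:
  assumes I: "monomial_ideal I" and fg: "finitely_generated M" and disj: "Gens_ideal I \<inter> Gens_module M = {}"
    and x: "x \<in> carrier M"
  shows "x \<in> ideal_times_module I M \<longleftrightarrow> (\<forall>a. a \<notin> monomials_in I \<longrightarrow> component x a = \<zero>)"
proof
  assume "\<forall>a. a \<notin> monomials_in I \<longrightarrow> component x a = \<zero>"
  then have comp: "component x a \<in> ideal_times_module I M" for a
    using gcomp_in_ideal_times_module[OF I fg disj _ component_properties(1)[OF x]]
      subgroup.one_closed[OF submodule.axioms(1)[OF submodule_ideal_times_module]]
    by (cases "a \<in> monomials_in I") auto
  have "(\<Oplus>a\<in>S. component x a) \<in> ideal_times_module I M" if "finite S" for S
    using that
  proof (induction S)
    case empty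
    then show ?case using subgroup.one_closed[OF submodule.axioms(1)[OF submodule_ideal_times_module]] by simp
  next
    case (insert a S)
    have "(\<Oplus>b\<in>insert a S. component x b) = component x a \<oplus> (\<Oplus>b\<in>S. component x b)"
      using insert.hyps component_carrier[OF x] by (intro finsum_insert) auto
    then show ?case using submoduleE(5)[OF submodule_ideal_times_module comp insert.IH] by simp
  qed
  from this[OF component_properties(2)[OF x]] show "x \<in> ideal_times_module I M"
    using component_properties(3)[OF x] by simp
qed (use component_ideal_times_module[OF I] in blast)

end

text \<open>
  The hypothesis of \<open>contracting_homotopy\<close> in a single strand; \<open>b\<close> says that \<open>x\<^sup>a\<close> is in \<open>I\<close>.
\<close>

lemma strand_augmentation_data:
  fixes F :: "('v, 'k::field, 'b) free_complex"
  assumes C: "is_complex F"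
    and c: "\<And>w. w \<in> supported_on (cstrand F a 0) \<Longrightarrow>
      w \<in> mat_app (diff_matrix F 1) ` supported_on (cstrand F a 1) \<longleftrightarrow> b \<or> functional c w = 0"
      "\<not> b \<Longrightarrow> \<exists>e\<in>supported_on (cstrand F a 0). functional c e = 1"
    and l: "l = (if b then (\<lambda>_. 0) else c)"
  shows "\<exists>e. e \<in> supported_on (cstrand F a 0) \<and>
      (\<forall>w\<in>supported_on (cstrand F a 1). functional l (mat_app (diff_matrix F 1) w) = 0) \<and>
      (\<forall>w\<in>supported_on (cstrand F a 0).
        w - pscale (functional l w) e \<in> mat_app (diff_matrix F 1) ` supported_on (cstrand F a 1))"
proof (cases b)
  case True
  show ?thesis
  proof (intro exI[of _ 0] conjI ballI)
    fix w :: "'b \<Rightarrow>\<^sub>0 'k" assume "w \<in> supported_on (cstrand F a 0)"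
    then show "w - pscale (functional l w) 0 \<in> mat_app (diff_matrix F 1) ` supported_on (cstrand F a 1)"
      using c(1)[of w] True by simp
  qed (simp_all add: True l)
next
  case False
  obtain e where e: "e \<in> supported_on (cstrand F a 0)" "functional c e = 1" using c(2)[OF False] by blast
  show ?thesis
  proof (intro exI[of _ e] conjI ballI e(1))
    fix w :: "'b \<Rightarrow>\<^sub>0 'k" assume w: "w \<in> supported_on (cstrand F a 1)"
    have "mat_app (diff_matrix F 1) w \<in> supported_on (cstrand F a 0)"
      using diff_matrix_supported[OF C w] by simp
    then show "functional l (mat_app (diff_matrix F 1) w) = 0"
      using c(1)[of "mat_app (diff_matrix F 1) w"] imageI[OF w, of "mat_app (diff_matrix F 1)"] False l by simp
  next
    fix w :: "'b \<Rightarrow>\<^sub>0 'k" assume w: "w \<in> supported_on (cstrand F a 0)"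
    have "w - pscale (functional c w) e \<in> supported_on (cstrand F a 0)"
      by (rule kvs.subspace_diff[OF subspace_supported_on w kvs.subspace_scale[OF subspace_supported_on e(1)]])
    from c(1)[OF this] show "w - pscale (functional l w) e \<in> mat_app (diff_matrix F 1) ` supported_on (cstrand F a 1)"
      using e(2) False l by (simp add: functional_diff functional_scale)
  qed
qed

text \<open>
  The map \<open>F\<^sub>0 * G\<^sub>0 \<rightarrow> G\<^sub>0\<close>, \<open>f * g \<mapsto> c\<^sub>f [u\<^sub>f, u\<^sub>g] / u\<^sub>g \<cdot> g\<close>, which is \<open>c \<otimes> 1\<close> in every strand. Followed by the
  augmentation \<open>G\<^sub>0 \<rightarrow> M\<close> and the projection \<open>M \<rightarrow> M/IM\<close> it is the augmentation of the star complex.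
\<close>

definition collapse :: "('v, 'k::field, 'b) free_complex \<Rightarrow> ('v, 'k, 'c) free_complex \<Rightarrow> ('b \<Rightarrow> 'k) \<Rightarrow>
    ('v, 'k, (nat \<times> nat) \<times> ('b \<times> 'c)) fvec \<Rightarrow> ('v, 'k, 'c) fvec"
  where "collapse F G c = linear_extension (\<lambda>(jk, (f, g)).
    single g (single (sup (bdeg (cbasis F 0) f) (bdeg (cbasis G 0) g) - bdeg (cbasis G 0) g) (c f)))"

lemma collapse_entry:
  assumes "b \<in> bset (cbasis (star_complex F G) 0)"
  shows "(\<lambda>(jk, (f, g)). single g (single (sup (bdeg (cbasis F 0) f) (bdeg (cbasis G 0) g) - bdeg (cbasis G 0) g) (c f))) b
    \<in> gcomp (free_module (cbasis G 0)) (bdeg (cbasis (star_complex F G) 0) b)"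
  using assms
  by (auto simp: star_complex_def gcomp_free_module lookup_single when_def direct_sum_basis_def split: if_splits)

lemma graded_hom_collapse: "graded_hom (cmod (star_complex F G) 0) (cmod G 0) (collapse F G c)"
  unfolding collapse_def cmod_def by (rule graded_hom_linear_extension[OF collapse_entry])

lemma strand_collapse:
  fixes F :: "('v, 'k::field, 'b) free_complex" and G :: "('v, 'k, 'c) free_complex"
  assumes F: "is_complex F" and G: "is_complex G" and x: "x \<in> carrier (cmod (star_complex F G) 0)"
  shows "strand (cbasis G 0) a (collapse F G c x) = augmentation_row c 0 (strand (cbasis (star_complex F G) 0) a x)"
proof (rule poly_mapping_eqI)
  fix g
  let ?B = "cbasis (star_complex F G) 0" and ?H = "cbasis G 0"
  let ?t = "\<lambda>(jk :: nat \<times> nat, (f, g)).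
    single g (single (sup (bdeg (cbasis F 0) f) (bdeg (cbasis G 0) g) - bdeg (cbasis G 0) g) (c f))"
  let ?p = "strand ?B a x"
  let ?K = "(\<lambda>f. ((0, 0), (f, g))) ` keys (tensor_column ?p 0 0 g)"
  have deg: "bdeg ?B ((0, 0), (f, h)) = sup (bdeg (cbasis F 0) f) (bdeg ?H h)" for f h
    by (simp add: star_complex_def)
  have p: "?p \<in> supported_on (cstrand (star_complex F G) a 0)"
    using keys_strand x unfolding cmod_def by blast
  have 0: "b = ((0, 0), (fst (snd b), snd (snd b)))" if "b \<in> keys ?p" for b
    using p that mem_cstrand_star[OF F G, where a = a and i = 0 and j = "fst (fst b)" and k = "snd (fst b)" and
      f = "fst (snd b)" and g = "snd (snd b)"]
    by (auto simp: prod_eq_iff)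
  have T: "lookup (strand ?H (bdeg ?B ((0, 0), (f, h))) (?t ((0, 0), (f, h)))) g = (if h = g then c f else 0)" for f h
    unfolding deg lookup_strand by (auto simp: lookup_single when_def)
  have t: "?t b \<in> gcomp (free_module ?H) (bdeg ?B b)" if "b \<in> keys x" for b
    using collapse_entry[of b F G c] x that by (auto simp: cmod_def carrier_free_module)
  have "lookup (strand ?H a (collapse F G c x)) g = (\<Sum>b\<in>keys ?p. lookup ?p b * lookup (strand ?H (bdeg ?B b) (?t b)) g)"
    unfolding collapse_def
    by (subst strand_linear_extension[where t = ?t and B = ?B and C = ?H]) (use t in \<open>simp_all only: lookup_mat_app\<close>)
  also have "\<dots> = (\<Sum>b\<in>?K. lookup ?p b * lookup (strand ?H (bdeg ?B b) (?t b)) g)"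
  proof (rule sum.mono_neutral_right)
    show "?K \<subseteq> keys ?p" by (auto simp: in_keys_iff)
    show "\<forall>b\<in>keys ?p - ?K. lookup ?p b * lookup (strand ?H (bdeg ?B b) (?t b)) g = 0"
    proof
      fix b assume b: "b \<in> keys ?p - ?K"
      obtain f h where fh: "b = ((0, 0), (f, h))" using 0 b by blast
      then have "h \<noteq> g" using b by (auto simp: in_keys_iff)
      then show "lookup ?p b * lookup (strand ?H (bdeg ?B b) (?t b)) g = 0"
        unfolding fh T by simp
    qed
  qed simp
  also have "\<dots> = (\<Sum>f\<in>keys (tensor_column ?p 0 0 g). lookup (tensor_column ?p 0 0 g) f * c f)"
    by (subst sum.reindex) (auto simp: inj_on_def T[unfolded prod.case])
  finally show "lookup (strand ?H a (collapse F G c x)) g = lookup (augmentation_row c 0 ?p) g"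
    by (simp add: lookup_augmentation_row functional_def)
qed

text \<open>
  Let \<open>\<eta>\<close> be the composite \<open>F\<^sub>0 * G\<^sub>0 \<rightarrow> G\<^sub>0 \<rightarrow> M \<rightarrow> M/IM\<close>. An element is in its kernel iff, for every \<open>a\<close> with
  \<open>x\<^sup>a \<notin> I\<close>, the image of its strand under \<open>c \<otimes> 1\<close> is a boundary of \<open>G\<close>, since \<open>I M\<close> consists of the elements
  without components in those degrees. In these degrees this is the criterion of \<open>star_strand_boundary\<close> for being a
  boundary of \<open>F * G\<close>; in the other degrees everything is a boundary. For surjectivity, multiply the
  coordinates of an element of \<open>G\<^sub>0\<close> by a vector \<open>e\<close> with \<open>c(e) = 1\<close>.
\<close>

theorem star_free_resolution:
  fixes I :: "('v::finite, 'k::field) mpoly set"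
    and M :: "('v, 'k, 'm) gmod"
    and F :: "('v, 'k, 'b) free_complex"
    and G :: "('v, 'k, 'c) free_complex"
  assumes I: "monomial_ideal I" and M: "multigraded_module M" and fg: "finitely_generated M"
    and disj: "Gens_ideal I \<inter> Gens_module M = {}"
    and resF: "free_resolution F (quotient_module regular_module I)" and resG: "free_resolution G M"
  shows "free_resolution (star_complex F G) (quotient_module M (ideal_times_module I M))"
proof -
  let ?T = "star_complex F G" and ?N = "ideal_times_module I M"
  let ?E = "monomials_in I"
  interpret multigraded_module M by (rule M)
  interpret q: module_with_submodule M ?N
    by (simp add: module_with_submodule_def module_with_submodule_axioms_def module_axioms submodule_ideal_times_module)
  have F: "is_complex F" "exact_at F (Suc i)" and G: "is_complex G" "exact_at G (Suc i)" for i
    using resF resG by (simp_all add: free_resolution_iff)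
  have T: "is_complex ?T" by (rule is_complex_star[OF F(1) G(1)])
  obtain c where c: "\<And>a w. w \<in> supported_on (cstrand F a 0) \<Longrightarrow>
      w \<in> mat_app (diff_matrix F 1) ` supported_on (cstrand F a 1) \<longleftrightarrow> a \<in> ?E \<or> functional c w = 0"
    "\<And>a. a \<notin> ?E \<Longrightarrow> \<exists>e\<in>supported_on (cstrand F a 0). functional c e = 1"
    using cyclic_augmentation[OF I resF] by blast
  have aug: "\<exists>e. e \<in> supported_on (cstrand F a 0) \<and>
      (\<forall>w\<in>supported_on (cstrand F a 1). functional l (mat_app (diff_matrix F 1) w) = 0) \<and>
      (\<forall>w\<in>supported_on (cstrand F a 0).
        w - pscale (functional l w) e \<in> mat_app (diff_matrix F 1) ` supported_on (cstrand F a 1))"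
    if "l = (if a \<in> ?E then (\<lambda>_. 0) else c)" for a l
    by (rule strand_augmentation_data[OF F(1) c that])
  have exT: "exact_at ?T (Suc n)" for n
    by (rule exact_at_star[OF F(1) G(1) F(2) G(2)]) (use aug[OF refl] in blast)
  have "\<exists>\<epsilon>. graded_hom (cmod G 0) M \<epsilon> \<and> \<epsilon> ` carrier (cmod G 0) = carrier M \<and>
      (\<forall>x\<in>carrier (cmod G 0). \<forall>y\<in>carrier (cmod G 0). \<epsilon> x = \<epsilon> y \<longleftrightarrow> x - y \<in> cdiff G 1 ` carrier (cmod G 1))"
    using resG unfolding free_resolution_iff by (elim conjE)
  then obtain \<epsilon> where "graded_hom (cmod G 0) M \<epsilon>"
    and e2: "\<epsilon> ` carrier (cmod G 0) = carrier M"
    and e3: "\<forall>x\<in>carrier (cmod G 0). \<forall>y\<in>carrier (cmod G 0). \<epsilon> x = \<epsilon> y \<longleftrightarrow> x - y \<in> cdiff G 1 ` carrier (cmod G 1)"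
    by (elim exE conjE)
  then have e1: "graded_hom (free_module (cbasis G 0)) M \<epsilon>" by (simp add: cmod_def)
  note eps = hom_from_free_carrier[OF e1] hom_from_free_add[OF e1] hom_from_free_zero[OF e1]
    component_hom_from_free[OF e1]
  have eps_zero_iff: "\<epsilon> y = \<zero>\<^bsub>M\<^esub> \<longleftrightarrow> y \<in> cdiff G 1 ` carrier (cmod G 1)" if y: "y \<in> carrier (cmod G 0)" for y
  proof -
    have "0 \<in> carrier (cmod G 0)" by (simp add: cmod_def carrier_free_module)
    then show ?thesis using e3[rule_format, OF y, of 0] eps(3) by simp
  qed
  let ?\<theta> = "collapse F G c"
  have collapse: "graded_hom (free_module (cbasis ?T 0)) (free_module (cbasis G 0)) ?\<theta>"
    using graded_hom_collapse unfolding cmod_def .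
  note collapse_carrier = free_hom_carrier[OF collapse] and collapse_add = free_hom_add[OF collapse]
  have kernel: "\<epsilon> (?\<theta> z) \<in> ?N \<longleftrightarrow> z \<in> cdiff ?T 1 ` carrier (cmod ?T 1)" if z: "z \<in> carrier (cmod ?T 0)" for z
  proof -
    have z': "z \<in> carrier (free_module (cbasis ?T 0))" using z by (simp add: cmod_def)
    note tz = collapse_carrier[OF z']
    let ?v = "\<lambda>a. strand (cbasis ?T 0) a z"
    have v: "?v a \<in> supported_on (cstrand ?T a 0)" for a by (rule keys_strand[OF z'])
    have "\<epsilon> (?\<theta> z) \<in> ?N \<longleftrightarrow> (\<forall>a. a \<notin> ?E \<longrightarrow> component (\<epsilon> (?\<theta> z)) a = \<zero>\<^bsub>M\<^esub>)"
      by (rule mem_ideal_times_module_iff[OF I fg disj eps(1)[OF tz]])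
    also have "\<dots> \<longleftrightarrow> (\<forall>a. a \<notin> ?E \<longrightarrow> augmentation_row c 0 (?v a) \<in> mat_app (diff_matrix G 1) ` supported_on (cstrand G a 1))"
    proof -
      have "component (\<epsilon> (?\<theta> z)) a = \<zero>\<^bsub>M\<^esub> \<longleftrightarrow>
          augmentation_row c 0 (?v a) \<in> mat_app (diff_matrix G 1) ` supported_on (cstrand G a 1)" for a
      proof -
        have s: "strand (cbasis G 0) a (?\<theta> z) \<in> supported_on (cstrand G a 0)" by (rule keys_strand[OF tz])
        have "unstrand (cbasis G 0) a (strand (cbasis G 0) a (?\<theta> z)) \<in> carrier (cmod G 0)"
          unfolding cmod_def by (rule unstrand_carrier[OF s])
        from eps_zero_iff[OF this] show ?thesis
          using unstrand_boundary_iff[OF G(1) s] by (simp add: eps(4)[OF tz] strand_collapse[OF F(1) G(1) z])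
      qed
      then show ?thesis by simp
    qed
    also have "\<dots> \<longleftrightarrow> (\<forall>a. ?v a \<in> mat_app (diff_matrix ?T 1) ` supported_on (cstrand ?T a 1))"
    proof (intro iffI allI impI)
      fix a assume *: "\<forall>a. a \<notin> ?E \<longrightarrow> augmentation_row c 0 (?v a) \<in> mat_app (diff_matrix G 1) ` supported_on (cstrand G a 1)"
      define l where "l = (if a \<in> ?E then (\<lambda>_. 0) else c)"
      obtain e where e: "e \<in> supported_on (cstrand F a 0)"
        "\<And>w. w \<in> supported_on (cstrand F a 1) \<Longrightarrow> functional l (mat_app (diff_matrix F 1) w) = 0"
        "\<And>w. w \<in> supported_on (cstrand F a 0) \<Longrightarrow>
          w - pscale (functional l w) e \<in> mat_app (diff_matrix F 1) ` supported_on (cstrand F a 1)"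
        using aug[OF l_def] by blast
      have "augmentation_row l 0 (?v a) \<in> mat_app (diff_matrix G 1) ` supported_on (cstrand G a 1)"
      proof (cases "a \<in> ?E")
        case True
        have "augmentation_row l 0 (?v a) = 0"
          by (rule poly_mapping_eqI) (simp add: lookup_augmentation_row l_def True)
        then show ?thesis by (intro image_eqI[of _ _ 0]) simp_all
      qed (use * in \<open>simp add: l_def\<close>)
      then have "?v a \<in> mat_app (diff_matrix ?T (Suc 0)) ` supported_on (cstrand ?T a (Suc 0))"
        by (intro star_strand_boundary[OF F(1) G(1) F(2) e v]) simp_all
      then show "?v a \<in> mat_app (diff_matrix ?T 1) ` supported_on (cstrand ?T a 1)" by simp
    next
      fix a assume a: "a \<notin> ?E" and *: "\<forall>a. ?v a \<in> mat_app (diff_matrix ?T 1) ` supported_on (cstrand ?T a 1)"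
      obtain w where w: "w \<in> supported_on (cstrand ?T a (Suc 0))" "?v a = mat_app (diff_matrix ?T (Suc 0)) w"
        using spec[OF *, of a] by auto
      have "functional c (mat_app (diff_matrix F 1) u) = 0" if "u \<in> supported_on (cstrand F a 1)" for u
        using aug[of c a] a that by auto
      from augmentation_row_diff_matrix[OF F(1) G(1) this w(1)]
      show "augmentation_row c 0 (?v a) \<in> mat_app (diff_matrix G 1) ` supported_on (cstrand G a 1)"
        using augmentation_row_supported[OF F(1) G(1) w(1)] by (simp add: w(2))
    qed
    also have "\<dots> \<longleftrightarrow> z \<in> cdiff ?T 1 ` carrier (cmod ?T 1)"
      using boundary_iff_strands[OF T z] by simp
    finally show ?thesis .
  qed
  define \<eta> where "\<eta> x = ?N +>\<^bsub>M\<^esub> \<epsilon> (?\<theta> x)" for x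
  have eta: "graded_hom (cmod ?T 0) (quotient_module M ?N) \<eta>"
    unfolding \<eta>_def cmod_def
    by (rule graded_hom_comp[OF graded_hom_comp[OF collapse e1] q.graded_hom_coset]) (use gcomp_carrier in blast)
  have eta_eq: "\<eta> x = \<eta> y \<longleftrightarrow> x - y \<in> cdiff ?T 1 ` carrier (cmod ?T 1)"
    if x: "x \<in> carrier (cmod ?T 0)" and y: "y \<in> carrier (cmod ?T 0)" for x y
  proof -
    have y': "y \<in> carrier (free_module (cbasis ?T 0))" using y by (simp add: cmod_def)
    have d: "x - y \<in> carrier (free_module (cbasis ?T 0))"
      using x y keys_diff[of x y] by (auto simp: cmod_def carrier_free_module)
    have ed: "\<epsilon> (?\<theta> (x - y)) \<in> carrier M" "\<epsilon> (?\<theta> y) \<in> carrier M"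
      using eps(1) collapse_carrier d y' by auto
    have "\<epsilon> (?\<theta> x) = \<epsilon> (?\<theta> (x - y)) \<oplus>\<^bsub>M\<^esub> \<epsilon> (?\<theta> y)"
      using collapse_add[OF d y'] eps(2)[OF collapse_carrier[OF d] collapse_carrier[OF y']] by simp
    then have "\<epsilon> (?\<theta> x) \<ominus>\<^bsub>M\<^esub> \<epsilon> (?\<theta> y) = \<epsilon> (?\<theta> (x - y))"
      using ed by (simp add: a_minus_def a_assoc r_neg)
    moreover have "\<epsilon> (?\<theta> x) \<in> carrier M" using eps(1) collapse_carrier x by (simp add: cmod_def)
    ultimately show ?thesis
      using q.coset_eq_iff[OF _ ed(2)] kernel[of "x - y"] d by (simp add: \<eta>_def cmod_def)
  qed
  have eta_surj: "\<eta> ` carrier (cmod ?T 0) = carrier (quotient_module M ?N)"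
  proof
    show "\<eta> ` carrier (cmod ?T 0) \<subseteq> carrier (quotient_module M ?N)"
      using eta by (auto simp: graded_hom_def)
    let ?S = "{y \<in> carrier (free_module (cbasis G 0)). \<exists>x\<in>carrier (cmod ?T 0). \<eta> x = ?N +>\<^bsub>M\<^esub> \<epsilon> y}"
    have 0: "0 \<in> carrier (cmod ?T 0)" by (simp add: cmod_def carrier_free_module)
    have S0: "0 \<in> ?S"
      using 0 free_hom_zero[OF collapse] by (auto simp: \<eta>_def carrier_free_module[of 0] intro!: bexI[of _ 0])
    have Sadd: "y + z \<in> ?S" if yzS: "y \<in> ?S" "z \<in> ?S" for y z
    proof -
      obtain x w where xw: "x \<in> carrier (cmod ?T 0)" "\<eta> x = ?N +>\<^bsub>M\<^esub> \<epsilon> y" "w \<in> carrier (cmod ?T 0)" "\<eta> w = ?N +>\<^bsub>M\<^esub> \<epsilon> z"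
        using yzS by blast
      have yz: "y \<in> carrier (free_module (cbasis G 0))" "z \<in> carrier (free_module (cbasis G 0))" using yzS by auto
      have "\<eta> (x + w) = \<eta> x \<oplus>\<^bsub>quotient_module M ?N\<^esub> \<eta> w"
        using eta xw unfolding graded_hom_def by (simp add: cmod_def)
      also have "\<dots> = ?N +>\<^bsub>M\<^esub> \<epsilon> (y + z)"
        using xw yz eps(1,2) q.coset_add by simp
      finally have "\<eta> (x + w) = ?N +>\<^bsub>M\<^esub> \<epsilon> (y + z)" .
      moreover have "x + w \<in> carrier (cmod ?T 0)"
        using xw(1,3) unfolding cmod_def by (rule carrier_free_add)
      ultimately show ?thesis using carrier_free_add[OF yz] by (intro CollectI conjI bexI[of _ "x + w"])
    qed
    have Shom: "unstrand (cbasis G 0) a (strand (cbasis G 0) a y) \<in> ?S"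
      if y: "y \<in> carrier (free_module (cbasis G 0))" for a y
    proof -
      let ?r = "strand (cbasis G 0) a y"
      have r: "?r \<in> supported_on (cstrand G a 0)" by (rule keys_strand[OF y])
      have u: "unstrand (cbasis G 0) a ?r \<in> gcomp (free_module (cbasis G 0)) a" by (rule unstrand_in_gcomp[OF r])
      note uc = gcomp_carrier_free_module[OF u]
      have "\<exists>x\<in>carrier (cmod ?T 0). \<eta> x = ?N +>\<^bsub>M\<^esub> \<epsilon> (unstrand (cbasis G 0) a ?r)"
      proof (cases "a \<in> ?E")
        case True
        have "\<epsilon> (unstrand (cbasis G 0) a ?r) \<in> ?N"
          by (rule gcomp_in_ideal_times_module[OF I fg disj True hom_from_free_gcomp[OF e1 u]])
        then have "?N +>\<^bsub>M\<^esub> \<epsilon> (unstrand (cbasis G 0) a ?r) = ?N"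
          using q.coset_eq_self_iff[OF eps(1)[OF uc]] by simp
        moreover have "\<eta> 0 = ?N"
          using q.coset_eq_self_iff[of "\<zero>\<^bsub>M\<^esub>"] q.N_zero by (simp add: \<eta>_def free_hom_zero[OF collapse] eps(3))
        ultimately show ?thesis using 0 by auto
      next
        case False
        obtain e where e: "e \<in> supported_on (cstrand F a 0)" "functional c e = 1" using c(2)[OF False] by blast
        define Y where "Y j k g = (if j = 0 \<and> k = 0 then pscale (lookup ?r g) e else 0)" for j k :: nat and g
        have "total_element (cstrand F a) (cstrand G a) 0 Y"
        proof -
          have "{g. Y 0 0 g \<noteq> 0} \<subseteq> keys ?r" by (auto simp: Y_def in_keys_iff)
          moreover have "Y 0 0 g \<in> supported_on (cstrand F a 0)" for g
            using kvs.subspace_scale[OF subspace_supported_on e(1)] by (simp add: Y_def)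
          ultimately show ?thesis using r unfolding total_element_def
            by (auto intro: finite_subset)
        qed
        then obtain p where p: "p \<in> supported_on (cstrand ?T a 0)" "\<And>j k g. j + k = 0 \<Longrightarrow> tensor_column p j k g = Y j k g"
          by (rule assemble_tensor_columns[OF F(1) G(1)]) blast
        let ?x = "unstrand (cbasis ?T 0) a p"
        have x: "?x \<in> carrier (cmod ?T 0)" unfolding cmod_def by (rule unstrand_carrier[OF p(1)])
        have row: "augmentation_row c 0 p = ?r"
          by (rule poly_mapping_eqI)
             (simp add: lookup_augmentation_row p(2) Y_def functional_scale e(2))
        have row0: "augmentation_row c 0 (0 :: (nat \<times> nat) \<times> ('b \<times> 'c) \<Rightarrow>\<^sub>0 'k) = 0"
          by (rule poly_mapping_eqI) (simp add: lookup_augmentation_row)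
        have "?\<theta> ?x = unstrand (cbasis G 0) a ?r"
        proof (rule strand_eqI)
          fix a'
          show "strand (cbasis G 0) a' (?\<theta> ?x) = strand (cbasis G 0) a' (unstrand (cbasis G 0) a ?r)"
            unfolding strand_collapse[OF F(1) G(1) x] strand_unstrand[OF p(1)] strand_unstrand[OF r]
            by (simp add: row row0)
        qed
        then show ?thesis unfolding \<eta>_def by (intro bexI[OF _ x]) simp
      qed
      then show ?thesis using uc by (intro CollectI conjI)
    qed
    show "carrier (quotient_module M ?N) \<subseteq> \<eta> ` carrier (cmod ?T 0)"
    proof
      fix t assume "t \<in> carrier (quotient_module M ?N)"
      then obtain m where m: "m \<in> carrier M" "t = ?N +>\<^bsub>M\<^esub> m" unfolding q.carrier_quotient by blast
      then obtain y where y: "y \<in> carrier (free_module (cbasis G 0))" "m = \<epsilon> y"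
        using e2 unfolding cmod_def by blast
      have "y \<in> ?S" by (rule strands_closed[OF y(1) S0 Sadd Shom[OF y(1)]])
      then show "t \<in> \<eta> ` carrier (cmod ?T 0)" using m y by auto
    qed
  qed
  show ?thesis
    unfolding free_resolution_iff using T exT eta eta_surj eta_eq by (intro conjI allI exI[of _ \<eta>] ballI)
qed

theorem theorem1p2:
  fixes I :: "('v::finite, 'k::field) mpoly set"
    and M :: "('v, 'k, 'm) gmod"
    and F :: "('v, 'k, 'b) free_complex"
    and G :: "('v, 'k, 'c) free_complex"
  assumes "monomial_ideal I"
    and "multigraded_module M"
    and "finitely_generated M"
    and "Gens_ideal I \<inter> Gens_module M = {}"
    and "minimal_free_resolution F (quotient_module regular_module I)"
    and "minimal_free_resolution G M"
  shows "free_resolution (star_complex F G) (quotient_module M (ideal_times_module I M))"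
  using assms by (intro star_free_resolution) (simp_all add: minimal_free_resolution_def)

end
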